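(* Let $u,v$ be words in the alphabet $X=\{1<2<3<\cdots\}$. Then $P_{\mathrm{mix}}(u)=P_{\mathrm{mix}}(v)$ if and only if $u$ can be transformed into $v$ by a finite sequence of moves, each of which replaces a factor (a block of four consecutive letters) of the current word by the other side of one of the following relations, where $a,b,c,d\in X$: (R1) $abdc \equiv adbc$ for $a\le b\le c<d$; (R2) $acdb\equiv acbd$ for $a\le b<c\le d$; (R3) $dacb\equiv adcb$ for $a\le b<c<d$; (R4) $badc\equiv bdac$ for $a<b\le c<d$; (R5) $cbda\equiv cdba$ for $a<b<c\le d$; (R6) $dbca\equiv bdca$ for $a<b\le c<d$; (R7) $bcda\equiv bcad$ for $a<b\le c\le d$; (R8) $cadb\equiv cdab$ for $a\le b<c\le d$. Consequently, for words $u,u',v,v'$ with $P_{\mathrm{mix}}(u)=P_{\mathrm{mix}}(u')$ and $P_{\mathrm{mix}}(v)=P_{\mathrm{mix}}(v')$ one has $P_{\mathrm{mix}}(uv)=P_{\mathrm{mix}}(u'v')$, i.e. the mixed insertion tableau of a concatenation is determined by the mixed insertion tableaux of the factors.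
   Context: $X=\{1<2<3<\cdots\}$ and $X'=\{1'<1<2'<2<3'<3<\cdots\}$; words are finite sequences of letters of $X$. A strict partition is $\lambda=(\lambda_1>\lambda_2>\cdots>\lambda_l>0)$; its shifted diagram has $\lambda_i$ cells in row $i$, with row $i$ shifted $i-1$ units to the right of row $1$ (so the first cell of each row lies on the main diagonal). A (semistandard) shifted Young tableau of shape $\lambda$ is a filling of the shifted diagram with letters of $X'$ such that rows and columns weakly increase, each unprimed $k$ occurs at most once in each column, each primed $k'$ occurs at most once in each row, and there are no primed entries on the main diagonal. A standard shifted Young tableau of shape $\lambda$ contains each of $1,\dots,|\lambda|$ exactly once (no primes), with rows and columns increasing. Mixed insertion: for a word $w=w_1\cdots w_n$ build $(T_0,U_0)=(\emptyset,\emptyset),\dots,(T_n,U_n)$. To obtain $T_i$, insert $w_i$ into the first row of $T_{i-1}$: it bumps the smallest entry $a$ of that row strictly greater than it (in the order of $X'$), or is placed at the end of the row if there is none. Whenever an entry $a$ is bumped: if $a$ is not on the main diagonal and is unprimed, it is inserted in the same way into the next row; if $a$ is not on the main diagonal and is primed, it is inserted into the next column to the right, bumping the smallest entry of that column strictly greater than $a$ (or placed at the end of the column if none); if $a$ is on the main diagonal (it is then unprimed), it is primed and the letter $a'$ is inserted into the next column to the right. The process stops when a letter is placed at the end of a row or column without bumping. $U_i$ is $U_{i-1}$ with the entry $i$ in the new box. $P_{\mathrm{mix}}(w)=T_n$ (a shifted Young tableau) and $Q_{\mathrm{mix}}(w)=U_n$ (a standard shifted Young tableau). *)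

theory Defs
  imports Main
begin

text \<open>Letters of the primed alphabet X': a pair (k, p) stands for k' if p is True
  and for the unprimed k if p is False.  Order: 1' < 1 < 2' < 2 < ...\<close>
type_synonym xletter = "nat \<times> bool"

definition lt_x :: "xletter \<Rightarrow> xletter \<Rightarrow> bool" where
  "lt_x x y = (fst x < fst y \<or> (fst x = fst y \<and> snd x \<and> \<not> snd y))"

text \<open>A shifted tableau as a partial filling of cells (row, column), both 0-indexed;
  row i starts on the main diagonal at column i.\<close>
type_synonym tab = "nat \<times> nat \<Rightarrow> xletter option"

datatype target = Row nat | Col nat

fun cands :: "target \<Rightarrow> xletter \<Rightarrow> tab \<Rightarrow> (nat \<times> nat) set" where
  "cands (Row i) x T = {p. fst p = i \<and> (\<exists>y. T p = Some y \<and> lt_x x y)}"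
| "cands (Col c) x T = {p. snd p = c \<and> (\<exists>y. T p = Some y \<and> lt_x x y)}"

text \<open>The cell of the smallest entry strictly greater than x (leftmost in a row,
  topmost in a column; rows and columns weakly increase).\<close>
fun bump_pos :: "target \<Rightarrow> xletter \<Rightarrow> tab \<Rightarrow> nat \<times> nat" where
  "bump_pos (Row i) x T = (i, Min (snd ` cands (Row i) x T))"
| "bump_pos (Col c) x T = (Min (fst ` cands (Col c) x T), c)"

fun end_pos :: "target \<Rightarrow> tab \<Rightarrow> nat \<times> nat" where
  "end_pos (Row i) T = (i, if \<exists>j. T (i, j) \<noteq> None then Suc (Max {j. T (i, j) \<noteq> None}) else i)"
| "end_pos (Col c) T = (if \<exists>i. T (i, c) \<noteq> None then Suc (Max {i. T (i, c) \<noteq> None}) else 0, c)"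

definition next_step :: "nat \<times> nat \<Rightarrow> xletter \<Rightarrow> target \<times> xletter" where
  "next_step p a =
     (if fst p = snd p then (Col (Suc (snd p)), (fst a, True))
      else if snd a then (Col (Suc (snd p)), a)
      else (Row (Suc (fst p)), a))"

inductive ins_rel :: "target \<Rightarrow> xletter \<Rightarrow> tab \<Rightarrow> tab \<Rightarrow> bool" where
  place: "cands t x T = {} \<Longrightarrow> ins_rel t x T (T(end_pos t T := Some x))"
| bump: "cands t x T \<noteq> {} \<Longrightarrow> p = bump_pos t x T \<Longrightarrow> T p = Some a \<Longrightarrow>
         next_step p a = (t', a') \<Longrightarrow> ins_rel t' a' (T(p := Some x)) T' \<Longrightarrow>
         ins_rel t x T T'"

definition mix_insert :: "tab \<Rightarrow> nat \<Rightarrow> tab" where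
  "mix_insert T k = (THE T'. ins_rel (Row 0) (k, False) T T')"

definition P_mix :: "nat list \<Rightarrow> tab" where
  "P_mix w = foldl mix_insert (\<lambda>_. None) w"

definition is_word :: "nat list \<Rightarrow> bool" where
  "is_word w = (\<forall>x\<in>set w. 1 \<le> x)"

definition mix_rel :: "nat list \<Rightarrow> nat list \<Rightarrow> bool" where
  "mix_rel p q = (\<exists>a b c d.
     (a \<le> b \<and> b \<le> c \<and> c < d \<and> p = [a,b,d,c] \<and> q = [a,d,b,c]) \<or>
     (a \<le> b \<and> b < c \<and> c \<le> d \<and> p = [a,c,d,b] \<and> q = [a,c,b,d]) \<or>
     (a \<le> b \<and> b < c \<and> c < d \<and> p = [d,a,c,b] \<and> q = [a,d,c,b]) \<or>
     (a < b \<and> b \<le> c \<and> c < d \<and> p = [b,a,d,c] \<and> q = [b,d,a,c]) \<or>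
     (a < b \<and> b < c \<and> c \<le> d \<and> p = [c,b,d,a] \<and> q = [c,d,b,a]) \<or>
     (a < b \<and> b \<le> c \<and> c < d \<and> p = [d,b,c,a] \<and> q = [b,d,c,a]) \<or>
     (a < b \<and> b \<le> c \<and> c \<le> d \<and> p = [b,c,d,a] \<and> q = [b,c,a,d]) \<or>
     (a \<le> b \<and> b < c \<and> c \<le> d \<and> p = [c,a,d,b] \<and> q = [c,d,a,b]))"

definition mix_move :: "nat list \<Rightarrow> nat list \<Rightarrow> bool" where
  "mix_move u v = (\<exists>x y p q. u = x @ p @ y \<and> v = x @ q @ y \<and> (mix_rel p q \<or> mix_rel q p))"

end

theory Submission
  imports Defs
begin

text \<open>Replace every letter \<open>x\<close> of a word by \<open>x, -x\<close> and insert positive letters by rows and negative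
  letters by columns, into an unshifted tableau: the result is the mixed insertion tableau together
  with its mirror image. If letters are processed by increasing absolute value, each of them is the
  largest or the smallest processed so far; therefore Knuth moves of the doubled word preserve
  its tableau, and they act on the sequence of new cells as Knuth moves with respect to the content
  (elementary dual equivalences). One fixed sequence of Knuth moves turns the doubled left-hand side
  of each of the eight relations into the doubled right-hand side, so the relations preserve the
  mixed insertion tableau.

  Conversely, insertion can be reversed from every corner of the shape. If two words with the same
  tableau differ in the last new cell, reverse insertion yields a word whose last four letters form
  a left-hand side and whose last two new cells are these two corners; the sequence of Knuth moves
  above shows that the relation exchanges them. Induction on the length connects the two words.

  Words with repeated letters are standardized.\<close>

section \<open>Growth of Young diagrams\<close>

text \<open>Doubling removes the diagonal rule. When an unprimed \<open>k\<close> on the diagonal is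
  bumped, the copy \<open>k\<close> drops by its row rule onto the mirror cell and drives
  \<open>-k\<close> from there across the diagonal into the next column. From then on the upper half
  carries \<open>-k\<close>, which moves along columns: this is the priming. Instead of bumping
  paths, a tableau is stored as the cells by which its letters, in the order of \<open>lev\<close>,
  enlarge the shape. Insertion then is a recursion with one local rule, \<open>push\<close>, and
  properties of insertion follow by checking that rule. A single list of Knuth moves can serve eight
  relations because a move on a monotone triple does nothing, and because the left-hand sides are
  just the eight orderings of four letters with a peak in third place. The list is read twice: on
  letters it yields the relation, on contents of new cells it tells where the cells go. Invariance
  and connectedness both rest on this double reading.\<close>

type_synonym cell = "nat \<times> nat"

definition Young :: "cell set \<Rightarrow> bool" where
  "Young S \<longleftrightarrow> finite S \<and> (\<forall>i j. (i, j) \<in> S \<longrightarrow> (\<forall>i' j'. i' \<le> i \<longrightarrow> j' \<le> j \<longrightarrow> (i', j') \<in> S))"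

definition addable :: "cell set \<Rightarrow> cell \<Rightarrow> bool" where
  "addable S c \<longleftrightarrow> c \<notin> S \<and> Young S \<and> Young (insert c S)"

definition rowend :: "cell set \<Rightarrow> nat \<Rightarrow> cell" where
  "rowend S i = (i, LEAST j. (i, j) \<notin> S)"

definition colend :: "cell set \<Rightarrow> nat \<Rightarrow> cell" where
  "colend S j = (LEAST i. (i, j) \<notin> S, j)"

definition rightof :: "cell \<Rightarrow> cell \<Rightarrow> bool" where
  "rightof c c' \<longleftrightarrow> fst c' \<le> fst c \<and> snd c < snd c'"

definition belowof :: "cell \<Rightarrow> cell \<Rightarrow> bool" where
  "belowof c c' \<longleftrightarrow> fst c < fst c' \<and> snd c' \<le> snd c"

lemma YoungD: "Young S \<Longrightarrow> (i, j) \<in> S \<Longrightarrow> i' \<le> i \<Longrightarrow> j' \<le> j \<Longrightarrow> (i', j') \<in> S"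
  unfolding Young_def by blast

lemma Young_finite: "Young S \<Longrightarrow> finite S"
  unfolding Young_def by blast

lemma Young_empty [simp]: "Young {}"
  unfolding Young_def by blast

lemma finite_row_free: "finite (S :: cell set) \<Longrightarrow> \<exists>j. i \<le> j \<and> (k, j) \<notin> S"
proof -
  assume "finite S"
  then have "finite (snd ` S)" by simp
  then obtain m where m: "\<forall>n \<in> snd ` S. n < m" using finite_nat_set_iff_bounded by auto
  have "(k, max i m) \<notin> S" using m by force
  then show ?thesis by (intro exI[of _ "max i m"]) simp
qed

lemma finite_col_free: "finite (S :: cell set) \<Longrightarrow> \<exists>i. (i, j) \<notin> S"
proof -
  assume "finite S"
  then have "finite (fst ` S)" by simp
  then obtain m where "\<forall>n \<in> fst ` S. n < m" using finite_nat_set_iff_bounded by auto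
  then have "(m, j) \<notin> S" by force
  then show ?thesis ..
qed

lemma rowend_eqI: "(i, j) \<notin> S \<Longrightarrow> (\<And>j'. j' < j \<Longrightarrow> (i, j') \<in> S) \<Longrightarrow> rowend S i = (i, j)"
  unfolding rowend_def by (auto intro!: Least_equality simp: not_less[symmetric])

lemma colend_eqI: "(i, j) \<notin> S \<Longrightarrow> (\<And>i'. i' < i \<Longrightarrow> (i', j) \<in> S) \<Longrightarrow> colend S j = (i, j)"
  unfolding colend_def by (auto intro!: Least_equality simp: not_less[symmetric])

lemma rowend_notin: "finite S \<Longrightarrow> rowend S i \<notin> S"
  unfolding rowend_def using finite_row_free by (metis (mono_tags, lifting) LeastI)

lemma colend_notin: "finite S \<Longrightarrow> colend S i \<notin> S"
  unfolding colend_def using finite_col_free by (metis (mono_tags, lifting) LeastI)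

lemma rowend_below: "j < snd (rowend S i) \<Longrightarrow> (i, j) \<in> S"
  unfolding rowend_def using not_less_Least by fastforce

lemma colend_below: "i < fst (colend S j) \<Longrightarrow> (i, j) \<in> S"
  unfolding colend_def using not_less_Least by fastforce

lemma fst_rowend [simp]: "fst (rowend S i) = i"
  by (simp add: rowend_def)

lemma snd_colend [simp]: "snd (colend S j) = j"
  by (simp add: colend_def)

lemma addable_rowend: "addable S c \<Longrightarrow> rowend S (fst c) = c"
  unfolding addable_def Young_def
  by (cases c) (auto intro!: rowend_eqI, metis less_imp_le_nat nat_neq_iff order_refl prod.inject)

lemma addable_colend: "addable S c \<Longrightarrow> colend S (snd c) = c"
  unfolding addable_def Young_def
  by (cases c) (auto intro!: colend_eqI, metis less_imp_le_nat nat_neq_iff order_refl prod.inject)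

lemma Young_insertI:
  assumes "Young S" "\<And>i'. i' < i \<Longrightarrow> (i', j) \<in> S" "\<And>j'. j' < j \<Longrightarrow> (i, j') \<in> S"
  shows "Young (insert (i, j) S)"
proof -
  have "(i', j') \<in> insert (i, j) S" if "i' \<le> i" "j' \<le> j" for i' j'
  proof -
    have "i' = i \<and> j' = j \<or> i' < i \<or> i' = i \<and> j' < j" using that by auto
    then consider "i' = i" "j' = j" | "i' < i" | "i' = i" "j' < j" by blast
    then show ?thesis
      by cases (use assms(2,3) that YoungD[OF assms(1)] in blast)+
  qed
  then show ?thesis using assms(1) unfolding Young_def by auto
qed

lemma addable_rowend0: "Young S \<Longrightarrow> addable S (rowend S 0)"
  unfolding addable_def
  using Young_insertI[of S "fst (rowend S 0)" "snd (rowend S 0)"] rowend_below[of _ S 0] rowend_notin[of S 0] Young_finite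
  by (simp) (metis fst_rowend less_nat_zero_code prod.collapse)

lemma addable_colend0: "Young S \<Longrightarrow> addable S (colend S 0)"
  unfolding addable_def
  using Young_insertI[of S "fst (colend S 0)" "snd (colend S 0)"] colend_below[of _ S 0] colend_notin[of S 0] Young_finite
  by (simp) (metis snd_colend less_nat_zero_code prod.collapse)

text \<open>The row below \<open>p\<close> ends weakly left of \<open>p\<close>, since otherwise
  \<open>p\<close> would have been forced into \<open>S\<close> before; so all cells above its end
  are present. This makes the place of a bumped letter legal.\<close>

lemma addable_next_row:
  assumes "addable S p"
  shows "addable (insert p S) (rowend (insert p S) (Suc (fst p)))"
proof -
  obtain i j where p: "p = (i, j)" by force
  let ?S = "insert p S"
  have Y: "Young ?S" "Young S" "p \<notin> S" using assms by (auto simp: addable_def)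
  obtain m where m: "rowend ?S (Suc i) = (Suc i, m)" by (simp add: rowend_def)
  have mb: "(Suc i, j') \<in> ?S" if "j' < m" for j' using rowend_below[of j' ?S "Suc i"] m that by simp
  have "m \<le> j"
  proof (rule ccontr)
    assume "\<not> m \<le> j"
    then have "(Suc i, j) \<in> ?S" using mb by simp
    then have "(i, j) \<in> S" using p YoungD[OF Y(2), of "Suc i" j i j] by simp
    then show False using p Y by simp
  qed
  then have "(i', m) \<in> ?S" if "i' < Suc i" for i'
    using YoungD[OF Y(1), of i j i' m] that p by simp
  moreover have "(Suc i, m) \<notin> ?S" using rowend_notin[of ?S "Suc i"] m Young_finite[OF Y(1)] by simp
  ultimately show ?thesis
    using Young_insertI[OF Y(1), of "Suc i" m] mb Y p m by (simp add: addable_def)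
qed

lemma addable_next_col:
  assumes "addable S p"
  shows "addable (insert p S) (colend (insert p S) (Suc (snd p)))"
proof -
  obtain i j where p: "p = (i, j)" by force
  let ?S = "insert p S"
  have Y: "Young ?S" "Young S" "p \<notin> S" using assms by (auto simp: addable_def)
  obtain m where m: "colend ?S (Suc j) = (m, Suc j)" by (simp add: colend_def)
  have mb: "(j', Suc j) \<in> ?S" if "j' < m" for j' using colend_below[of j' ?S "Suc j"] m that by simp
  have "m \<le> i"
  proof (rule ccontr)
    assume "\<not> m \<le> i"
    then have "(i, Suc j) \<in> ?S" using mb by simp
    then have "(i, j) \<in> S" using p YoungD[OF Y(2), of i "Suc j" i j] by simp
    then show False using p Y by simp
  qed
  then have "(m, j') \<in> ?S" if "j' < Suc j" for j'
    using YoungD[OF Y(1), of i j m j'] that p by simp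
  moreover have "(m, Suc j) \<notin> ?S" using colend_notin[of ?S "Suc j"] m Young_finite[OF Y(1)] by simp
  ultimately show ?thesis
    using Young_insertI[OF Y(1), of m "Suc j"] mb Y p m by (simp add: addable_def)
qed

lemma addable_other:
  assumes "addable S p" "addable S c" "p \<noteq> c"
  shows "addable (insert c S) p"
  using assms unfolding addable_def Young_def by auto

text \<open>The second cell is not weakly northwest of the first, being outside the shape, and not
  strictly southeast, since the shape would then have contained \<open>c\<close> already. Hence one
  coordinate decides between \<open>rightof\<close> and \<open>belowof\<close>.\<close>

lemma addable_chain:
  assumes "addable S c" "addable (insert c S) c'"
  shows "rightof c c' \<longleftrightarrow> fst c' \<le> fst c" "rightof c c' \<longleftrightarrow> snd c < snd c'"
    "belowof c c' \<longleftrightarrow> fst c < fst c'" "belowof c c' \<longleftrightarrow> snd c' \<le> snd c"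
proof -
  obtain i j i' j' where c: "c = (i, j)" "c' = (i', j')" by force
  have Y: "Young (insert c S)" "Young (insert c' (insert c S))" "c \<notin> S" "c' \<notin> insert c S" "Young S"
    using assms by (auto simp: addable_def)
  have 1: "\<not> (i' \<le> i \<and> j' \<le> j)"
    using YoungD[OF Y(1), of i j i' j'] Y(4) c by auto
  have 2: "\<not> (i' > i \<and> j' > j)"
  proof
    assume a: "i' > i \<and> j' > j"
    then have "(i, j') \<in> insert c' (insert c S)" using YoungD[OF Y(2), of i' j' i j'] c by auto
    then have "(i, j') \<in> S" using a c by auto
    then have "(i, j) \<in> S" using YoungD[OF Y(5), of i j' i j] a by auto
    then show False using Y c by auto
  qed
  show "rightof c c' \<longleftrightarrow> fst c' \<le> fst c" "rightof c c' \<longleftrightarrow> snd c < snd c'"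
    "belowof c c' \<longleftrightarrow> fst c < fst c'" "belowof c c' \<longleftrightarrow> snd c' \<le> snd c"
    using 1 2 unfolding rightof_def belowof_def c by auto
qed

text \<open>A positive letter moves along rows and a negative one along columns; \<open>crd k\<close> is the
  coordinate that identifies the line on which the letter \<open>k\<close> lies. The order by \<open>lev\<close> is
  \<open>1, -1, 2, -2, ...\<close>; a tableau is the list of its letters and their cells in decreasing order.\<close>

definition crd :: "int \<Rightarrow> cell \<Rightarrow> nat" where
  "crd k c = (if k > 0 then fst c else snd c)"

definition lineend :: "int \<Rightarrow> cell set \<Rightarrow> nat \<Rightarrow> cell" where
  "lineend k S i = (if k > 0 then rowend S i else colend S i)"

definition lev :: "int \<Rightarrow> int" where
  "lev k = (if k > 0 then 2 * k else 1 - 2 * k)"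

abbreviation ushape :: "(int \<times> cell) list \<Rightarrow> cell set" where
  "ushape S \<equiv> snd ` set S"

abbreviation uletters :: "(int \<times> cell) list \<Rightarrow> int set" where
  "uletters S \<equiv> fst ` set S"

text \<open>A local growth rule: \<open>S\<close> is the shape of the letters below
  \<open>k\<close>, \<open>p\<close> the cell of \<open>k\<close>, and \<open>c\<close> the cell by
  which an insertion enlarges \<open>S\<close>. The results are the new cell of \<open>k\<close> and
  the cell by which the shape including \<open>k\<close> grows.\<close>

definition push :: "int \<Rightarrow> cell set \<Rightarrow> cell \<Rightarrow> cell \<Rightarrow> cell \<times> cell" where
  "push k S p c = (if c = p then (let q = lineend k (insert p S) (Suc (crd k p)) in (q, q)) else (p, c))"

fun uins :: "int \<Rightarrow> (int \<times> cell) list \<Rightarrow> cell \<times> (int \<times> cell) list" where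
  "uins x [] = ((0, 0), [(x, (0, 0))])"
| "uins x ((k, p) # S) =
     (if lev x < lev k
      then (let (c, S') = uins x S; (q, d) = push k (ushape S) p c in (d, (k, q) # S'))
      else (let q = lineend x (ushape ((k, p) # S)) 0 in (q, (x, q) # (k, p) # S)))"

fun uvalid :: "(int \<times> cell) list \<Rightarrow> bool" where
  "uvalid [] = True"
| "uvalid ((k, p) # S) = (uvalid S \<and> addable (ushape S) p \<and> k \<noteq> 0 \<and> (\<forall>l \<in> uletters S. lev l < lev k))"

fun urun :: "int list \<Rightarrow> (int \<times> cell) list \<Rightarrow> cell list \<times> (int \<times> cell) list" where
  "urun [] S = ([], S)"
| "urun (x # xs) S = (let (c, S1) = uins x S; (cs, S2) = urun xs S1 in (c # cs, S2))"

lemma crd_lineend [simp]: "crd k (lineend k S i) = i"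
  by (simp add: crd_def lineend_def)

lemma addable_lineend: "addable S c \<Longrightarrow> lineend k S (crd k c) = c"
  by (simp add: crd_def lineend_def addable_rowend addable_colend)

lemma addable_lineend0: "Young S \<Longrightarrow> addable S (lineend k S 0)"
  by (simp add: lineend_def addable_rowend0 addable_colend0)

lemma addable_next_line: "addable S p \<Longrightarrow> addable (insert p S) (lineend k (insert p S) (Suc (crd k p)))"
  by (simp add: lineend_def crd_def addable_next_row addable_next_col)

lemma lineend_insert: "crd k c \<noteq> i \<Longrightarrow> lineend k (insert c S) i = lineend k S i"
  by (cases c) (auto simp: lineend_def crd_def rowend_def colend_def intro!: arg_cong[where f = Least])

text \<open>A line has only one addable cell. So cells can be replaced by one of their coordinates,
  and \<open>push\<close> becomes arithmetic on line numbers.\<close>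

lemma addable_eq_iff_crd: "addable S c \<Longrightarrow> addable S p \<Longrightarrow> c = p \<longleftrightarrow> crd k c = crd k p"
  using addable_lineend by metis

lemma push_props:
  assumes "addable S p" "addable S c" "push k S p c = (q, d)"
  shows "addable (insert c S) q" "addable (insert p S) d" "insert q (insert c S) = insert d (insert p S)"
    "crd k q = (if crd k c = crd k p then Suc (crd k p) else crd k p)"
    "crd k d = (if crd k c = crd k p then Suc (crd k p) else crd k c)"
proof -
  note * = assms(3)[unfolded push_def Let_def]
  have iff: "c = p \<longleftrightarrow> crd k c = crd k p" using addable_eq_iff_crd assms by blast
  show "addable (insert c S) q" "addable (insert p S) d" "insert q (insert c S) = insert d (insert p S)"
    using * addable_next_line[OF assms(1), of k] addable_other[OF assms(1,2)] addable_other[OF assms(2,1)]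
    by (auto split: if_splits)
  show "crd k q = (if crd k c = crd k p then Suc (crd k p) else crd k p)"
    "crd k d = (if crd k c = crd k p then Suc (crd k p) else crd k c)"
    using * iff by (auto split: if_splits)
qed

lemma lev_neq: "x \<noteq> 0 \<Longrightarrow> k \<noteq> 0 \<Longrightarrow> x \<noteq> k \<Longrightarrow> lev x \<noteq> lev k"
  unfolding lev_def by (auto; presburger)

lemma addable_origin: "addable {} (0, 0)"
  by (auto simp: addable_def Young_def)

lemma uvalid_Young: "uvalid S \<Longrightarrow> Young (ushape S)"
  by (cases S) (auto simp: addable_def)

lemma uins_props:
  assumes "uvalid S" "x \<noteq> 0" "x \<notin> uletters S" "uins x S = (c, S')"
  shows "uvalid S' \<and> uletters S' = insert x (uletters S) \<and> ushape S' = insert c (ushape S) \<and> addable (ushape S) c"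
  using assms
proof (induction S arbitrary: c S')
  case Nil
  then show ?case using addable_origin by auto
next
  case (Cons e S)
  obtain k p where e: "e = (k, p)" by (cases e)
  show ?case
  proof (cases "lev x < lev k")
    case True
    obtain c0 S0 where c0: "uins x S = (c0, S0)" by (cases "uins x S")
    obtain q d where q: "push k (ushape S) p c0 = (q, d)" by (cases "push k (ushape S) p c0")
    have IH: "uvalid S0" "uletters S0 = insert x (uletters S)" "ushape S0 = insert c0 (ushape S)" "addable (ushape S) c0"
      using Cons.IH[OF _ _ _ c0] Cons.prems e by auto
    have r: "c = d" "S' = (k, q) # S0" using Cons.prems(4) e True c0 q by auto
    note pp = push_props[OF _ IH(4) q]
    show ?thesis using Cons.prems(1) IH pp r True e by auto
  next
    case False
    let ?q = "lineend x (ushape (e # S)) 0"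
    have "c = ?q" "S' = (x, ?q) # e # S" using Cons.prems(4) e False by (auto simp: Let_def)
    moreover have "lev k < lev x" using False lev_neq[of x k] Cons.prems e by auto
    moreover have "addable (ushape (e # S)) ?q" using addable_lineend0 uvalid_Young Cons.prems(1) by blast
    ultimately show ?thesis using Cons.prems e by auto
  qed
qed

lemma uins_top:
  assumes "\<forall>l \<in> uletters S. lev l < lev x"
  shows "uins x S = (lineend x (ushape S) 0, (x, lineend x (ushape S) 0) # S)"
proof (cases S)
  case Nil
  have "lineend x {} 0 = (0, 0)" by (auto simp: lineend_def intro: rowend_eqI colend_eqI)
  then show ?thesis using Nil by simp
next
  case (Cons e S0)
  then show ?thesis using assms by (cases e) (auto simp: Let_def)
qed

lemma chain_crd:
  assumes "addable S c" "addable (insert c S) c'"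
  shows "(if k > 0 then rightof c c' else belowof c c') \<longleftrightarrow> crd k c' \<le> crd k c"
    "(if k > 0 then belowof c c' else rightof c c') \<longleftrightarrow> crd k c < crd k c'"
  using addable_chain[OF assms] by (auto simp: crd_def)

lemma lev_less_pos: "lev x < lev y \<Longrightarrow> 0 < y \<Longrightarrow> x < y"
  by (auto simp: lev_def split: if_splits)

lemma lev_less_neg: "lev x < lev y \<Longrightarrow> y < 0 \<Longrightarrow> y < x"
  by (auto simp: lev_def split: if_splits)

lemma uins_adjacent_top:
  assumes "uvalid S" "x \<noteq> 0" "y \<noteq> 0" "x \<notin> uletters S" "y \<notin> uletters S"
    "uins x S = (c, S1)" "uins y S1 = (c', S2)" "lev k < lev m" "\<forall>l \<in> uletters S. lev l < lev m"
    "k = x \<and> m = y \<or> k = y \<and> m = x"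
  shows "(if x < y then rightof c c' else belowof c c')"
proof -
  have u1: "uvalid S1" "uletters S1 = insert x (uletters S)" "ushape S1 = insert c (ushape S)" "addable (ushape S) c"
    using uins_props[OF assms(1,2,4,6)] by auto
  have ne: "x \<noteq> y" using assms(8,10) by auto
  have u2: "addable (insert c (ushape S)) c'"
    using uins_props[OF u1(1) assms(3) _ assms(7)] u1 assms(5) ne by auto
  note lt = lev_less_pos[OF assms(8)] lev_less_neg[OF assms(8)]
  from assms(10) show ?thesis
  proof
    assume km: "k = x \<and> m = y"
    then have "\<forall>l \<in> uletters S1. lev l < lev y" using u1(2) assms(8,9) by simp
    then have "c' = lineend y (ushape S1) 0" using assms(7) uins_top[of S1 y] by auto
    then have "crd y c' \<le> crd y c" by simp
    then show ?thesis using chain_crd(1)[OF u1(4) u2, of y] lt km assms(3) by (auto split: if_splits)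
  next
    assume km: "k = y \<and> m = x"
    then have top: "c = lineend x (ushape S) 0" "S1 = (x, c) # S"
      using assms(6,9) uins_top[of S x] by auto
    obtain b T where b: "uins y S = (b, T)" by (cases "uins y S")
    obtain q d where q: "push x (ushape S) c b = (q, d)" by (cases "push x (ushape S) c b")
    have "c' = d" using assms(7,8) top(2) km b q by auto
    moreover have "addable (ushape S) b" using uins_props[OF assms(1,3,5) b] by auto
    moreover have "crd x c = 0" using top by simp
    ultimately have "crd x c < crd x c'" using push_props(5)[OF u1(4) _ q] by (auto split: if_splits)
    then show ?thesis using chain_crd(2)[OF u1(4) u2, of x] lt km assms(2) by (auto split: if_splits)
  qed
qed

text \<open>Ascents give steps to the right, descents steps down. A stored letter above both does
  not disturb this, since \<open>push\<close> preserves the weak comparison of the two coordinates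
  in its direction; otherwise one of \<open>x\<close>, \<open>y\<close> is on top.\<close>

lemma uins_adjacent:
  assumes "uvalid S" "x \<noteq> 0" "y \<noteq> 0" "x \<noteq> y" "x \<notin> uletters S" "y \<notin> uletters S"
    "uins x S = (c, S1)" "uins y S1 = (c', S2)"
  shows "(if x < y then rightof c c' else belowof c c')"
  using assms
proof (induction S arbitrary: c S1 c' S2)
  case Nil
  have "lev x < lev y \<or> lev y < lev x" using lev_neq[OF Nil(2-4)] by linarith
  then show ?case using uins_adjacent_top[OF Nil(1-3,5-8), of x y] uins_adjacent_top[OF Nil(1-3,5-8), of y x] by auto
next
  case (Cons e S)
  obtain k p where e: "e = (k, p)" by (cases e)
  have v: "uvalid S" "addable (ushape S) p" "k \<noteq> 0" "x \<noteq> k" "y \<noteq> k" and kS: "\<forall>l \<in> uletters S. lev l < lev k"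
    using Cons.prems e by auto
  have "lev x \<noteq> lev y" "lev x \<noteq> lev k" "lev y \<noteq> lev k"
    using lev_neq Cons.prems(2-4) v(3-5) by blast+
  then have "lev x < lev k \<and> lev y < lev k \<or> lev y < lev x \<and> lev k < lev x \<or> lev x < lev y \<and> lev k < lev y"
    by linarith
  then consider (low) "lev x < lev k" "lev y < lev k" | (x) "lev y < lev x" "lev k < lev x" | (y) "lev x < lev y" "lev k < lev y"
    by blast
  then show ?case
  proof cases
    case low
    obtain a T1 where a: "uins x S = (a, T1)" by (cases "uins x S")
    obtain b T2 where b: "uins y T1 = (b, T2)" by (cases "uins y T1")
    have t1: "uvalid T1" "uletters T1 = insert x (uletters S)" "ushape T1 = insert a (ushape S)" "addable (ushape S) a"
      using uins_props[OF v(1) Cons.prems(2) _ a] Cons.prems e by auto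
    have t2: "addable (insert a (ushape S)) b"
      using uins_props[OF t1(1) Cons.prems(3) _ b] t1 Cons.prems e by auto
    have IH: "if x < y then rightof a b else belowof a b"
      using Cons.IH[OF v(1) Cons.prems(2-4) _ _ a b] Cons.prems e by auto
    obtain q d where q: "push k (ushape S) p a = (q, d)" by (cases "push k (ushape S) p a")
    have S1: "c = d" "S1 = (k, q) # T1" using Cons.prems(7) e low a q by auto
    obtain q' d' where q': "push k (insert a (ushape S)) q b = (q', d')" by (cases "push k (insert a (ushape S)) q b")
    have c': "c' = d'" using Cons.prems(8) S1 low b q' t1 by auto
    note pp = push_props[OF v(2) t1(4) q]
    note pp' = push_props[OF pp(1) t2 q']
    have ch: "addable (ushape (e # S)) c" "addable (insert c (ushape (e # S))) c'"
      using pp(2,3) pp'(2) S1 c' e by auto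
    show ?thesis
      using IH chain_crd[OF t1(4) t2, of k] chain_crd[OF ch, of k] pp(4,5) pp'(4,5) S1 c'
      by (auto split: if_splits)
  next
    case x
    then have "\<forall>l \<in> uletters (e # S). lev l < lev x" using kS e by auto
    then show ?thesis using uins_adjacent_top[OF Cons.prems(1-3,5-8) x(1)] by blast
  next
    case y
    then have "\<forall>l \<in> uletters (e # S). lev l < lev y" using kS e by auto
    then show ?thesis using uins_adjacent_top[OF Cons.prems(1-3,5-8) y(1)] by blast
  qed
qed

section \<open>Knuth relations on words, on lines and on cells\<close>

text \<open>Knuth relations for sequences of line numbers, equal numbers counting as decreasing from
  left to right, in accordance with \<open>chain_crd\<close>.\<close>

definition knuth_lines :: "nat \<times> nat \<times> nat \<Rightarrow> nat \<times> nat \<times> nat \<Rightarrow> bool" where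
  "knuth_lines u v \<longleftrightarrow>
     (\<exists>a b z. b < z \<and> z \<le> a \<and> (u = (a, b, z) \<and> v = (b, a, z) \<or> v = (a, b, z) \<and> u = (b, a, z))) \<or>
     (\<exists>a b z. b \<le> a \<and> a < z \<and> (u = (a, b, z) \<and> v = (a, z, b) \<or> v = (a, b, z) \<and> u = (a, z, b)))"

definition knuth_cells :: "cell \<times> cell \<times> cell \<Rightarrow> cell \<times> cell \<times> cell \<Rightarrow> bool" where
  "knuth_cells u v \<longleftrightarrow>
     (\<exists>a b z. rightof a b \<and> belowof b z \<and> rightof a z \<and>
        (u = (a, b, z) \<and> v = (b, a, z) \<or> v = (a, b, z) \<and> u = (b, a, z))) \<or>
     (\<exists>a b z. rightof a b \<and> belowof b z \<and> belowof a z \<and>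
        (u = (a, b, z) \<and> v = (a, z, b) \<or> v = (a, b, z) \<and> u = (a, z, b)))"

definition knuth_words :: "int \<times> int \<times> int \<Rightarrow> int \<times> int \<times> int \<Rightarrow> bool" where
  "knuth_words u v \<longleftrightarrow>
     (\<exists>x y z. (x < z \<and> z < y \<or> y < z \<and> z < x) \<and> u = (x, y, z) \<and> v = (y, x, z)) \<or>
     (\<exists>x y z. (y < x \<and> x < z \<or> z < x \<and> x < y) \<and> u = (x, y, z) \<and> v = (x, z, y))"

abbreviation chain3 :: "cell set \<Rightarrow> cell \<times> cell \<times> cell \<Rightarrow> bool" where
  "chain3 S u \<equiv> (case u of (a, b, z) \<Rightarrow>
     addable S a \<and> addable (insert a S) b \<and> addable (insert b (insert a S)) z)"

abbreviation crd3 :: "int \<Rightarrow> cell \<times> cell \<times> cell \<Rightarrow> nat \<times> nat \<times> nat" where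
  "crd3 k u \<equiv> (case u of (a, b, z) \<Rightarrow> (crd k a, crd k b, crd k z))"

lemma knuth_lines_sym: "knuth_lines u v \<Longrightarrow> knuth_lines v u"
  unfolding knuth_lines_def by blast

lemma knuth_cells_sym: "knuth_cells u v \<Longrightarrow> knuth_cells v u"
  unfolding knuth_cells_def by blast

text \<open>\<open>rightof\<close> and \<open>belowof\<close> bound both coordinates, so the
  relation between cells does not depend on a direction. The passage through cells is what allows
  positive and negative letters in one induction.\<close>

lemma knuth_lines_of_cells:
  assumes "knuth_cells u v"
  shows "knuth_lines (crd3 k u) (crd3 k v)"
proof -
  from assms consider a b z where "rightof a b" "belowof b z" "rightof a z"
      "u = (a, b, z) \<and> v = (b, a, z) \<or> v = (a, b, z) \<and> u = (b, a, z)"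
    | a b z where "rightof a b" "belowof b z" "belowof a z"
      "u = (a, b, z) \<and> v = (a, z, b) \<or> v = (a, b, z) \<and> u = (a, z, b)"
    unfolding knuth_cells_def by metis
  then show ?thesis
  proof cases
    case 1
    have "knuth_lines (crd k a, crd k b, crd k z) (crd k b, crd k a, crd k z)"
      by (cases "k > 0") (use 1(1-3) in \<open>auto simp: knuth_lines_def crd_def rightof_def belowof_def\<close>)
    then show ?thesis using 1(4) knuth_lines_sym by (elim disjE conjE) simp_all
  next
    case 2
    have "knuth_lines (crd k a, crd k b, crd k z) (crd k a, crd k z, crd k b)"
      by (cases "k > 0") (use 2(1-3) in \<open>auto simp: knuth_lines_def crd_def rightof_def belowof_def\<close>)
    then show ?thesis using 2(4) knuth_lines_sym by (elim disjE conjE) simp_all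
  qed
qed

text \<open>Adding a cell does not change the ends of other lines (\<open>lineend_insert\<close>),
  so two sequences with exchanged line numbers consist of the same cells in exchanged order. One
  direction therefore determines the other.\<close>

lemma knuth_cells_of_lines:
  assumes "chain3 S u" "chain3 S v" "knuth_lines (crd3 k u) (crd3 k v)"
  shows "knuth_cells u v"
proof -
  obtain a b z a' b' z' where uv: "u = (a, b, z)" "v = (a', b', z')" by (metis prod_cases3)
  have I: "knuth_cells (a, b, z) (a', b', z')"
    if u: "chain3 S (a, b, z)" and v: "chain3 S (a', b', z')"
      and h: "crd k b < crd k z \<and> crd k z \<le> crd k a \<and> crd k a' = crd k b \<and> crd k b' = crd k a \<and> crd k z' = crd k z"
    for a b z a' b' z'
  proof -
    have l: "lineend k S (crd k a) = a" "lineend k S (crd k a') = a'"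
      "lineend k (insert a S) (crd k b) = b" "lineend k (insert a' S) (crd k b') = b'"
      using u v addable_lineend by (simp_all only: prod.case)
    have ne: "crd k a \<noteq> crd k b" "crd k a' \<noteq> crd k b'" using h by linarith+
    have "lineend k S (crd k b) = b" using l(3) lineend_insert[OF ne(1)] by metis
    then have e1: "a' = b" using l(2) h by metis
    have "lineend k S (crd k b') = b'" using l(4) lineend_insert[OF ne(2)] by metis
    then have "b' = a" using l(1) h by metis
    then have e: "a' = b" "b' = a" using e1 by simp_all
    have "z' = z" using addable_lineend[of "insert b (insert a S)" z k] addable_lineend[of "insert b' (insert a' S)" z' k] u v h e
      by (simp add: insert_commute)
    have c: "addable S a" "addable (insert a S) b" "addable (insert b (insert a S)) z"
      "addable S b" "addable (insert b S) a" "addable (insert a (insert b S)) z"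
      using u v e \<open>z' = z\<close> by auto
    note r = chain_crd[OF c(1,2), of k] chain_crd[OF c(2,3), of k] chain_crd[OF c(4,5), of k] chain_crd[OF c(5,6), of k]
    show ?thesis
    proof (cases "k > 0")
      case True
      then have "rightof a b \<and> belowof b z \<and> rightof a z" using r h by auto
      then show ?thesis unfolding knuth_cells_def e \<open>z' = z\<close> by blast
    next
      case False
      then have "rightof b a \<and> belowof a z \<and> rightof b z" using r h by auto
      then show ?thesis unfolding knuth_cells_def e \<open>z' = z\<close> by blast
    qed
  qed
  have II: "knuth_cells (a, b, z) (a', b', z')"
    if u: "chain3 S (a, b, z)" and v: "chain3 S (a', b', z')"
      and h: "crd k b \<le> crd k a \<and> crd k a < crd k z \<and> crd k a' = crd k a \<and> crd k b' = crd k z \<and> crd k z' = crd k b"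
    for a b z a' b' z'
  proof -
    have e1: "a' = a" using u v h addable_lineend[of S a k] addable_lineend[of S a' k] by auto
    have l: "lineend k (insert a S) (crd k b) = b" "lineend k (insert b (insert a S)) (crd k z) = z"
      "lineend k (insert a S) (crd k b') = b'" "lineend k (insert b' (insert a S)) (crd k z') = z'"
      using u v addable_lineend e1 by (simp_all only: prod.case)
    have ne: "crd k b \<noteq> crd k z" "crd k b' \<noteq> crd k z'" using h by linarith+
    have "lineend k (insert a S) (crd k z) = z" using l(2) lineend_insert[OF ne(1)] by metis
    then have e2: "b' = z" using l(3) h by metis
    have "lineend k (insert a S) (crd k z') = z'" using l(4) lineend_insert[OF ne(2)] by metis
    then have "z' = b" using l(1) h by metis
    then have e: "b' = z" "z' = b" using e2 by simp_all
    have c: "addable S a" "addable (insert a S) b" "addable (insert b (insert a S)) z"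
      "addable (insert a S) z" "addable (insert z (insert a S)) b"
      using u v e e1 by auto
    note r = chain_crd[OF c(1,2), of k] chain_crd[OF c(2,3), of k] chain_crd[OF c(1,4), of k] chain_crd[OF c(4,5), of k]
    show ?thesis
    proof (cases "k > 0")
      case True
      then have "rightof a b \<and> belowof b z \<and> belowof a z" using r h by auto
      then show ?thesis unfolding knuth_cells_def e e1 by blast
    next
      case False
      then have "rightof a z \<and> belowof z b \<and> belowof a b" using r h by auto
      then show ?thesis unfolding knuth_cells_def e e1 by blast
    qed
  qed
  have ch: "chain3 S (a, b, z)" "chain3 S (a', b', z')" using assms(1,2) uv by auto
  from assms(3) consider
    "crd k b < crd k z \<and> crd k z \<le> crd k a \<and> crd k a' = crd k b \<and> crd k b' = crd k a \<and> crd k z' = crd k z"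
    | "crd k b' < crd k z' \<and> crd k z' \<le> crd k a' \<and> crd k a = crd k b' \<and> crd k b = crd k a' \<and> crd k z = crd k z'"
    | "crd k b \<le> crd k a \<and> crd k a < crd k z \<and> crd k a' = crd k a \<and> crd k b' = crd k z \<and> crd k z' = crd k b"
    | "crd k b' \<le> crd k a' \<and> crd k a' < crd k z' \<and> crd k a = crd k a' \<and> crd k b = crd k z' \<and> crd k z = crd k b'"
    unfolding uv knuth_lines_def by auto
  then show ?thesis
  proof cases
    case 1 then show ?thesis using I[OF ch] uv by simp
  next
    case 2 then show ?thesis using I[OF ch(2,1)] uv knuth_cells_sym[of v u] by simp
  next
    case 3 then show ?thesis using II[OF ch] uv by simp
  next
    case 4 then show ?thesis using II[OF ch(2,1)] uv knuth_cells_sym[of v u] by simp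
  qed
qed

text \<open>\<open>push\<close> seen in one coordinate: \<open>r\<close> is the line of the stored
  letter, \<open>i\<close> that of the new cell, and the result gives both afterwards.\<close>

definition step :: "nat \<Rightarrow> nat \<Rightarrow> nat \<times> nat" where
  "step r i = (if i = r then (Suc r, Suc r) else (r, i))"

definition step3 :: "nat \<Rightarrow> nat \<times> nat \<times> nat \<Rightarrow> nat \<times> nat \<times> nat \<times> nat" where
  "step3 r u = (case u of (i1, i2, i3) \<Rightarrow>
     let (r1, k1) = step r i1; (r2, k2) = step r1 i2; (r3, k3) = step r2 i3 in (r3, k1, k2, k3))"

lemma knuth_linesI1: "b < z \<Longrightarrow> z \<le> a \<Longrightarrow> knuth_lines (a, b, z) (b, a, z)"
  unfolding knuth_lines_def by blast

lemma knuth_linesI2: "b \<le> a \<Longrightarrow> a < z \<Longrightarrow> knuth_lines (a, b, z) (a, z, b)"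
  unfolding knuth_lines_def by blast

lemma knuth_lines_step1:
  assumes "b < z" "z \<le> a"
  shows "fst (step3 r (a, b, z)) = fst (step3 r (b, a, z)) \<and> knuth_lines (snd (step3 r (a, b, z))) (snd (step3 r (b, a, z)))"
proof -
  consider "r = a" | "r = b" "a = Suc b" | "r = b" "z = Suc b" "a \<noteq> Suc b" | "r = b" "z \<noteq> Suc b"
    | "r = z" "r \<noteq> a" | "r \<noteq> a" "r \<noteq> b" "r \<noteq> z" by metis
  then show ?thesis
  proof cases
    case 1
    then show ?thesis using assms by (simp add: step3_def step_def knuth_linesI1)
  next
    case 2
    \<comment> \<open>The relation changes its kind here: the triples become
      \<open>(b+1, b+1, b+2)\<close> and \<open>(b+1, b+2, b+1)\<close>.\<close>
    then have "z = Suc b" using assms by simp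
    then show ?thesis using 2 knuth_linesI2[of "Suc b" "Suc b" "Suc (Suc b)"]
      by (simp add: step3_def step_def knuth_lines_sym)
  next
    case 3
    then show ?thesis using assms by (simp add: step3_def step_def knuth_linesI1)
  next
    case 4
    then have "a \<noteq> Suc b" using assms by simp
    then show ?thesis using 4 assms by (simp add: step3_def step_def knuth_linesI1)
  next
    case 5
    then show ?thesis using assms by (simp add: step3_def step_def knuth_linesI1)
  next
    case 6
    then show ?thesis using assms by (simp add: step3_def step_def knuth_linesI1)
  qed
qed

lemma knuth_lines_step2:
  assumes "b \<le> a" "a < z"
  shows "fst (step3 r (a, b, z)) = fst (step3 r (a, z, b)) \<and> knuth_lines (snd (step3 r (a, b, z))) (snd (step3 r (a, z, b)))"
proof -
  consider "r = a" "z = Suc a" | "r = a" "z \<noteq> Suc a" | "r = b" "r \<noteq> a"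
    | "r = z" | "r \<noteq> a" "r \<noteq> b" "r \<noteq> z" by metis
  then show ?thesis
    by cases (use assms in \<open>simp_all add: step3_def step_def knuth_linesI2\<close>)
qed

text \<open>The inductive step of \<open>urun_knuth\<close>, for a stored letter above the three
  inserted ones: it ends on the same line either way.\<close>

lemma knuth_lines_step:
  assumes "knuth_lines u v"
  shows "fst (step3 r u) = fst (step3 r v) \<and> knuth_lines (snd (step3 r u)) (snd (step3 r v))"
proof -
  consider a b z where "b < z" "z \<le> a" "u = (a, b, z) \<and> v = (b, a, z) \<or> v = (a, b, z) \<and> u = (b, a, z)"
    | a b z where "b \<le> a" "a < z" "u = (a, b, z) \<and> v = (a, z, b) \<or> v = (a, b, z) \<and> u = (a, z, b)"
    using assms unfolding knuth_lines_def by auto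
  then show ?thesis
  proof cases
    case 1
    then show ?thesis using knuth_lines_step1[OF 1(1,2), of r] knuth_lines_sym by (elim disjE conjE) simp_all
  next
    case 2
    then show ?thesis using knuth_lines_step2[OF 2(1,2), of r] knuth_lines_sym by (elim disjE conjE) simp_all
  qed
qed

lemma urun_append: "urun (xs @ ys) S = (let (cs, S1) = urun xs S; (ds, S2) = urun ys S1 in (cs @ ds, S2))"
  by (induction xs arbitrary: S) (auto simp: Let_def split: prod.splits)

lemma urun3:
  assumes "uvalid S" "distinct [x, y, z]" "0 \<notin> {x, y, z}" "{x, y, z} \<inter> uletters S = {}"
  obtains c1 c2 c3 S' where "urun [x, y, z] S = ([c1, c2, c3], S')" "chain3 (ushape S) (c1, c2, c3)"
    "uvalid S'" "ushape S' = insert c3 (insert c2 (insert c1 (ushape S)))" "uletters S' = {x, y, z} \<union> uletters S"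
proof -
  obtain c1 S1 where 1: "uins x S = (c1, S1)" by (cases "uins x S")
  obtain c2 S2 where 2: "uins y S1 = (c2, S2)" by (cases "uins y S1")
  obtain c3 S3 where 3: "uins z S2 = (c3, S3)" by (cases "uins z S2")
  have p: "uvalid S1" "uletters S1 = insert x (uletters S)" "ushape S1 = insert c1 (ushape S)" "addable (ushape S) c1"
    using uins_props[OF assms(1) _ _ 1] assms by auto
  have q: "uvalid S2" "uletters S2 = insert y (uletters S1)" "ushape S2 = insert c2 (ushape S1)" "addable (ushape S1) c2"
    using uins_props[OF p(1) _ _ 2] assms p by auto
  have r: "uvalid S3" "uletters S3 = insert z (uletters S2)" "ushape S3 = insert c3 (ushape S2)" "addable (ushape S2) c3"
    using uins_props[OF q(1) _ _ 3] assms p q by auto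
  show thesis by (rule that[of c1 c2 c3 S3]) (use p q r 1 2 3 in auto)
qed

lemma urun3_Cons:
  assumes "uvalid ((k, p) # S)" "distinct [x, y, z]" "0 \<notin> {x, y, z}" "{x, y, z} \<inter> uletters ((k, p) # S) = {}"
    "lev x < lev k" "lev y < lev k" "lev z < lev k" "urun [x, y, z] S = ([c1, c2, c3], S')"
  obtains d1 d2 d3 q where "urun [x, y, z] ((k, p) # S) = ([d1, d2, d3], (k, q) # S')"
    "step3 (crd k p) (crd k c1, crd k c2, crd k c3) = (crd k q, crd k d1, crd k d2, crd k d3)"
    "addable (ushape S') q"
proof -
  obtain S1 where 1: "uins x S = (c1, S1)" using assms(8) by (auto split: prod.splits)
  obtain S2 where 2: "uins y S1 = (c2, S2)" using assms(8) 1 by (auto split: prod.splits)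
  have 3: "uins z S2 = (c3, S')" using assms(8) 1 2 by (auto split: prod.splits)
  have v: "uvalid S" "addable (ushape S) p" using assms(1) by auto
  have p: "uvalid S1" "uletters S1 = insert x (uletters S)" "ushape S1 = insert c1 (ushape S)" "addable (ushape S) c1"
    using uins_props[OF v(1) _ _ 1] assms by auto
  have q: "uvalid S2" "uletters S2 = insert y (uletters S1)" "ushape S2 = insert c2 (ushape S1)" "addable (ushape S1) c2"
    using uins_props[OF p(1) _ _ 2] assms p by auto
  have r: "uvalid S'" "uletters S' = insert z (uletters S2)" "ushape S' = insert c3 (ushape S2)" "addable (ushape S2) c3"
    using uins_props[OF q(1) _ _ 3] assms p q by auto
  obtain q1 d1 where a: "push k (ushape S) p c1 = (q1, d1)" by (cases "push k (ushape S) p c1")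
  note pa = push_props[OF v(2) p(4) a]
  have x1: "addable (ushape S1) q1" using pa(1) p(3) by simp
  obtain q2 d2 where b: "push k (ushape S1) q1 c2 = (q2, d2)" by (cases "push k (ushape S1) q1 c2")
  note pb = push_props[OF x1 q(4) b]
  have x2: "addable (ushape S2) q2" using pb(1) q(3) by simp
  obtain q3 d3 where c: "push k (ushape S2) q2 c3 = (q3, d3)" by (cases "push k (ushape S2) q2 c3")
  note pc = push_props[OF x2 r(4) c]
  have "urun [x, y, z] ((k, p) # S) = ([d1, d2, d3], (k, q3) # S')"
    using 1 2 3 a b c assms(5-7) by simp
  moreover have "step3 (crd k p) (crd k c1, crd k c2, crd k c3) = (crd k q3, crd k d1, crd k d2, crd k d3)"
    using pa(4,5) pb(4,5) pc(4,5) by (auto simp: step3_def step_def)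
  moreover have "addable (ushape S') q3" using pc(1) r(3) by simp
  ultimately show thesis using that by blast
qed

lemma uins_adjacent_crd:
  assumes "uvalid S" "x \<noteq> 0" "y \<noteq> 0" "x \<noteq> y" "x \<notin> uletters S" "y \<notin> uletters S" "k \<noteq> 0"
    "uins x S = (c, S1)" "uins y S1 = (c', S2)"
  shows "x < y \<longleftrightarrow> 0 < k \<Longrightarrow> crd k c' \<le> crd k c" "x < y \<longleftrightarrow> k < 0 \<Longrightarrow> crd k c < crd k c'"
proof -
  have p: "uvalid S1" "uletters S1 = insert x (uletters S)" "ushape S1 = insert c (ushape S)" "addable (ushape S) c"
    using uins_props[OF assms(1,2,5,8)] by auto
  have q: "addable (insert c (ushape S)) c'"
    using uins_props[OF p(1) assms(3) _ assms(9)] assms p by auto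
  note a = uins_adjacent[OF assms(1-6,8,9)] chain_crd[OF p(4) q, of k]
  show "x < y \<longleftrightarrow> 0 < k \<Longrightarrow> crd k c' \<le> crd k c" "x < y \<longleftrightarrow> k < 0 \<Longrightarrow> crd k c < crd k c'"
    using a assms(4,7) by (auto split: if_splits)
qed

text \<open>The letter of largest level is the largest or the smallest of the three, so it is not the middle one.\<close>

lemma urun_knuth_top1:
  assumes "uvalid S" "distinct [x, y, z]" "0 \<notin> {x, y, z}" "{x, y, z} \<inter> uletters S = {}"
    "x < z \<and> z < y \<or> y < z \<and> z < x" "lev y < lev x" "lev z < lev x" "\<forall>l \<in> uletters S. lev l < lev x"
    "urun [x, y, z] S = ([c1, c2, c3], S1)" "urun [y, x, z] S = ([d1, d2, d3], S2)"
  shows "S1 = S2 \<and> knuth_lines (crd x c1, crd x c2, crd x c3) (crd x d1, crd x d2, crd x d3)"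
proof -
  obtain a T1 where a: "uins y S = (a, T1)" by (cases "uins y S")
  obtain b T2 where b: "uins z T1 = (b, T2)" by (cases "uins z T1")
  have p: "uvalid T1" "uletters T1 = insert y (uletters S)" "ushape T1 = insert a (ushape S)" "addable (ushape S) a"
    using uins_props[OF assms(1) _ _ a] assms by auto
  have q: "uvalid T2" "uletters T2 = insert z (uletters T1)" "ushape T2 = insert b (ushape T1)" "addable (ushape T1) b"
    using uins_props[OF p(1) _ _ b] assms p by auto
  have order: "y < z \<longleftrightarrow> 0 < x"
    using assms(3,5) lev_less_pos[OF assms(6)] lev_less_neg[OF assms(6)] by fastforce
  have ab: "crd x b \<le> crd x a"
    using uins_adjacent_crd(1)[OF assms(1) _ _ _ _ _ _ a b, of x] assms(2-4) order by auto
  have low: "\<forall>l \<in> uletters T1. lev l < lev x" unfolding p(2) using assms(6,8) by simp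
  define e where "e = lineend x (ushape S) 0"
  define e' where "e' = lineend x (ushape T1) 0"
  have e: "uins x S = (e, (x, e) # S)" "uins x T1 = (e', (x, e') # T1)"
    unfolding e_def e'_def using uins_top[OF assms(8)] uins_top[OF low] by simp_all
  have ae: "addable (ushape S) e" "addable (ushape T1) e'" unfolding e_def e'_def
    using addable_lineend0 uvalid_Young assms(1) p(1) by auto
  obtain q1 f1 where 1: "push x (ushape S) e a = (q1, f1)" by (cases "push x (ushape S) e a")
  note p1 = push_props[OF ae(1) p(4) 1]
  have x1: "addable (ushape T1) q1" using p1(1) p(3) by simp
  obtain q2 f2 where 2: "push x (ushape T1) q1 b = (q2, f2)" by (cases "push x (ushape T1) q1 b")
  note p2 = push_props[OF x1 q(4) 2]
  obtain q3 f3 where 3: "push x (ushape T1) e' b = (q3, f3)" by (cases "push x (ushape T1) e' b")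
  note p3 = push_props[OF ae(2) q(4) 3]
  have A: "c1 = e" "c2 = f1" "c3 = f2" "S1 = (x, q2) # T2" using assms(6,7,9) e a b 1 2 p by auto
  have B: "d1 = a" "d2 = e'" "d3 = f3" "S2 = (x, q3) # T2" using assms(6,7,10) e a b 3 p by auto
  have z: "crd x e = 0" "crd x e' = 0" by (auto simp: e_def e'_def)
  have "crd x q2 = crd x q3 \<and> knuth_lines (crd x c1, crd x c2, crd x c3) (crd x d1, crd x d2, crd x d3)"
  proof (cases "crd x a = 0")
    case True
    then have "crd x b = 0" using ab by simp
    then show ?thesis using True A B z p1(4,5) p2(4,5) p3(4,5) knuth_lines_sym[OF knuth_linesI2[of 0 0 "Suc 0"]] by simp
  next
    case False
    then show ?thesis using A B z p1(4,5) p2(4,5) p3(4,5) ab knuth_lines_sym[OF knuth_linesI1[of 0 "crd x f2" "crd x a"]]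
      by (cases "crd x b = 0") auto
  qed
  moreover have "q2 = q3 \<longleftrightarrow> crd x q2 = crd x q3"
    using addable_eq_iff_crd p2(1) p3(1) by blast
  ultimately show ?thesis using A B by simp
qed

lemma urun_knuth_top2:
  assumes "uvalid S" "distinct [x, y, z]" "0 \<notin> {x, y, z}" "{x, y, z} \<inter> uletters S = {}"
    "y < x \<and> x < z \<or> z < x \<and> x < y" "lev x < lev y" "lev z < lev y" "\<forall>l \<in> uletters S. lev l < lev y"
    "urun [x, y, z] S = ([c1, c2, c3], S1)" "urun [x, z, y] S = ([d1, d2, d3], S2)"
  shows "S1 = S2 \<and> knuth_lines (crd y c1, crd y c2, crd y c3) (crd y d1, crd y d2, crd y d3)"
proof -
  obtain a T1 where a: "uins x S = (a, T1)" by (cases "uins x S")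
  obtain b T2 where b: "uins z T1 = (b, T2)" by (cases "uins z T1")
  have p: "uvalid T1" "uletters T1 = insert x (uletters S)" "ushape T1 = insert a (ushape S)" "addable (ushape S) a"
    using uins_props[OF assms(1) _ _ a] assms by auto
  have q: "uvalid T2" "uletters T2 = insert z (uletters T1)" "ushape T2 = insert b (ushape T1)" "addable (ushape T1) b"
    using uins_props[OF p(1) _ _ b] assms p by auto
  have order: "x < z \<longleftrightarrow> y < 0"
    using assms(3,5) lev_less_pos[OF assms(6)] lev_less_neg[OF assms(6)] by fastforce
  have ab: "crd y a < crd y b"
    using uins_adjacent_crd(2)[OF assms(1) _ _ _ _ _ _ a b, of y] assms(2-4) order by auto
  have low: "\<forall>l \<in> uletters T1. lev l < lev y" "\<forall>l \<in> uletters T2. lev l < lev y"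
    unfolding p(2) q(2) using assms(6-8) by simp_all
  define e where "e = lineend y (ushape T1) 0"
  define e' where "e' = lineend y (ushape T2) 0"
  have e: "uins y T1 = (e, (y, e) # T1)" "uins y T2 = (e', (y, e') # T2)"
    unfolding e_def e'_def using uins_top[OF low(1)] uins_top[OF low(2)] by simp_all
  have ae: "addable (ushape T1) e" "addable (ushape T2) e'" unfolding e_def e'_def
    using addable_lineend0 uvalid_Young p(1) q(1) by auto
  obtain q1 f1 where 1: "push y (ushape T1) e b = (q1, f1)" by (cases "push y (ushape T1) e b")
  note p1 = push_props[OF ae(1) q(4) 1]
  have A: "c1 = a" "c2 = e" "c3 = f1" "S1 = (y, q1) # T2" using assms(6,7,9) e a b 1 p by auto
  have B: "d1 = a" "d2 = b" "d3 = e'" "S2 = (y, e') # T2" using assms(6,7,10) e a b p by auto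
  have z: "crd y e = 0" "crd y e' = 0" by (auto simp: e_def e'_def)
  have "crd y q1 = crd y e' \<and> knuth_lines (crd y c1, crd y c2, crd y c3) (crd y d1, crd y d2, crd y d3)"
    using A B z p1(4,5) ab knuth_linesI2[of 0 "crd y a" "crd y b"] by auto
  moreover have "q1 = e' \<longleftrightarrow> crd y q1 = crd y e'"
    using addable_eq_iff_crd p1(1) ae(2) q(3) by metis
  ultimately show ?thesis using A B by simp
qed

text \<open>Equality of the tableaux and the relation between the new cells need each other: how a
  larger letter moves depends only on the new cells below it. Letters above \<open>x\<close>,
  \<open>y\<close>, \<open>z\<close> are peeled off until one of the three is on top; the relation
  first appears in the direction of that letter, hence the existential \<open>k\<close>.\<close>

theorem urun_knuth:
  assumes "uvalid S" "knuth_words (x, y, z) (x', y', z')" "0 \<notin> {x, y, z}" "{x, y, z} \<inter> uletters S = {}"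
    "urun [x, y, z] S = ([c1, c2, c3], S1)" "urun [x', y', z'] S = ([d1, d2, d3], S2)"
  shows "S1 = S2 \<and> knuth_cells (c1, c2, c3) (d1, d2, d3)"
proof -
  have w: "{x', y', z'} = {x, y, z}" "distinct [x, y, z]" "distinct [x', y', z']"
    using assms(2) unfolding knuth_words_def by auto
  have nz: "x \<noteq> 0" "y \<noteq> 0" "z \<noteq> 0" using assms(3) by auto
  have levs: "lev x \<noteq> lev y" "lev x \<noteq> lev z" "lev y \<noteq> lev z"
    using lev_neq nz w(2) by auto
  have base: "\<exists>k. k \<noteq> 0 \<and> S1 = S2 \<and> knuth_lines (crd k c1, crd k c2, crd k c3) (crd k d1, crd k d2, crd k d3)"
    if v: "uvalid S" and fresh: "{x, y, z} \<inter> uletters S = {}"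
      and r: "urun [x, y, z] S = ([c1, c2, c3], S1)" "urun [x', y', z'] S = ([d1, d2, d3], S2)"
      and top: "\<forall>l \<in> uletters S. lev l < lev x \<or> lev l < lev y \<or> lev l < lev z"
    for S c1 c2 c3 d1 d2 d3 S1 S2
  proof -
    have fr: "{y, x, z} \<inter> uletters S = {}" "{x, z, y} \<inter> uletters S = {}" using fresh by auto
    have ds: "distinct [y, x, z]" "distinct [x, z, y]" using w(2) by auto
    have n0: "0 \<notin> {y, x, z}" "0 \<notin> {x, z, y}" using assms(3) by auto
    from assms(2) consider (1) "x < z \<and> z < y \<or> y < z \<and> z < x" "x' = y" "y' = x" "z' = z"
      | (2) "y < x \<and> x < z \<or> z < x \<and> x < y" "x' = x" "y' = z" "z' = y"
      unfolding knuth_words_def by auto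
    then show ?thesis
    proof cases
      case 1
      have "\<not> (lev x < lev z \<and> lev y < lev z)"
      proof
        assume h: "lev x < lev z \<and> lev y < lev z"
        then show False using 1(1) nz(3) lev_less_pos[of x z] lev_less_pos[of y z] lev_less_neg[of x z] lev_less_neg[of y z]
          by (cases "0 < z") auto
      qed
      then consider "lev y < lev x" "lev z < lev x" | "lev x < lev y" "lev z < lev y" using levs by linarith
      then show ?thesis
      proof cases
        case a: 1
        have t: "\<forall>l \<in> uletters S. lev l < lev x" using top a by fastforce
        show ?thesis using urun_knuth_top1[OF v w(2) assms(3) fresh 1(1) a t r(1)] r(2) 1 nz by blast
      next
        case a: 2
        have t: "\<forall>l \<in> uletters S. lev l < lev y" using top a by fastforce
        have o: "y < z \<and> z < x \<or> x < z \<and> z < y" using 1(1) by blast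
        show ?thesis using urun_knuth_top1[OF v ds(1) n0(1) fr(1) o a t _ r(1)] r(2) 1(2-4) nz knuth_lines_sym by blast
      qed
    next
      case 2
      have "\<not> (lev y < lev x \<and> lev z < lev x)"
      proof
        assume h: "lev y < lev x \<and> lev z < lev x"
        then show False using 2(1) nz(1) lev_less_pos[of y x] lev_less_pos[of z x] lev_less_neg[of y x] lev_less_neg[of z x]
          by (cases "0 < x") auto
      qed
      then consider "lev x < lev y" "lev z < lev y" | "lev x < lev z" "lev y < lev z" using levs by linarith
      then show ?thesis
      proof cases
        case a: 1
        have t: "\<forall>l \<in> uletters S. lev l < lev y" using top a by fastforce
        show ?thesis using urun_knuth_top2[OF v w(2) assms(3) fresh 2(1) a t r(1)] r(2) 2 nz by blast
      next
        case a: 2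
        have t: "\<forall>l \<in> uletters S. lev l < lev z" using top a by fastforce
        have o: "z < x \<and> x < y \<or> y < x \<and> x < z" using 2(1) by blast
        show ?thesis using urun_knuth_top2[OF v ds(2) n0(2) fr(2) o a t _ r(1)] r(2) 2(2-4) nz knuth_lines_sym by blast
      qed
    qed
  qed
  have main: "\<exists>k. k \<noteq> 0 \<and> S1 = S2 \<and> knuth_lines (crd k c1, crd k c2, crd k c3) (crd k d1, crd k d2, crd k d3)"
    using assms(1,4-6)
  proof (induction S arbitrary: c1 c2 c3 d1 d2 d3 S1 S2)
    case Nil
    show ?case by (rule base[OF Nil]) simp
  next
    case (Cons e S)
    obtain k p where e: "e = (k, p)" by (cases e)
    show ?case
    proof (cases "lev x < lev k \<and> lev y < lev k \<and> lev z < lev k")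
      case False
      have "k \<noteq> 0" "k \<notin> {x, y, z}" "\<forall>l \<in> uletters S. lev l < lev k" using Cons.prems e by auto
      then have "lev x > lev k \<or> lev y > lev k \<or> lev z > lev k"
        using False lev_neq nz by (metis insertCI linorder_less_linear)
      then have "\<forall>l \<in> uletters (e # S). lev l < lev x \<or> lev l < lev y \<or> lev l < lev z"
        using e \<open>\<forall>l \<in> uletters S. lev l < lev k\<close> by fastforce
      then show ?thesis by (rule base[OF Cons.prems])
    next
      case True
      have k0: "k \<noteq> 0" using Cons.prems e by auto
      have v: "uvalid S" "{x, y, z} \<inter> uletters S = {}" using Cons.prems e by auto
      have ve: "uvalid ((k, p) # S)" "{x, y, z} \<inter> uletters ((k, p) # S) = {}" using Cons.prems e by auto
      have fr': "{x', y', z'} \<inter> uletters S = {}" "0 \<notin> {x', y', z'}" "{x', y', z'} \<inter> uletters ((k, p) # S) = {}"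
        using v(2) ve(2) assms(3) unfolding w(1) by blast+
      have "\<forall>l \<in> {x', y', z'}. lev l < lev k" unfolding w(1) using True by simp
      then have lv': "lev x' < lev k" "lev y' < lev k" "lev z' < lev k" by simp_all
      from urun3[OF v(1) w(2) assms(3) v(2)]
      obtain a1 a2 a3 T1 where a: "urun [x, y, z] S = ([a1, a2, a3], T1)" "chain3 (ushape S) (a1, a2, a3)" .
      from urun3[OF v(1) w(3) fr'(2,1)]
      obtain b1 b2 b3 T2 where b: "urun [x', y', z'] S = ([b1, b2, b3], T2)" "chain3 (ushape S) (b1, b2, b3)" .
      obtain j where j: "j \<noteq> 0" "T1 = T2" "knuth_lines (crd j a1, crd j a2, crd j a3) (crd j b1, crd j b2, crd j b3)"
        using Cons.IH[OF v a(1) b(1)] by blast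
      \<comment> \<open>The direction \<open>j\<close> stems from the base case; the detour through
        cells replaces it by the direction of \<open>k\<close>.\<close>
      have "knuth_cells (a1, a2, a3) (b1, b2, b3)"
        using knuth_cells_of_lines[OF a(2) b(2), of j] j(3) by simp
      then have l: "knuth_lines (crd k a1, crd k a2, crd k a3) (crd k b1, crd k b2, crd k b3)"
        using knuth_lines_of_cells[of "(a1, a2, a3)" "(b1, b2, b3)" k] by simp
      have lv: "lev x < lev k" "lev y < lev k" "lev z < lev k" using True by simp_all
      from urun3_Cons[OF ve(1) w(2) assms(3) ve(2) lv a(1)]
      obtain c1' c2' c3' q where r: "urun [x, y, z] ((k, p) # S) = ([c1', c2', c3'], (k, q) # T1)"
        "step3 (crd k p) (crd k a1, crd k a2, crd k a3) = (crd k q, crd k c1', crd k c2', crd k c3')"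
        "addable (ushape T1) q" .
      have q: "S1 = (k, q) # T1" "c1' = c1" "c2' = c2" "c3' = c3" using r(1) Cons.prems(3) unfolding e by auto
      from urun3_Cons[OF ve(1) w(3) fr'(2,3) lv' b(1)]
      obtain d1' d2' d3' q' where r': "urun [x', y', z'] ((k, p) # S) = ([d1', d2', d3'], (k, q') # T2)"
        "step3 (crd k p) (crd k b1, crd k b2, crd k b3) = (crd k q', crd k d1', crd k d2', crd k d3')"
        "addable (ushape T2) q'" .
      have q': "S2 = (k, q') # T2" "d1' = d1" "d2' = d2" "d3' = d3" using r'(1) Cons.prems(4) unfolding e by auto
      have "crd k q = crd k q'" "knuth_lines (crd k c1, crd k c2, crd k c3) (crd k d1, crd k d2, crd k d3)"
        using knuth_lines_step[OF l, of "crd k p"] r(2) r'(2) q q' by auto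
      then show ?thesis using k0 q(1) q'(1) r(3) r'(3) j(2) addable_eq_iff_crd[of "ushape T2" q q' k] by auto
    qed
  qed
  then obtain k where k: "k \<noteq> 0" "S1 = S2" "knuth_lines (crd k c1, crd k c2, crd k c3) (crd k d1, crd k d2, crd k d3)"
    by blast
  have "chain3 (ushape S) (c1, c2, c3)"
    using urun3[OF assms(1) w(2) assms(3,4)] assms(5) by force
  moreover have "chain3 (ushape S) (d1, d2, d3)"
    using urun3[OF assms(1) w(3)] assms(3,4,6) w(1) by force
  ultimately show ?thesis using knuth_cells_of_lines[of "ushape S" "(c1, c2, c3)" "(d1, d2, d3)" k] k by auto
qed

section \<open>Knuth moves as operators governed by a key\<close>

definition content :: "cell \<Rightarrow> int" where
  "content c = int (snd c) - int (fst c)"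

text \<open>The key is the identity for letters and the content for cells. The operator is total: a
  triple whose middle key stands in the middle, or to which no test applies because of ties, stays
  fixed, so a fixed list of moves can be applied to every word.\<close>

definition kn3 :: "('a \<Rightarrow> int) \<Rightarrow> 'a \<Rightarrow> 'a \<Rightarrow> 'a \<Rightarrow> 'a list" where
  "kn3 \<kappa> x y z =
     (if \<kappa> x < \<kappa> z \<and> \<kappa> z < \<kappa> y \<or> \<kappa> y < \<kappa> z \<and> \<kappa> z < \<kappa> x then [y, x, z]
      else if \<kappa> y < \<kappa> x \<and> \<kappa> x < \<kappa> z \<or> \<kappa> z < \<kappa> x \<and> \<kappa> x < \<kappa> y then [x, z, y]
      else [x, y, z])"

fun kn :: "('a \<Rightarrow> int) \<Rightarrow> nat \<Rightarrow> 'a list \<Rightarrow> 'a list" where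
  "kn \<kappa> 0 (x # y # z # r) = kn3 \<kappa> x y z @ r"
| "kn \<kappa> (Suc j) (x # r) = x # kn \<kappa> j r"
| "kn \<kappa> _ xs = xs"

lemma set_kn: "set (kn \<kappa> j xs) = set xs"
  by (induction \<kappa> j xs rule: kn.induct) (auto simp: kn3_def)

lemma distinct_kn: "distinct (kn \<kappa> j xs) = distinct xs"
  by (induction \<kappa> j xs rule: kn.induct) (auto simp: kn3_def set_kn)

lemma rightof_content: "rightof a b \<Longrightarrow> content a < content b"
  by (simp add: rightof_def content_def)

lemma belowof_content: "belowof a b \<Longrightarrow> content b < content a"
  by (simp add: belowof_def content_def)

lemma kn3_content_of_knuth_cells:
  assumes "knuth_cells (c1, c2, c3) (d1, d2, d3)"
  shows "kn3 content c1 c2 c3 = [d1, d2, d3]"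
proof -
  from assms consider a b z where "rightof a b" "belowof b z" "rightof a z"
      "(c1, c2, c3) = (a, b, z) \<and> (d1, d2, d3) = (b, a, z) \<or> (d1, d2, d3) = (a, b, z) \<and> (c1, c2, c3) = (b, a, z)"
    | a b z where "rightof a b" "belowof b z" "belowof a z"
      "(c1, c2, c3) = (a, b, z) \<and> (d1, d2, d3) = (a, z, b) \<or> (d1, d2, d3) = (a, b, z) \<and> (c1, c2, c3) = (a, z, b)"
    unfolding knuth_cells_def by metis
  then show ?thesis
  proof cases
    case 1
    then have "content a < content b" "content z < content b" "content a < content z"
      using rightof_content belowof_content by blast+
    then show ?thesis using 1(4) by (elim disjE conjE) (simp_all add: kn3_def)
  next
    case 2
    then have "content a < content b" "content z < content b" "content z < content a"
      using rightof_content belowof_content by blast+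
    then show ?thesis using 2(4) by (elim disjE conjE) (simp_all add: kn3_def)
  qed
qed

text \<open>If a Knuth relation applies, \<open>urun_knuth\<close> gives the matching exchange of
  cells. If the triple of letters is monotone, so are the contents of the new cells by
  \<open>uins_adjacent\<close>, and both sides stay fixed.\<close>

lemma urun_kn3:
  assumes "uvalid S" "distinct [x, y, z]" "0 \<notin> {x, y, z}" "{x, y, z} \<inter> uletters S = {}"
    "urun [x, y, z] S = ([c1, c2, c3], S')"
  shows "urun (kn3 (\<lambda>a. a) x y z) S = (kn3 content c1 c2 c3, S')"
proof -
  have "\<exists>x' y' z'. kn3 (\<lambda>a. a) x y z = [x', y', z']" by (simp add: kn3_def)
  then obtain x' y' z' where k: "kn3 (\<lambda>a. a) x y z = [x', y', z']" by blast
  show ?thesis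
  proof (cases "knuth_words (x, y, z) (x', y', z')")
    case True
    have s: "set [x', y', z'] = set [x, y, z]" "distinct [x', y', z']"
      using True assms(2) unfolding knuth_words_def by auto
    then have "0 \<notin> {x', y', z'}" "{x', y', z'} \<inter> uletters S = {}" using assms(3,4) by auto
    from urun3[OF assms(1) s(2) this]
    obtain d1 d2 d3 S2 where d: "urun [x', y', z'] S = ([d1, d2, d3], S2)" .
    have "S' = S2 \<and> knuth_cells (c1, c2, c3) (d1, d2, d3)" by (rule urun_knuth[OF assms(1) True assms(3-5) d])
    then show ?thesis using kn3_content_of_knuth_cells[of c1 c2 c3 d1 d2 d3] d k by simp
  next
    case False
    have m: "[x', y', z'] = [x, y, z]" "x < y \<and> y < z \<or> y < x \<and> z < y"
      using False k assms(2) unfolding kn3_def knuth_words_def by (auto split: if_splits)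
    obtain S1 where 1: "uins x S = (c1, S1)" using assms(5) by (auto split: prod.splits)
    obtain S2 where 2: "uins y S1 = (c2, S2)" using assms(5) 1 by (auto split: prod.splits)
    have 3: "uins z S2 = (c3, S')" using assms(5) 1 2 by (auto split: prod.splits)
    have p: "uvalid S1" "uletters S1 = insert x (uletters S)"
      using uins_props[OF assms(1) _ _ 1] assms by auto
    have a: "if x < y then rightof c1 c2 else belowof c1 c2"
      using uins_adjacent[OF assms(1) _ _ _ _ _ 1 2] assms(2-4) by auto
    have b: "if y < z then rightof c2 c3 else belowof c2 c3"
      using uins_adjacent[OF p(1) _ _ _ _ _ 2 3] assms(2-4) p by auto
    have "content c1 < content c2 \<and> content c2 < content c3 \<or> content c2 < content c1 \<and> content c3 < content c2"
      using m(2) a b by (auto split: if_splits dest: rightof_content belowof_content)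
    then have "kn3 content c1 c2 c3 = [c1, c2, c3]" by (auto simp: kn3_def)
    then show ?thesis using assms(5) k m(1) by simp
  qed
qed

lemma urun_kn:
  assumes "uvalid S" "distinct w" "0 \<notin> set w" "set w \<inter> uletters S = {}" "urun w S = (cs, S')"
  shows "urun (kn (\<lambda>a. a) j w) S = (kn content j cs, S')"
  using assms
proof (induction "(\<lambda>a. a) :: int \<Rightarrow> int" j w arbitrary: S cs rule: kn.induct)
  case (1 x y z r)
  have h: "distinct [x, y, z]" "0 \<notin> {x, y, z}" "{x, y, z} \<inter> uletters S = {}" using 1 by auto
  from urun3[OF \<open>uvalid S\<close> h] obtain c1 c2 c3 S1 where r: "urun [x, y, z] S = ([c1, c2, c3], S1)" .
  obtain ds where ds: "urun r S1 = (ds, S')" "cs = [c1, c2, c3] @ ds"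
    using 1(5) r urun_append[of "[x, y, z]" r S] by (auto split: prod.splits)
  show ?case using urun_kn3[OF \<open>uvalid S\<close> h r] ds urun_append[of "kn3 (\<lambda>a. a) x y z" r S] by simp
next
  case (2 j x r)
  obtain c S1 where c: "uins x S = (c, S1)" by (cases "uins x S")
  obtain ds where ds: "urun r S1 = (ds, S')" "cs = c # ds" using 2 c by (auto split: prod.splits)
  have p: "uvalid S1" "uletters S1 = insert x (uletters S)" using uins_props[OF _ _ _ c] 2 by auto
  have "urun (kn (\<lambda>a. a) j r) S1 = (kn content j ds, S')"
    using 2(1)[OF p(1) _ _ _ ds(1)] p 2 by auto
  then show ?case using c ds by simp
qed (auto split: prod.splits)

lemma urun_fold_kn:
  assumes "uvalid S" "distinct w" "0 \<notin> set w" "set w \<inter> uletters S = {}" "urun w S = (cs, S')"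
  shows "urun (fold (kn (\<lambda>a. a)) J w) S = (fold (kn content) J cs, S')"
  using assms
proof (induction J arbitrary: w cs)
  case (Cons j J)
  show ?case using Cons.IH[OF Cons.prems(1) _ _ _ urun_kn[OF Cons.prems]] Cons.prems
    by (simp add: set_kn distinct_kn)
qed simp

section \<open>Shifted growth\<close>

definition SYoung :: "cell set \<Rightarrow> bool" where
  "SYoung S \<longleftrightarrow> finite S \<and> (\<forall>i j. (i, j) \<in> S \<longrightarrow> i \<le> j \<and>
     (\<forall>i' j'. i' \<le> i \<longrightarrow> j' \<le> j \<longrightarrow> i' \<le> j' \<longrightarrow> (i', j') \<in> S))"

definition saddable :: "cell set \<Rightarrow> cell \<Rightarrow> bool" where
  "saddable S c \<longleftrightarrow> c \<notin> S \<and> SYoung S \<and> SYoung (insert c S)"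

definition srow :: "cell set \<Rightarrow> nat \<Rightarrow> cell" where
  "srow S i = (i, LEAST j. i \<le> j \<and> (i, j) \<notin> S)"

text \<open>Columns of a shifted diagram start in row 0 like those of an unshifted one; only rows
  start on the diagonal.\<close>

abbreviation scol :: "cell set \<Rightarrow> nat \<Rightarrow> cell" where
  "scol \<equiv> colend"

text \<open>Reflection in the line midway between the diagonals of content 0 and -1. The diagonal
  cell \<open>(i, i)\<close> goes to \<open>(i+1, i)\<close>, so a shifted diagram is disjoint from
  its image and fits together with it to a Young diagram.\<close>

definition mir :: "cell \<Rightarrow> cell" where
  "mir c = (Suc (snd c), fst c)"

definition dbl :: "cell set \<Rightarrow> cell set" where
  "dbl S = S \<union> mir ` S"

text \<open>An entry consists of a letter, its cell and whether it is primed.\<close>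

type_synonym entry = "nat \<times> cell \<times> bool"

abbreviation sshape :: "entry list \<Rightarrow> cell set" where
  "sshape S \<equiv> (fst \<circ> snd) ` set S"

abbreviation sletters :: "entry list \<Rightarrow> nat set" where
  "sletters S \<equiv> fst ` set S"

definition snext :: "cell set \<Rightarrow> cell \<Rightarrow> bool \<Rightarrow> cell \<times> bool" where
  "snext S p f = (if f \<or> fst p = snd p then (scol S (Suc (snd p)), True) else (srow S (Suc (fst p)), False))"

definition spush :: "cell set \<Rightarrow> cell \<Rightarrow> bool \<Rightarrow> cell \<Rightarrow> (cell \<times> bool) \<times> cell" where
  "spush S p f c = (if c = p then (let (q, g) = snext (insert p S) p f in ((q, g), q)) else ((p, f), c))"

fun sins :: "nat \<Rightarrow> entry list \<Rightarrow> cell \<times> entry list" where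
  "sins x [] = ((0, 0), [(x, (0, 0), False)])"
| "sins x ((k, p, f) # S) =
     (if x < k
      then (let (c, S') = sins x S; ((q, g), d) = spush (sshape S) p f c in (d, (k, q, g) # S'))
      else (let q = srow (sshape ((k, p, f) # S)) 0 in (q, (x, q, False) # (k, p, f) # S)))"

fun svalid :: "entry list \<Rightarrow> bool" where
  "svalid [] = True"
| "svalid ((k, p, f) # S) = (svalid S \<and> saddable (sshape S) p \<and> (fst p = snd p \<longrightarrow> \<not> f) \<and> 0 < k \<and>
     (\<forall>l \<in> sletters S. l < k))"

lemma SYoungI:
  "finite S \<Longrightarrow> (\<And>i j. (i, j) \<in> S \<Longrightarrow> i \<le> j) \<Longrightarrow>
    (\<And>i j i' j'. (i, j) \<in> S \<Longrightarrow> i' \<le> i \<Longrightarrow> j' \<le> j \<Longrightarrow> i' \<le> j' \<Longrightarrow> (i', j') \<in> S) \<Longrightarrow> SYoung S"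
  unfolding SYoung_def by blast

lemma SYoungD: "SYoung S \<Longrightarrow> (i, j) \<in> S \<Longrightarrow> i' \<le> i \<Longrightarrow> j' \<le> j \<Longrightarrow> i' \<le> j' \<Longrightarrow> (i', j') \<in> S"
  unfolding SYoung_def by blast

lemma SYoung_le: "SYoung S \<Longrightarrow> (i, j) \<in> S \<Longrightarrow> i \<le> j"
  unfolding SYoung_def by blast

lemma SYoung_finite: "SYoung S \<Longrightarrow> finite S"
  unfolding SYoung_def by blast

lemma SYoung_empty [simp]: "SYoung {}"
  unfolding SYoung_def by blast

lemma saddable_le: "saddable S c \<Longrightarrow> fst c \<le> snd c"
  unfolding saddable_def SYoung_def by (cases c) auto

lemma srow_eqI: "(i, j) \<notin> S \<Longrightarrow> i \<le> j \<Longrightarrow> (\<And>j'. i \<le> j' \<Longrightarrow> j' < j \<Longrightarrow> (i, j') \<in> S) \<Longrightarrow> srow S i = (i, j)"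
  unfolding srow_def by (auto intro!: Least_equality simp: not_less[symmetric])

lemma fst_srow [simp]: "fst (srow S i) = i"
  by (simp add: srow_def)

lemma srow_notin: "finite S \<Longrightarrow> srow S i \<notin> S" "finite S \<Longrightarrow> i \<le> snd (srow S i)"
  unfolding srow_def using LeastI_ex[OF finite_row_free[of S i i]] by auto

lemma srow_below: "i \<le> j \<Longrightarrow> j < snd (srow S i) \<Longrightarrow> (i, j) \<in> S"
  unfolding srow_def using not_less_Least by fastforce

lemma saddable_srow: "saddable S c \<Longrightarrow> srow S (fst c) = c"
proof (cases c)
  case (Pair i j)
  assume a: "saddable S c"
  have "(i, j') \<in> S" if "i \<le> j'" "j' < j" for j'
    using a that SYoungD[of "insert c S" i j i j'] Pair unfolding saddable_def by auto
  then show ?thesis using a srow_eqI[of i j S] saddable_le[OF a] Pair unfolding saddable_def by auto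
qed

lemma saddable_scol: "saddable S c \<Longrightarrow> scol S (snd c) = c"
proof (cases c)
  case (Pair i j)
  assume a: "saddable S c"
  have "(i', j) \<in> S" if "i' < i" for i'
    using a that SYoungD[of "insert c S" i j i' j] saddable_le[OF a] Pair unfolding saddable_def by auto
  then show ?thesis using a colend_eqI[of i j S] Pair unfolding saddable_def by auto
qed

lemma SYoung_insertI:
  assumes "SYoung S" "i \<le> j" "\<And>i'. i' < i \<Longrightarrow> (i', j) \<in> S" "\<And>j'. i \<le> j' \<Longrightarrow> j' < j \<Longrightarrow> (i, j') \<in> S"
  shows "SYoung (insert (i, j) S)"
proof -
  have "(i', j') \<in> insert (i, j) S" if "i' \<le> i" "j' \<le> j" "i' \<le> j'" for i' j'
  proof -
    have "i' = i \<and> j' = j \<or> i' < i \<or> i' = i \<and> j' < j" using that by auto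
    then consider "i' = i" "j' = j" | "i' < i" | "i' = i" "j' < j" by blast
    then show ?thesis
      by cases (use assms(3,4) that SYoungD[OF assms(1)] in blast)+
  qed
  then have *: "i' \<le> i \<Longrightarrow> j' \<le> j \<Longrightarrow> i' \<le> j' \<Longrightarrow> (i', j') \<in> insert (i, j) S" for i' j' .
  show ?thesis
  proof (rule SYoungI)
    show "finite (insert (i, j) S)" using SYoung_finite[OF assms(1)] by simp
    show "a \<le> b" if "(a, b) \<in> insert (i, j) S" for a b using that SYoung_le[OF assms(1)] assms(2) by blast
    show "(a', b') \<in> insert (i, j) S" if h: "(a, b) \<in> insert (i, j) S" "a' \<le> a" "b' \<le> b" "a' \<le> b'" for a b a' b'
    proof (cases "(a, b) = (i, j)")
      case True
      then show ?thesis using *[of a' b'] h by blast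
    next
      case False
      then show ?thesis using SYoungD[OF assms(1) _ h(2-4)] h(1) by blast
    qed
  qed
qed

lemma saddable_srow0: "SYoung S \<Longrightarrow> saddable S (srow S 0)"
  using SYoung_insertI[of S 0 "snd (srow S 0)"] srow_below[of 0 _ S] srow_notin[of S 0] SYoung_finite[of S]
  unfolding saddable_def by (metis fst_srow le0 not_less_zero prod.collapse)

lemma saddable_next_row:
  assumes "saddable S p" "fst p < snd p"
  shows "saddable (insert p S) (srow (insert p S) (Suc (fst p)))"
proof -
  obtain i j where p: "p = (i, j)" by (cases p)
  let ?S = "insert p S"
  have Y: "SYoung ?S" "SYoung S" "p \<notin> S" using assms by (auto simp: saddable_def)
  obtain m where m: "srow ?S (Suc i) = (Suc i, m)" by (simp add: srow_def)
  have mn: "(Suc i, m) \<notin> ?S" "Suc i \<le> m"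
    using srow_notin[of ?S "Suc i"] m SYoung_finite[OF Y(1)] by auto
  have mb: "(Suc i, j') \<in> ?S" if "j' < m" "Suc i \<le> j'" for j' using srow_below[of "Suc i" j' ?S] m that by simp
  have "m \<le> j"
  proof (rule ccontr)
    assume "\<not> m \<le> j"
    then have "(Suc i, j) \<in> ?S" using mb assms(2) p by simp
    then have "(i, j) \<in> S" using p SYoungD[OF Y(2), of "Suc i" j i j] assms(2) by simp
    then show False using p Y by simp
  qed
  then have "(i', m) \<in> ?S" if "i' < Suc i" for i'
    using SYoungD[OF Y(1), of i j i' m] that p mn by simp
  then show ?thesis
    using SYoung_insertI[OF Y(1) mn(2)] mn(1) mb Y p m by (simp add: saddable_def)
qed

text \<open>The bound on the row keeps the new cell off the main diagonal, so no primed entry ever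
  lands there.\<close>

lemma saddable_next_col:
  assumes "saddable S p"
  shows "saddable (insert p S) (scol (insert p S) (Suc (snd p)))" "fst (scol (insert p S) (Suc (snd p))) \<le> fst p"
proof -
  obtain i j where p: "p = (i, j)" by (cases p)
  let ?S = "insert p S"
  have Y: "SYoung ?S" "SYoung S" "p \<notin> S" "i \<le> j" using assms saddable_le[OF assms] p by (auto simp: saddable_def)
  obtain m where m: "colend ?S (Suc j) = (m, Suc j)" by (simp add: colend_def)
  have mb: "(j', Suc j) \<in> ?S" if "j' < m" for j' using colend_below[of j' ?S "Suc j"] m that by simp
  have mi: "m \<le> i"
  proof (rule ccontr)
    assume "\<not> m \<le> i"
    then have "(i, Suc j) \<in> ?S" using mb by simp
    then have "(i, j) \<in> S" using p SYoungD[OF Y(2), of i "Suc j" i j] Y(4) by simp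
    then show False using p Y by simp
  qed
  then have "(m, j') \<in> ?S" if "j' < Suc j" "m \<le> j'" for j'
    using SYoungD[OF Y(1), of i j m j'] that p by simp
  moreover have "(m, Suc j) \<notin> ?S" using colend_notin[of ?S "Suc j"] m SYoung_finite[OF Y(1)] by simp
  ultimately show "saddable ?S (scol ?S (Suc (snd p)))"
    using SYoung_insertI[OF Y(1), of m "Suc j"] mb Y p m mi by (simp add: saddable_def)
  show "fst (scol ?S (Suc (snd p))) \<le> fst p" using m mi p by simp
qed

lemma SYoung_Un: "SYoung S \<Longrightarrow> SYoung T \<Longrightarrow> SYoung (S \<union> T)"
  by (rule SYoungI) (use SYoung_finite SYoung_le SYoungD in blast)+

lemma saddable_other:
  assumes "saddable S p" "saddable S c" "p \<noteq> c"
  shows "saddable (insert c S) p"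
  using assms SYoung_Un[of "insert c S" "insert p S"] unfolding saddable_def by (auto simp: insert_commute)

lemma spush_props:
  assumes "saddable S p" "saddable S c" "fst p = snd p \<longrightarrow> \<not> f" "spush S p f c = ((q, g), d)"
  shows "saddable (insert c S) q" "saddable (insert p S) d" "insert q (insert c S) = insert d (insert p S)"
    "fst q = snd q \<longrightarrow> \<not> g"
proof -
  have le: "fst p \<le> snd p" using saddable_le[OF assms(1)] .
  have "saddable (insert c S) q \<and> saddable (insert p S) d \<and> insert q (insert c S) = insert d (insert p S) \<and>
      (fst q = snd q \<longrightarrow> \<not> g)"
  proof (cases "c = p")
    case False
    then show ?thesis using assms saddable_other[OF assms(1,2)] saddable_other[OF assms(2,1)]
      by (auto simp: spush_def)
  next
    case True
    have "saddable (insert p S) q \<and> d = q \<and> (fst q = snd q \<longrightarrow> \<not> g)"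
    proof (cases "f \<or> fst p = snd p")
      case f: True
      then have q: "q = scol (insert p S) (Suc (snd p))" "d = q"
        using assms(4) True unfolding spush_def snext_def Let_def by auto
      have "snd q = Suc (snd p)" using q by simp
      moreover have "fst q \<le> fst p" using saddable_next_col(2)[OF assms(1)] q by simp
      ultimately show ?thesis using saddable_next_col(1)[OF assms(1)] q le by auto
    next
      case False
      then have "q = srow (insert p S) (Suc (fst p))" "d = q" "\<not> g"
        using assms(4) True unfolding spush_def snext_def Let_def by auto
      then show ?thesis using saddable_next_row[OF assms(1)] le False by auto
    qed
    then show ?thesis using True by simp
  qed
  then show "saddable (insert c S) q" "saddable (insert p S) d" "insert q (insert c S) = insert d (insert p S)"
    "fst q = snd q \<longrightarrow> \<not> g" by blast+
qed

lemma saddable_origin: "saddable {} (0, 0)"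
  by (auto simp: saddable_def SYoung_def)

lemma svalid_SYoung: "svalid S \<Longrightarrow> SYoung (sshape S)"
  by (cases S) (auto simp: saddable_def)

lemma sins_top:
  assumes "\<forall>l \<in> sletters S. l < x"
  shows "sins x S = (srow (sshape S) 0, (x, srow (sshape S) 0, False) # S)"
proof (cases S)
  case Nil
  have "srow {} 0 = (0, 0)" by (auto intro: srow_eqI)
  then show ?thesis using Nil by simp
next
  case (Cons e S0)
  then show ?thesis using assms by (cases e) (auto simp: Let_def)
qed

lemma sins_props:
  assumes "svalid S" "0 < x" "x \<notin> sletters S" "sins x S = (c, S')"
  shows "svalid S' \<and> sletters S' = insert x (sletters S) \<and> sshape S' = insert c (sshape S) \<and> saddable (sshape S) c"
  using assms
proof (induction S arbitrary: c S')
  case Nil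
  then show ?case using saddable_origin by auto
next
  case (Cons e S)
  obtain k p f where e: "e = (k, p, f)" by (cases e)
  show ?case
  proof (cases "x < k")
    case True
    obtain c0 S0 where c0: "sins x S = (c0, S0)" by (cases "sins x S")
    obtain q g d where q: "spush (sshape S) p f c0 = ((q, g), d)" by (metis prod.collapse)
    have IH: "svalid S0" "sletters S0 = insert x (sletters S)" "sshape S0 = insert c0 (sshape S)" "saddable (sshape S) c0"
      using Cons.IH[OF _ _ _ c0] Cons.prems e by auto
    have r: "c = d" "S' = (k, q, g) # S0" using Cons.prems(4) e True c0 q by auto
    have pf: "saddable (sshape S) p" "fst p = snd p \<longrightarrow> \<not> f" using Cons.prems(1) e by auto
    note pp = spush_props[OF pf(1) IH(4) pf(2) q]
    have "svalid S'" using pp(1,4) r IH(1,2,3) Cons.prems(1) e True by simp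
    moreover have "sletters S' = insert x (sletters (e # S))" using r e IH(2) by auto
    moreover have "sshape S' = insert c (sshape (e # S))" using r e IH(3) pp(3) by (simp add: insert_commute)
    moreover have "saddable (sshape (e # S)) c" using pp(2) r e by simp
    ultimately show ?thesis by blast
  next
    case False
    have lt: "\<forall>l \<in> sletters (e # S). l < x" using False Cons.prems(1,3) e by auto
    have ad: "saddable (sshape (e # S)) (srow (sshape (e # S)) 0)"
      using saddable_srow0 svalid_SYoung Cons.prems(1) by blast
    have "c = srow (sshape (e # S)) 0" "S' = (x, c, False) # e # S"
      using sins_top[OF lt] Cons.prems(4) by auto
    then show ?thesis using ad lt Cons.prems(1,2) by simp
  qed
qed

section \<open>Doubling\<close>

lemma Young_dbl: assumes "SYoung S" shows "Young (dbl S)"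
proof -
  have "(i', j') \<in> dbl S" if a: "(i, j) \<in> dbl S" "i' \<le> i" "j' \<le> j" for i j i' j'
  proof -
    have S: "SYoung S" by fact
    consider (up) "(i, j) \<in> S" | (low) a b where "(a, b) \<in> S" "i = Suc b" "j = a"
      using a(1) unfolding dbl_def mir_def by auto
    then have "if i' \<le> j' then (i', j') \<in> S else (j', i' - 1) \<in> S"
    proof cases
      case up
      then show ?thesis using SYoungD[OF S up] SYoung_le[OF S up] a by auto
    next
      case low
      then show ?thesis using SYoungD[OF S low(1)] SYoung_le[OF S low(1)] a by auto
    qed
    then show ?thesis
    proof (cases "i' \<le> j'")
      case False
      then have "(j', i' - 1) \<in> S" "(i', j') = mir (j', i' - 1)"
        using \<open>if i' \<le> j' then (i', j') \<in> S else (j', i' - 1) \<in> S\<close> by (auto simp: mir_def)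
      then show ?thesis unfolding dbl_def by blast
    qed (simp add: dbl_def)
  qed
  then show ?thesis using SYoung_finite[OF assms] unfolding Young_def dbl_def by auto
qed

lemma dbl_insert: "dbl (insert c S) = insert (mir c) (insert c (dbl S))"
  by (auto simp: dbl_def)

lemma mir_le_neq: "fst c \<le> snd c \<Longrightarrow> fst p \<le> snd p \<Longrightarrow> mir c \<noteq> p"
  by (cases c, cases p) (auto simp: mir_def)

lemma mir_eq_iff [simp]: "mir c = mir p \<longleftrightarrow> c = p"
  by (cases c, cases p) (auto simp: mir_def)

lemma Young_remove: "Young (insert c S) \<Longrightarrow> c \<notin> S \<Longrightarrow> (\<And>i j. (i, j) \<in> S \<Longrightarrow> \<not> (fst c \<le> i \<and> snd c \<le> j)) \<Longrightarrow> Young S"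
  unfolding Young_def by fastforce

text \<open>The order matters on the diagonal, where the mirror cell \<open>(i+1, i)\<close> rests
  on \<open>(i, i)\<close>; off the diagonal the two cells are independent.\<close>

lemma addable_dbl:
  assumes "saddable S c"
  shows "addable (dbl S) c" "addable (insert c (dbl S)) (mir c)"
proof -
  have le: "fst c \<le> snd c" using saddable_le[OF assms] .
  have Y: "Young (dbl S)" "Young (insert (mir c) (insert c (dbl S)))"
    using Young_dbl assms unfolding saddable_def dbl_insert[symmetric] by blast+
  have SS: "\<And>i j. (i, j) \<in> S \<Longrightarrow> i \<le> j" using assms SYoung_le unfolding saddable_def by blast
  have c: "c \<notin> dbl S" using assms le SS mir_le_neq unfolding saddable_def dbl_def by (metis Un_iff imageE prod.collapse)
  have m: "mir c \<notin> insert c (dbl S)" using assms le SS mir_le_neq unfolding saddable_def dbl_def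
    by (auto dest!: mir_le_neq)
  have "Young (insert c (dbl S))"
  proof (rule Young_remove[OF Y(2) m])
    fix i j assume a: "(i, j) \<in> insert c (dbl S)"
    show "\<not> (fst (mir c) \<le> i \<and> snd (mir c) \<le> j)"
    proof
      assume h: "fst (mir c) \<le> i \<and> snd (mir c) \<le> j"
      have "(i, j) \<noteq> c" using h le by (auto simp: mir_def)
      then have "mir c \<in> dbl S" using YoungD[OF Y(1), of i j "fst (mir c)" "snd (mir c)"] a h by auto
      then show False using m by simp
    qed
  qed
  then show "addable (dbl S) c" "addable (insert c (dbl S)) (mir c)"
    using c m Y by (auto simp: addable_def)
qed

text \<open>In the upper half an unprimed entry appears as \<open>k\<close>, which moves along rows,
  and a primed one as \<open>-k\<close>, which moves along columns. The mirror cell carries the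
  opposite sign.\<close>

fun dbls :: "entry list \<Rightarrow> (int \<times> cell) list" where
  "dbls [] = []"
| "dbls ((k, p, f) # S) = (- int k, if f then p else mir p) # (int k, if f then mir p else p) # dbls S"

lemma ushape_dbls: "ushape (dbls S) = dbl (sshape S)"
  by (induction S rule: dbls.induct) (auto simp: dbl_def)

lemma uletters_dbls: "uletters (dbls S) = (\<lambda>k. int k) ` sletters S \<union> (\<lambda>k. - int k) ` sletters S"
  by (induction S rule: dbls.induct) auto

lemma addable_swap:
  assumes "addable S a" "addable (insert a S) b" "addable S b"
  shows "addable (insert b S) a"
  using assms unfolding addable_def by (auto simp: insert_commute)

lemma uvalid_dbls: "svalid S \<Longrightarrow> uvalid (dbls S)"
proof (induction S rule: dbls.induct)
  case (2 k p f S)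
  have ad: "saddable (sshape S) p" "fst p = snd p \<longrightarrow> \<not> f" using 2 by auto
  have le: "fst p \<le> snd p" using saddable_le[OF ad(1)] .
  note a = addable_dbl[OF ad(1)]
  have lets: "\<forall>l \<in> uletters (dbls S). lev l < lev (int k) \<and> lev l < lev (- int k)"
    using 2 unfolding uletters_dbls by (auto simp: lev_def)
  have k: "lev (int k) < lev (- int k)" "int k \<noteq> 0" using 2 by (auto simp: lev_def)
  have v: "uvalid (dbls S)" using 2 by auto
  have "addable (dbl (sshape S)) (if f then mir p else p) \<and>
      addable (insert (if f then mir p else p) (dbl (sshape S))) (if f then p else mir p)"
  \<comment> \<open>For a primed entry the positive copy sits on the mirror cell and precedes the
    negative one in level, so the mirror cell is added first. This is legal because primed entries
    are off the diagonal.\<close>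
  proof (cases f)
    case True
    then have lt: "fst p < snd p" using ad le by auto
    have "Young (insert (mir p) (dbl (sshape S)))"
    proof (rule Young_remove[of p])
      have n: "mir p \<notin> insert p (dbl (sshape S))" "Young (insert (mir p) (insert p (dbl (sshape S))))"
        "p \<notin> dbl (sshape S)" "Young (dbl (sshape S))"
        using a by (auto simp: addable_def)
      show "Young (insert p (insert (mir p) (dbl (sshape S))))" using n by (simp add: insert_commute)
      show "p \<notin> insert (mir p) (dbl (sshape S))" using n by auto
      show "\<not> (fst p \<le> i \<and> snd p \<le> j)" if "(i, j) \<in> insert (mir p) (dbl (sshape S))" for i j
      proof
        assume h: "fst p \<le> i \<and> snd p \<le> j"
        have "(i, j) \<noteq> mir p" using h lt by (auto simp: mir_def)
        then have "p \<in> dbl (sshape S)" using that YoungD[OF n(4), of i j "fst p" "snd p"] h by auto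
        then show False using n by simp
      qed
    qed
    then have "addable (dbl (sshape S)) (mir p)" using a by (auto simp: addable_def)
    then show ?thesis using True addable_swap[OF a] by simp
  qed (use a in simp)
  then show ?case using v lets k ushape_dbls[of S] by auto
qed simp

lemma colend_addable: "addable S c \<Longrightarrow> snd c = j \<Longrightarrow> colend S j = c"
  using addable_colend by blast

lemma rowend_addable: "addable S c \<Longrightarrow> fst c = i \<Longrightarrow> rowend S i = c"
  using addable_rowend by blast

lemma rowend_insert: "fst c \<noteq> i \<Longrightarrow> rowend (insert c S) i = rowend S i"
  using lineend_insert[of 1 c i S] by (simp add: lineend_def crd_def)

text \<open>The insertion of \<open>x\<close> meets each entry with the cell \<open>c0\<close>, that
  of \<open>-x\<close> with the mirror image of \<open>c0\<close>. The resulting four applications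
  of \<open>push\<close> to the copies \<open>k\<close> and \<open>-k\<close> amount to one
  \<open>spush\<close>.\<close>

theorem urun_dbls:
  assumes "svalid S" "0 < x" "x \<notin> sletters S" "sins x S = (c, S')"
  shows "urun [int x, - int x] (dbls S) = ([c, mir c], dbls S')"
  using assms
proof (induction S arbitrary: c S')
  case Nil
  moreover have "colend {(0, 0)} 0 = (Suc 0, 0)" by (auto intro: colend_eqI)
  ultimately show ?case by (auto simp: lev_def lineend_def mir_def Let_def)
next
  case (Cons e S)
  obtain k p f where e: "e = (k, p, f)" by (cases e)
  show ?case
  proof (cases "x < k")
    case False
    have lt: "\<forall>l \<in> sletters (e # S). l < x" using False Cons.prems(1,3) e by auto
    let ?D = "dbls (e # S)"
    have c: "c = srow (sshape (e # S)) 0" "S' = (x, c, False) # e # S"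
      using sins_top[OF lt] Cons.prems(4) by auto
    have ad: "saddable (sshape (e # S)) c" using c saddable_srow0 svalid_SYoung Cons.prems(1) by blast
    have f0: "fst c = 0" using c by simp
    note a = addable_dbl[OF ad]
    have "\<forall>l \<in> uletters ?D. lev l < lev (int x)"
      unfolding uletters_dbls using lt Cons.prems(2) by (auto simp: lev_def)
    then have 1: "uins (int x) ?D = (c, (int x, c) # ?D)"
      using uins_top[of ?D "int x"] rowend_addable[OF a(1) f0] Cons.prems(2) ushape_dbls[of "e # S"]
      by (simp add: lineend_def)
    have "\<forall>l \<in> uletters ((int x, c) # ?D). lev l < lev (- int x)"
      using \<open>\<forall>l \<in> uletters ?D. lev l < lev (int x)\<close> Cons.prems(2) by (fastforce simp: lev_def)
    then have 2: "uins (- int x) ((int x, c) # ?D) = (mir c, (- int x, mir c) # (int x, c) # ?D)"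
      using uins_top[of "(int x, c) # ?D" "- int x"] colend_addable[OF a(2), of 0] f0 ushape_dbls[of "e # S"]
      by (simp add: lineend_def mir_def)
    show ?thesis using 1 2 c(2) by simp
  next
    case True
    obtain c0 S0 where c0: "sins x S = (c0, S0)" by (cases "sins x S")
    obtain q g d where q: "spush (sshape S) p f c0 = ((q, g), d)" by (metis prod.collapse)
    have r: "c = d" "S' = (k, q, g) # S0" using Cons.prems(4) e True c0 q by auto
    have v: "svalid S" "saddable (sshape S) p" "fst p = snd p \<longrightarrow> \<not> f" "x \<notin> sletters S" using Cons.prems e by auto
    have p0: "sshape S0 = insert c0 (sshape S)" "saddable (sshape S) c0"
      using sins_props[OF v(1) Cons.prems(2) v(4) c0] by auto
    have IH: "urun [int x, - int x] (dbls S) = ([c0, mir c0], dbls S0)"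
      using Cons.IH[OF v(1) Cons.prems(2) v(4) c0] .
    obtain D1 where D1: "uins (int x) (dbls S) = (c0, D1)" "uins (- int x) D1 = (mir c0, dbls S0)"
      using IH by (auto split: prod.splits)
    have fresh: "int x \<notin> uletters (dbls S)" "- int x \<notin> uletters (dbls S)"
    proof -
      have "y \<in> uletters (dbls S) \<Longrightarrow> nat \<bar>y\<bar> \<in> sletters S" for y
        unfolding uletters_dbls by (force simp: image_iff)
      from this[of "int x"] this[of "- int x"] show "int x \<notin> uletters (dbls S)" "- int x \<notin> uletters (dbls S)"
        using v(4) by (metis nat_int abs_of_nat, metis nat_int abs_of_nat abs_minus_cancel)
    qed
    have D1s: "ushape D1 = insert c0 (dbl (sshape S))"
      using uins_props[OF uvalid_dbls[OF v(1)] _ fresh(1) D1(1)] Cons.prems(2) ushape_dbls by auto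
    have lv: "lev (int x) < lev (int k)" "lev (int x) < lev (- int k)" "lev (- int x) < lev (int k)"
      "lev (- int x) < lev (- int k)" "lev (int k) < lev (- int k)" "0 < int k"
      using True by (auto simp: lev_def)
    let ?a = "if f then mir p else p" and ?b = "if f then p else mir p"
    let ?X = "dbl (sshape S)"
    have two: "urun [int x, - int x] (dbls (e # S)) =
      (let (a1, e1) = push (int k) ?X ?a c0;
           (b1, g1) = push (- int k) (insert ?a ?X) ?b e1;
           (a2, e2) = push (int k) (insert c0 ?X) a1 (mir c0);
           (b2, g2) = push (- int k) (insert a1 (insert c0 ?X)) b1 e2
       in ([g1, g2], (- int k, b2) # (int k, a2) # dbls S0))"
      using lv D1 D1s e ushape_dbls[of S] by (simp add: Let_def split: prod.splits)
    have le: "fst p \<le> snd p" "fst c0 \<le> snd c0" using saddable_le v(2) p0(2) by blast+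
    show ?thesis
    proof (cases "c0 = p")
      case False
      have "mir c0 \<noteq> p" "mir p \<noteq> c0" using mir_le_neq le by blast+
      moreover have "q = p" "g = f" "d = c0" using q False by (auto simp: spush_def)
      ultimately show ?thesis using two False r by (auto simp: push_def)
    next
      case hit: True
      have q': "(q, g) = snext (insert p (sshape S)) p f" "d = q"
        using q hit unfolding spush_def Let_def by (auto split: prod.splits)
      have sq: "saddable (insert p (sshape S)) q"
        using spush_props(1)[OF v(2) p0(2) v(3) q] hit by simp
      note ap = addable_dbl[OF v(2)]
      note aq = addable_dbl[OF sq]
      have dp: "dbl (insert p (sshape S)) = insert (mir p) (insert p ?X)" by (rule dbl_insert)
      have leq: "fst q \<le> snd q" using saddable_le[OF sq] .
      have ne: "mir p \<noteq> q" "mir q \<noteq> p" "mir q \<noteq> q" "mir p \<noteq> p" using mir_le_neq le leq by blast+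
      have pq: "p \<noteq> q" using sq by (auto simp: saddable_def)
      show ?thesis
      proof (cases "f \<or> fst p = snd p")
        case False
        then have qq: "q = srow (insert p (sshape S)) (Suc (fst p))" "\<not> g" using q' by (auto simp: snext_def)
        then have fq: "fst q = Suc (fst p)" by simp
        have 1: "rowend (insert p ?X) (Suc (fst p)) = q"
          using rowend_addable[OF aq(1) fq] False rowend_insert[of "mir p" "Suc (fst p)" "insert p ?X"]
          unfolding dp by (auto simp: mir_def)
        have 2: "colend (insert (mir p) (insert q (insert p ?X))) (Suc (fst p)) = mir q"
          using colend_addable[OF aq(2), of "Suc (fst p)"] fq unfolding dp by (simp add: mir_def insert_commute)
        \<comment> \<open>Unprimed, off the diagonal: \<open>k\<close> moves from \<open>p\<close>
          during the first insertion, \<open>-k\<close> from the mirror cell during the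
          second.\<close>
        have P: "push (int k) ?X p p = (q, q)" "push (- int k) (insert p ?X) (mir p) q = (mir p, q)"
          "push (int k) (insert p ?X) q (mir p) = (q, mir p)"
          "push (- int k) (insert q (insert p ?X)) (mir p) (mir p) = (mir q, mir q)"
          using ne lv(6) 1 2 by (auto simp: push_def lineend_def crd_def mir_def[of p] Let_def)
        show ?thesis unfolding two hit r q'(2) using False qq(2) by (simp only: P dbls.simps Let_def prod.case if_False de_Morgan_disj)
      next
        case fl: True
        then have qq: "q = scol (insert p (sshape S)) (Suc (snd p))" g using q' by (auto simp: snext_def)
        then have sq': "snd q = Suc (snd p)" by simp
        have fq: "fst q \<le> fst p" using saddable_next_col(2)[OF v(2)] qq by simp
        have R: "rowend (insert (mir p) (insert p ?X)) (Suc (Suc (snd p))) = mir q"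
          using rowend_addable[OF aq(2), of "Suc (Suc (snd p))"] rowend_insert[of q "Suc (Suc (snd p))"] fq le sq'
          unfolding dp by (simp add: mir_def)
        have C: "colend (insert (mir p) (insert p ?X)) (Suc (snd p)) = q"
          using colend_addable[OF aq(1) sq'] unfolding dp .
        show ?thesis
        proof (cases f)
          case True
          \<comment> \<open>Primed: now \<open>-k\<close> is the copy on \<open>p\<close> and moves
            during the first insertion, \<open>k\<close> follows during the second.\<close>
          have P: "push (int k) ?X (mir p) p = (mir p, p)" "push (- int k) (insert (mir p) ?X) p p = (q, q)"
            "push (int k) (insert p ?X) (mir p) (mir p) = (mir q, mir q)"
            "push (- int k) (insert (mir p) (insert p ?X)) q (mir q) = (q, mir q)"
            using ne lv(6) R C insert_commute[of p "mir p" ?X] by (auto simp: push_def lineend_def crd_def mir_def[of p] Let_def)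
          show ?thesis unfolding two hit r q'(2) using True qq(2) by (simp only: P dbls.simps Let_def prod.case if_True)
        next
          case False
          then have dg: "fst p = snd p" using fl by simp
          \<comment> \<open>On the diagonal the first insertion sends \<open>k\<close> from
            \<open>p\<close> to \<open>mir p\<close> and thereby \<open>-k\<close> from there to
            \<open>q\<close>; the second sends \<open>k\<close> on to \<open>mir q\<close>. The
            copies have changed halves, which is the priming.\<close>
          have M: "rowend (insert p ?X) (Suc (fst p)) = mir p"
            using rowend_addable[OF ap(2), of "Suc (fst p)"] dg by (simp add: mir_def)
          have P: "push (int k) ?X p p = (mir p, mir p)" "push (- int k) (insert p ?X) (mir p) (mir p) = (q, q)"
            "push (int k) (insert p ?X) (mir p) (mir p) = (mir q, mir q)"
            "push (- int k) (insert (mir p) (insert p ?X)) q (mir q) = (q, mir q)"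
            using ne lv(6) R C M dg by (auto simp: push_def lineend_def crd_def mir_def[of p] Let_def)
          show ?thesis unfolding two hit r q'(2) using False qq(2) by (simp only: P dbls.simps Let_def prod.case if_False if_True)
        qed
      qed
    qed
  qed
qed

section \<open>Doubled words and doubled sequences of cells\<close>

fun srun :: "nat list \<Rightarrow> entry list \<Rightarrow> cell list \<times> entry list" where
  "srun [] S = ([], S)"
| "srun (x # xs) S = (let (c, S1) = sins x S; (cs, S2) = srun xs S1 in (c # cs, S2))"

fun dword :: "nat list \<Rightarrow> int list" where
  "dword [] = []"
| "dword (x # xs) = int x # - int x # dword xs"

fun dcells :: "cell list \<Rightarrow> cell list" where
  "dcells [] = []"
| "dcells (c # cs) = c # mir c # dcells cs"

lemma srun_append: "srun (xs @ ys) S = (let (cs, S1) = srun xs S; (ds, S2) = srun ys S1 in (cs @ ds, S2))"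
  by (induction xs arbitrary: S) (auto simp: Let_def split: prod.splits)

lemma snd_srun_append: "snd (srun (xs @ ys) S) = snd (srun ys (snd (srun xs S)))"
  by (simp add: srun_append Let_def split: prod.splits)

lemma srun_props:
  assumes "svalid S" "distinct w" "0 \<notin> set w" "set w \<inter> sletters S = {}" "srun w S = (cs, S')"
  shows "svalid S' \<and> sletters S' = set w \<union> sletters S \<and> length cs = length w"
  using assms
proof (induction w arbitrary: S cs)
  case (Cons x w)
  obtain c S1 where 1: "sins x S = (c, S1)" by (cases "sins x S")
  obtain ds where 2: "srun w S1 = (ds, S')" using Cons.prems(5) 1 by (auto split: prod.splits)
  have p: "svalid S1" "sletters S1 = insert x (sletters S)"
    using sins_props[OF Cons.prems(1) _ _ 1] Cons.prems by auto
  show ?case using Cons.IH[OF p(1) _ _ _ 2] p 1 2 Cons.prems by auto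
qed auto

lemma set_dword: "set (dword w) = int ` set w \<union> (\<lambda>x. - int x) ` set w"
  by (induction w) auto

lemma distinct_dword: "distinct w \<Longrightarrow> 0 \<notin> set w \<Longrightarrow> distinct (dword w)"
  by (induction w) (auto simp: set_dword)

lemma zero_dword: "0 \<notin> set w \<Longrightarrow> 0 \<notin> set (dword w)"
  by (auto simp: set_dword)

lemma fresh_dword: "0 \<notin> set w \<Longrightarrow> set w \<inter> sletters S = {} \<Longrightarrow> svalid S \<Longrightarrow> set (dword w) \<inter> uletters (dbls S) = {}"
proof -
  assume a: "0 \<notin> set w" "set w \<inter> sletters S = {}" "svalid S"
  have 1: "y \<in> set (dword w) \<Longrightarrow> nat \<bar>y\<bar> \<in> set w" for y unfolding set_dword by auto
  have 2: "y \<in> uletters (dbls S) \<Longrightarrow> nat \<bar>y\<bar> \<in> sletters S" for y unfolding uletters_dbls by (force simp: image_iff)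
  show ?thesis using 1 2 a(2) by blast
qed

lemma urun_dword:
  assumes "svalid S" "distinct w" "0 \<notin> set w" "set w \<inter> sletters S = {}" "srun w S = (cs, S')"
  shows "urun (dword w) (dbls S) = (dcells cs, dbls S')"
  using assms
proof (induction w arbitrary: S cs)
  case (Cons x w)
  obtain c S1 where 1: "sins x S = (c, S1)" by (cases "sins x S")
  obtain ds where 2: "srun w S1 = (ds, S')" "cs = c # ds" using Cons.prems(5) 1 by (auto split: prod.splits)
  have x: "0 < x" "x \<notin> sletters S" using Cons.prems by auto
  have p: "svalid S1" "sletters S1 = insert x (sletters S)"
    using sins_props[OF Cons.prems(1) x 1] by auto
  have "urun (dword w) (dbls S1) = (dcells ds, dbls S')"
    using Cons.IH[OF p(1) _ _ _ 2(1)] p Cons.prems by auto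
  then show ?case
    using urun_append[of "[int x, - int x]" "dword w" "dbls S"] urun_dbls[OF Cons.prems(1) x 1] 2(2) by simp
qed auto

text \<open>Of the two cells of a label only one lies on or above the diagonal; it is the cell of
  the entry, and the sign found there gives the flag.\<close>

lemma dbls_inj: "svalid S \<Longrightarrow> svalid T \<Longrightarrow> dbls S = dbls T \<Longrightarrow> S = T"
proof (induction S arbitrary: T rule: dbls.induct)
  case 1
  then show ?case by (cases T rule: dbls.cases) auto
next
  case (2 k p f S)
  then obtain k' p' f' T' where T: "T = (k', p', f') # T'" by (cases T rule: dbls.cases) auto
  have le: "fst p \<le> snd p" "fst p' \<le> snd p'" using 2(2,3) T saddable_le by auto
  have "k = k'" "S = T'" "(if f then p else mir p) = (if f' then p' else mir p')"
    "(if f then mir p else p) = (if f' then mir p' else p')" using 2 T by auto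
  then show ?case using mir_le_neq[OF le] mir_le_neq[OF le(2,1)] T by (auto split: if_splits)
qed

text \<open>By \<open>uins_adjacent\<close> at each place. It lets letters be compared when only the
  new cells are known, as in \<open>srun_peak\<close>.\<close>

lemma urun_adjacent:
  assumes "uvalid S" "distinct w" "0 \<notin> set w" "set w \<inter> uletters S = {}" "urun w S = (cs, S')" "Suc i < length w"
  shows "w ! i < w ! Suc i \<longleftrightarrow> content (cs ! i) < content (cs ! Suc i)"
  using assms
proof (induction w arbitrary: S cs i)
  case (Cons x w)
  obtain c S1 where 1: "uins x S = (c, S1)" by (cases "uins x S")
  obtain ds where 2: "urun w S1 = (ds, S')" "cs = c # ds" using Cons.prems(5) 1 by (auto split: prod.splits)
  have p: "uvalid S1" "uletters S1 = insert x (uletters S)"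
    using uins_props[OF Cons.prems(1) _ _ 1] Cons.prems by auto
  show ?case
  proof (cases i)
    case 0
    obtain y v where w: "w = y # v" using Cons.prems(6) by (cases w) auto
    obtain c' S2 where 3: "uins y S1 = (c', S2)" by (cases "uins y S1")
    have "if x < y then rightof c c' else belowof c c'"
      using uins_adjacent[OF Cons.prems(1) _ _ _ _ _ 1 3] Cons.prems w by auto
    then have "x < y \<longleftrightarrow> content c < content c'"
      using rightof_content belowof_content by (metis less_asym)
    moreover have "cs ! Suc 0 = c'" using 2 3 w by (auto split: prod.splits)
    ultimately show ?thesis using 0 w 2 by simp
  next
    case (Suc j)
    then show ?thesis using Cons.IH[OF p(1) _ _ _ 2(1), of j] p Cons.prems 2(2) by auto
  qed
qed auto

text \<open>Applied to the word \<open>s\<^sub>1, -s\<^sub>1, ..., s\<^sub>4, -s\<^sub>4\<close>, these Knuth transformations realise every relation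
  of \<open>mix_rel\<close>; applied to the sequence of new cells they exchange the last two insertions.\<close>

definition mix_knuth :: "nat list" where
  "mix_knuth = [1, 5, 3, 1, 0, 2, 3, 5, 3, 2, 0, 4]"

lemma kn_numeral: "kn \<kappa> (numeral n) (x # r) = x # kn \<kappa> (pred_numeral n) r"
  by (simp add: numeral_eq_Suc)

lemma kn_map:
  assumes "\<And>x y. x \<in> set w \<Longrightarrow> y \<in> set w \<Longrightarrow> \<kappa> (g x) < \<kappa> (g y) \<longleftrightarrow> \<kappa>' x < \<kappa>' y"
  shows "kn \<kappa> j (map g w) = map g (kn \<kappa>' j w)"
  using assms by (induction \<kappa>' j w rule: kn.induct) (auto simp: kn3_def)

text \<open>Only comparisons of keys matter. So the effect of a list of moves can be computed on a
  concrete word of integers with the same comparisons and transported by \<open>g\<close>.\<close>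

lemma fold_kn_map:
  assumes "\<And>x y. x \<in> set w \<Longrightarrow> y \<in> set w \<Longrightarrow> \<kappa> (g x) < \<kappa> (g y) \<longleftrightarrow> \<kappa>' x < \<kappa>' y"
  shows "fold (kn \<kappa>) J (map g w) = map g (fold (kn \<kappa>') J w)"
  using assms
proof (induction J arbitrary: w)
  case (Cons j J)
  have "kn \<kappa> j (map g w) = map g (kn \<kappa>' j w)" by (rule kn_map) (rule Cons.prems)
  moreover have "fold (kn \<kappa>) J (map g (kn \<kappa>' j w)) = map g (fold (kn \<kappa>') J (kn \<kappa>' j w))"
    by (rule Cons.IH) (use Cons.prems in \<open>simp add: set_kn\<close>)
  ultimately show ?case by simp
qed simp

text \<open>Carries the model letters 1 to 4 and their negatives monotonically to the signed letters
  of a word; the eight relations thereby reduce to eight computations with numerals.\<close>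

definition sign_extend :: "int \<Rightarrow> int \<Rightarrow> int \<Rightarrow> int \<Rightarrow> int \<Rightarrow> int" where
  "sign_extend a b c d v = sgn v * (if \<bar>v\<bar> = 1 then a else if \<bar>v\<bar> = 2 then b else if \<bar>v\<bar> = 3 then c else d)"

lemma sign_extend_less:
  assumes "0 < a" "a < b" "b < c" "c < d" "x \<in> {1, 2, 3, 4, - 1, - 2, - 3, - 4}" "y \<in> {1, 2, 3, 4, - 1, - 2, - 3, - 4}"
  shows "sign_extend a b c d x < sign_extend a b c d y \<longleftrightarrow> x < y"
proof -
  let ?g = "sign_extend a b c d"
  have v: "?g 1 = a" "?g 2 = b" "?g 3 = c" "?g 4 = d" "?g (- 1) = - a" "?g (- 2) = - b" "?g (- 3) = - c" "?g (- 4) = - d"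
    by (simp_all add: sign_extend_def)
  have "\<forall>x \<in> {1, 2, 3, 4, - 1, - 2, - 3, - 4}. \<forall>y \<in> {1, 2, 3, 4, - 1, - 2, - 3, - 4}. ?g x < ?g y \<longleftrightarrow> x < y"
    using assms(1-4) by (simp add: v)
  then show ?thesis using assms(5,6) by blast
qed

lemma mix_knuth_word:
  assumes "mix_rel p q" "distinct p" "0 \<notin> set p"
  shows "fold (kn (\<lambda>x. x)) mix_knuth (dword p) = dword q"
proof -
  obtain a b c d where m:
    "(a \<le> b \<and> b \<le> c \<and> c < d \<and> p = [a,b,d,c] \<and> q = [a,d,b,c]) \<or>
     (a \<le> b \<and> b < c \<and> c \<le> d \<and> p = [a,c,d,b] \<and> q = [a,c,b,d]) \<or>
     (a \<le> b \<and> b < c \<and> c < d \<and> p = [d,a,c,b] \<and> q = [a,d,c,b]) \<or>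
     (a < b \<and> b \<le> c \<and> c < d \<and> p = [b,a,d,c] \<and> q = [b,d,a,c]) \<or>
     (a < b \<and> b < c \<and> c \<le> d \<and> p = [c,b,d,a] \<and> q = [c,d,b,a]) \<or>
     (a < b \<and> b \<le> c \<and> c < d \<and> p = [d,b,c,a] \<and> q = [b,d,c,a]) \<or>
     (a < b \<and> b \<le> c \<and> c \<le> d \<and> p = [b,c,d,a] \<and> q = [b,c,a,d]) \<or>
     (a \<le> b \<and> b < c \<and> c \<le> d \<and> p = [c,a,d,b] \<and> q = [c,d,a,b])"
    using assms(1) unfolding mix_rel_def by (elim exE) (erule that)
  then have lt: "a < b" "b < c" "c < d" "0 < a"
    using assms(2,3) by (elim disjE conjE; simp)+
  define g where "g = sign_extend (int a) (int b) (int c) (int d)"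
  have g: "g x < g y \<longleftrightarrow> x < y" if "x \<in> {1, 2, 3, 4, - 1, - 2, - 3, - 4}" "y \<in> {1, 2, 3, 4, - 1, - 2, - 3, - 4}" for x y
    unfolding g_def by (rule sign_extend_less[OF _ _ _ _ that]) (use lt in simp_all)
  have *: "fold (kn (\<lambda>x. x)) mix_knuth (map g w) = map g (fold (kn (\<lambda>x. x)) mix_knuth w)"
    if "set w \<subseteq> {1, 2, 3, 4, - 1, - 2, - 3, - 4}" for w
    by (rule fold_kn_map) (rule g[OF subsetD[OF that] subsetD[OF that]])
  have v: "g 1 = int a" "g 2 = int b" "g 3 = int c" "g 4 = int d" "g (- 1) = - int a" "g (- 2) = - int b"
    "g (- 3) = - int c" "g (- 4) = - int d" by (simp_all add: g_def sign_extend_def)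
  note ev = mix_knuth_def kn_numeral kn3_def v
  from m show ?thesis
  proof (elim disjE conjE)
    assume "p = [a,b,d,c]" "q = [a,d,b,c]"
    then show ?thesis using *[of "[1,-1,2,-2,4,-4,3,-3]"] by (simp add: ev)
  next
    assume "p = [a,c,d,b]" "q = [a,c,b,d]"
    then show ?thesis using *[of "[1,-1,3,-3,4,-4,2,-2]"] by (simp add: ev)
  next
    assume "p = [d,a,c,b]" "q = [a,d,c,b]"
    then show ?thesis using *[of "[4,-4,1,-1,3,-3,2,-2]"] by (simp add: ev)
  next
    assume "p = [b,a,d,c]" "q = [b,d,a,c]"
    then show ?thesis using *[of "[2,-2,1,-1,4,-4,3,-3]"] by (simp add: ev)
  next
    assume "p = [c,b,d,a]" "q = [c,d,b,a]"
    then show ?thesis using *[of "[3,-3,2,-2,4,-4,1,-1]"] by (simp add: ev)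
  next
    assume "p = [d,b,c,a]" "q = [b,d,c,a]"
    then show ?thesis using *[of "[4,-4,2,-2,3,-3,1,-1]"] by (simp add: ev)
  next
    assume "p = [b,c,d,a]" "q = [b,c,a,d]"
    then show ?thesis using *[of "[2,-2,3,-3,4,-4,1,-1]"] by (simp add: ev)
  next
    assume "p = [c,a,d,b]" "q = [c,d,a,b]"
    then show ?thesis using *[of "[3,-3,1,-1,4,-4,2,-2]"] by (simp add: ev)
  qed
qed

lemma content_mir: "content (mir c) = - 1 - content c"
  by (cases c) (simp add: content_def mir_def)

text \<open>The hypotheses fix the order of the contents except for \<open>y\<close> against
  \<open>d\<close>, so three model computations suffice, one of them with equal contents.\<close>

lemma mix_knuth_cells:
  assumes "0 \<le> content y" "content y < content z" "content z < content c" "content d < content z" "0 \<le> content d"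
  shows "fold (kn content) mix_knuth (dcells [y, z, c, d]) = dcells [y, z, d, c]"
proof -
  \<comment> \<open>Integers model the cells and \<open>x div 2\<close> models the content: 4 is
    \<open>z\<close>, 6 is \<open>c\<close>, \<open>m\<close> is \<open>y\<close> and
    \<open>n\<close> is \<open>d\<close>. The mirror image of \<open>v\<close> is
    \<open>- 1 - v\<close>, since \<open>(- 1 - v) div 2 = - 1 - v div 2\<close>. Halving provides
    two different integers, 2 and 3, for distinct cells of equal content.\<close>
  have *: "fold (kn content) mix_knuth (dcells [y, z, c, d]) = dcells [y, z, d, c]"
    if m: "m \<in> {0, 2}" "n \<in> {0, 2, 3}" "m \<noteq> n" "content y < content d \<longleftrightarrow> m div 2 < n div 2"
      "content d < content y \<longleftrightarrow> n div 2 < m div 2" for m n :: int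
  proof -
    define g where "g v = (if v = m then y else if v = n then d else if v = 4 then z else if v = 6 then c
      else if v = - 1 - m then mir y else if v = - 1 - n then mir d else if v = - 5 then mir z else mir c)" for v
    have v: "g m = y" "g n = d" "g 4 = z" "g 6 = c" "g (- 1 - m) = mir y" "g (- 1 - n) = mir d" "g (- 5) = mir z" "g (- 7) = mir c"
      using m(1-3) by (auto simp: g_def)
    have "\<forall>a \<in> {m, - 1 - m, 4, - 5, 6, - 7, n, - 1 - n}. \<forall>b \<in> {m, - 1 - m, 4, - 5, 6, - 7, n, - 1 - n}.
        content (g a) < content (g b) \<longleftrightarrow> a div 2 < b div 2"
      unfolding ball_simps v content_mir using m assms
      by (elim insertE emptyE) simp_all
    then have g: "content (g a) < content (g b) \<longleftrightarrow> a div 2 < b div 2"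
      if "a \<in> {m, - 1 - m, 4, - 5, 6, - 7, n, - 1 - n}" "b \<in> {m, - 1 - m, 4, - 5, 6, - 7, n, - 1 - n}" for a b
      using that by blast
    have "fold (kn content) mix_knuth (map g [m, - 1 - m, 4, - 5, 6, - 7, n, - 1 - n]) =
        map g (fold (kn (\<lambda>x. x div 2)) mix_knuth [m, - 1 - m, 4, - 5, 6, - 7, n, - 1 - n])"
      by (rule fold_kn_map) (rule g, simp_all)
    moreover have "fold (kn (\<lambda>x. x div 2)) mix_knuth [m, - 1 - m, 4, - 5, 6, - 7, n, - 1 - n]
        = [m, - 1 - m, 4, - 5, n, - 1 - n, 6, - 7]"
      using m(1-3) by (elim insertE emptyE) (simp_all add: mix_knuth_def kn_numeral kn3_def)
    ultimately show ?thesis by (simp add: v)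
  qed
  consider "content d < content y" | "content d = content y" | "content y < content d" by linarith
  then show ?thesis
  proof cases
    case 1 then show ?thesis using *[of 2 0] by simp
  next
    case 2 then show ?thesis using *[of 2 3] by simp
  next
    case 3 then show ?thesis using *[of 0 2] by simp
  qed
qed

lemma mix_rel_perm: "mix_rel p q \<Longrightarrow> set q = set p \<and> (distinct q \<longleftrightarrow> distinct p)"
  unfolding mix_rel_def by (elim exE disjE conjE) auto

text \<open>One application of \<open>urun_fold_kn\<close> to the doubled word: on letters the list
  produces \<open>q\<close>, on cells it gives the new recording, and \<open>dbls_inj\<close> leads
  back to shifted tableaux.\<close>

lemma srun_mix_rel:
  assumes "svalid S" "distinct p" "0 \<notin> set p" "set p \<inter> sletters S = {}" "mix_rel p q"
    "srun p S = (cs, S1)" "srun q S = (ds, S2)"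
  shows "S1 = S2 \<and> dcells ds = fold (kn content) mix_knuth (dcells cs)"
proof -
  have pq: "set q = set p" "distinct q"
    using assms(2,5) mix_rel_perm by auto
  have "urun (dword p) (dbls S) = (dcells cs, dbls S1)" "urun (dword q) (dbls S) = (dcells ds, dbls S2)"
    using urun_dword assms pq by auto
  moreover have "urun (fold (kn (\<lambda>a. a)) mix_knuth (dword p)) (dbls S) = (fold (kn content) mix_knuth (dcells cs), dbls S1)"
    using urun_fold_kn[OF uvalid_dbls[OF assms(1)] distinct_dword[OF assms(2,3)] zero_dword[OF assms(3)]
        fresh_dword[OF assms(3,4,1)]] urun_dword[OF assms(1-4,6)] by blast
  ultimately have "dbls S1 = dbls S2" "dcells ds = fold (kn content) mix_knuth (dcells cs)"
    using mix_knuth_word[OF assms(5,2,3)] by auto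
  moreover have "svalid S1" "svalid S2" using srun_props assms pq by blast+
  ultimately show ?thesis using dbls_inj by blast
qed

lemma srun_mix_move:
  assumes "svalid S" "distinct u" "0 \<notin> set u" "set u \<inter> sletters S = {}" "mix_move u v"
  shows "snd (srun u S) = snd (srun v S)"
proof -
  obtain x y p q where uv: "u = x @ p @ y" "v = x @ q @ y" "mix_rel p q \<or> mix_rel q p"
    using assms(5) unfolding mix_move_def by blast
  have pq: "set q = set p" "distinct q" "distinct p"
    using uv(3) assms(2) mix_rel_perm unfolding uv(1) by auto
  obtain cs S0 where x: "srun x S = (cs, S0)" by (cases "srun x S")
  have x': "svalid S0" "sletters S0 = set x \<union> sletters S"
    using srun_props[OF assms(1) _ _ _ x] assms(2-4) uv(1) by auto
  have f: "0 \<notin> set p" "set p \<inter> sletters S0 = {}" using assms(2-4) uv(1) x' by auto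
  have f': "0 \<notin> set q" "set q \<inter> sletters S0 = {}" using f pq(1) by auto
  obtain cs1 T1 where p1: "srun p S0 = (cs1, T1)" by (cases "srun p S0")
  obtain cs2 T2 where p2: "srun q S0 = (cs2, T2)" by (cases "srun q S0")
  from uv(3) have "T1 = T2"
  proof
    assume "mix_rel p q"
    then show ?thesis using srun_mix_rel[OF x'(1) pq(3) f _ p1 p2] by blast
  next
    assume "mix_rel q p"
    then show ?thesis using srun_mix_rel[OF x'(1) pq(2) f' _ p2 p1] by blast
  qed
  then have "snd (srun p S0) = snd (srun q S0)" using p1 p2 by simp
  then show ?thesis using x by (simp add: uv(1,2) snd_srun_append)
qed

section \<open>Reverse insertion\<close>

definition corner :: "cell set \<Rightarrow> cell \<Rightarrow> bool" where
  "corner S c \<longleftrightarrow> c \<in> S \<and> SYoung S \<and> SYoung (S - {c})"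

lemma corner_insert: "saddable S c \<Longrightarrow> corner (insert c S) c"
  unfolding corner_def saddable_def by simp

lemma saddable_eq_row: "saddable S c \<Longrightarrow> saddable S d \<Longrightarrow> fst c = fst d \<Longrightarrow> c = d"
  using saddable_srow by metis

lemma corner_eq_row:
  assumes "corner S c" "corner S d" "fst c = fst d" shows "c = d"
proof (rule ccontr)
  assume ne: "c \<noteq> d"
  obtain i j j' where c: "c = (i, j)" "d = (i, j')" using assms(3) by (cases c; cases d) auto
  have "j' \<noteq> j" using ne c by simp
  moreover have "j < j' \<Longrightarrow> False"
    using SYoungD[of "S - {c}" i j' i j] assms(1,2) ne c SYoung_le[of S] unfolding corner_def by auto
  moreover have "j' < j \<Longrightarrow> False"
    using SYoungD[of "S - {d}" i j i j'] assms(1,2) ne c SYoung_le[of S] unfolding corner_def by auto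
  ultimately show False by linarith
qed

lemma corner_eq_col:
  assumes "corner S c" "corner S d" "snd c = snd d" shows "c = d"
proof (rule ccontr)
  assume ne: "c \<noteq> d"
  obtain i i' j where c: "c = (i, j)" "d = (i', j)" using assms(3) by (cases c; cases d) auto
  have "i' \<noteq> i" using ne c by simp
  moreover have "i < i' \<Longrightarrow> False"
    using SYoungD[of "S - {c}" i' j i j] assms(1,2) ne c SYoung_le[of S i j] unfolding corner_def by auto
  moreover have "i' < i \<Longrightarrow> False"
    using SYoungD[of "S - {d}" i j i' j] assms(1,2) ne c SYoung_le[of S i' j] unfolding corner_def by auto
  ultimately show False by linarith
qed

text \<open>The three possible origins of the largest entry of the result; reverse insertion is an
  induction along them.\<close>

lemma sins_cases:
  assumes "svalid S" "0 < x" "x \<notin> sletters S" "sins x S = (c, (l, q, g) # R)"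
  obtains (new) "x = l" "S = R" "c = q" "q = srow (sshape R) 0" "\<not> g"
  | (hit) p f S0 where "x < l" "S = (l, p, f) # S0" "sins x S0 = (p, R)" "c = q" "(q, g) = snext (sshape R) p f"
      "corner (sshape R) p" "fst p = snd p \<longrightarrow> \<not> f"
  | (miss) S0 where "x < l" "S = (l, q, g) # S0" "sins x S0 = (c, R)" "c \<noteq> q"
proof (cases "\<forall>l \<in> sletters S. l < x")
  case True
  then show thesis using new assms(4) sins_top[OF True] by auto
next
  case False
  then obtain k p f S0 where S: "S = (k, p, f) # S0" by (cases S rule: dbls.cases) auto
  have k: "x < k" using False assms(1,3) S by fastforce
  obtain c0 R0 where c0: "sins x S0 = (c0, R0)" by (cases "sins x S0")
  obtain q' g' d where q': "spush (sshape S0) p f c0 = ((q', g'), d)" by (metis prod.collapse)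
  have e: "l = k" "q' = q" "g' = g" "R0 = R" "c = d" using assms(4) S k c0 q' by auto
  have p: "sshape R = insert c0 (sshape S0)" "saddable (sshape S0) p" "saddable (sshape S0) c0"
    using sins_props[OF _ assms(2) _ c0] assms(1,3) S e by auto
  show thesis
  proof (cases "c0 = p")
    case True
    then have "(q, g) = snext (sshape R) p f" "c = q"
      using q' e p(1) unfolding spush_def Let_def by (auto split: prod.splits)
    then show thesis using hit[of p f S0] k e S c0 True p corner_insert[OF p(2)] assms(1) by auto
  next
    case False
    then have "p = q" "f = g" "c = c0" using q' e by (auto simp: spush_def)
    then show thesis using miss[of S0] k e S c0 False by auto
  qed
qed

text \<open>The flag at the target tells whether the last move went along a column or a row, the
  target then names the line of the source, and a line holds only one corner. The flag at the source
  is forced on the diagonal and unchanged off it.\<close>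

lemma snext_inj:
  assumes "(q, g) = snext R p f" "(q, g) = snext R p' f'" "corner R p" "corner R p'"
    "fst p = snd p \<longrightarrow> \<not> f" "fst p' = snd p' \<longrightarrow> \<not> f'"
  shows "p = p' \<and> f = f'"
proof (cases g)
  case True
  then have a: "f \<or> fst p = snd p" "f' \<or> fst p' = snd p'"
    and "q = scol R (Suc (snd p))" "q = scol R (Suc (snd p'))"
    using assms(1,2) unfolding snext_def by (auto split: if_splits)
  then have "snd q = Suc (snd p)" "snd q = Suc (snd p')" by (metis snd_colend)+
  then have "p = p'" using corner_eq_col[OF assms(3,4)] by simp
  then show ?thesis using a assms(5,6) by auto
next
  case False
  then have a: "\<not> f" "\<not> f'" and "q = srow R (Suc (fst p))" "q = srow R (Suc (fst p'))"
    using assms(1,2) unfolding snext_def by (auto split: if_splits)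
  then have "fst q = Suc (fst p)" "fst q = Suc (fst p')" by (metis fst_srow)+
  then show ?thesis using a corner_eq_row[OF assms(3,4)] by simp
qed

lemma snext_new: "(srow R' 0, False) \<noteq> snext R p f"
  unfolding snext_def by (auto dest!: arg_cong[where f = fst])

text \<open>The largest entry and the new cell reveal the case: \<open>miss\<close> is the one with
  a different new cell, and a freshly inserted entry, unprimed in row 0, is never the target of a
  bump (\<open>snext_new\<close>).\<close>

theorem sins_inj:
  assumes "svalid S" "0 < x" "x \<notin> sletters S" "svalid T" "0 < y" "y \<notin> sletters T"
    "sins x S = (c, S')" "sins y T = (c, S')"
  shows "x = y \<and> S = T"
  using assms
proof (induction S' arbitrary: S T c)
  case Nil
  then show ?case using sins_props[OF Nil(1-3,7)] by auto
next
  case (Cons e R)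
  obtain l q g where e: "e = (l, q, g)" by (cases e)
  note s = Cons.prems(7)[unfolded e] and t = Cons.prems(8)[unfolded e]
  from Cons.prems(1-3) s show ?case
  proof (cases rule: sins_cases)
    case new
    note n = new
    from Cons.prems(4-6) t show ?thesis
    proof (cases rule: sins_cases)
      case new
      then show ?thesis using n by simp
    next
      case hit
      then show ?thesis using n snext_new by metis
    next
      case miss
      then show ?thesis using n by simp
    qed
  next
    case (hit p f S0)
    note h = hit
    from Cons.prems(4-6) t show ?thesis
    proof (cases rule: sins_cases)
      case new
      then show ?thesis using h snext_new by metis
    next
      case (hit p' f' T0)
      have "p = p' \<and> f = f'" using snext_inj[OF h(5) hit(5) h(6) hit(6) h(7) hit(7)] .
      then show ?thesis using Cons.IH[of S0 T0 p] h hit Cons.prems by auto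
    next
      case miss
      then show ?thesis using h by simp
    qed
  next
    case (miss S0)
    note m = miss
    from Cons.prems(4-6) t show ?thesis
    proof (cases rule: sins_cases)
      case new
      then show ?thesis using m by simp
    next
      case hit
      then show ?thesis using m by simp
    next
      case (miss T0)
      then show ?thesis using Cons.IH[of S0 T0 c] m Cons.prems by auto
    qed
  qed
qed

text \<open>Among the cells weakly southeast of \<open>a\<close>, one with the largest coordinate
  sum has no further cell of the shape to its southeast.\<close>

lemma maximal_corner:
  assumes "SYoung S" "a \<in> S"
  obtains z where "corner S z" "fst a \<le> fst z" "snd a \<le> snd z"
proof -
  let ?A = "{z \<in> S. fst a \<le> fst z \<and> snd a \<le> snd z}"
  let ?w = "\<lambda>z. fst z + snd z :: nat"
  have "a \<in> ?A" using assms(2) by simp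
  then have fin: "finite ?A" "?A \<noteq> {}" using SYoung_finite[OF assms(1)] by (simp, blast)
  then have "Max (?w ` ?A) \<in> ?w ` ?A" using Max_in by (metis (no_types, lifting) finite_imageI image_is_empty)
  then obtain z where z: "z \<in> ?A" "?w z = Max (?w ` ?A)" by force
  have m: "?w y \<le> ?w z" if "y \<in> ?A" for y unfolding z(2) using fin that by (intro Max_ge) auto
  have "SYoung (S - {z})"
  proof (rule SYoungI)
    show "finite (S - {z})" using SYoung_finite[OF assms(1)] by simp
    show "i \<le> j" if "(i, j) \<in> S - {z}" for i j using that SYoung_le[OF assms(1)] by blast
    fix i j i' j' assume h: "(i, j) \<in> S - {z}" "i' \<le> i" "j' \<le> j" "i' \<le> j'"
    have "(i', j') \<noteq> z"
    proof
      assume "(i', j') = z"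
      then have "(i, j) \<in> ?A" using h z(1) by auto
      then have "i + j \<le> i' + j'" using m \<open>(i', j') = z\<close> by fastforce
      then show False using h \<open>(i', j') = z\<close> by auto
    qed
    then show "(i', j') \<in> S - {z}" using SYoungD[OF assms(1) _ h(2-4)] h(1) by blast
  qed
  then show thesis using that z(1) assms(1) unfolding corner_def by blast
qed

lemma SYoung_Int: "SYoung S \<Longrightarrow> SYoung T \<Longrightarrow> SYoung (S \<inter> T)"
  by (rule SYoungI) (use SYoung_finite SYoung_le SYoungD in blast)+

lemma saddable_corner_remove:
  assumes "saddable R q" "corner (insert q R) c" "c \<noteq> q"
  shows "corner R c" "saddable (R - {c}) q"
proof -
  have R: "SYoung R" "q \<notin> R" "SYoung (insert q R)" using assms(1) by (auto simp: saddable_def)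
  have c: "c \<in> R" "SYoung (insert q R - {c})" using assms(2,3) by (auto simp: corner_def)
  have "R \<inter> (insert q R - {c}) = R - {c}" by blast
  then have S: "SYoung (R - {c})" using SYoung_Int[OF R(1) c(2)] by simp
  then show "corner R c" using R c by (auto simp: corner_def)
  have "insert q (R - {c}) = insert q R - {c}" using assms(3) by auto
  then show "saddable (R - {c}) q" using S R c by (auto simp: saddable_def)
qed

text \<open>The source lies in the column before \<open>q\<close> if the entry is primed, in the row
  above \<open>q\<close> if not. A corner weakly southeast of the neighbour of \<open>q\<close>
  there must stay in that line, because beyond it \<open>q\<close> would already belong to
  \<open>R\<close>.\<close>

lemma snext_surj:
  assumes "saddable R q" "fst q = snd q \<longrightarrow> \<not> g" "g \<or> 0 < fst q"
  obtains p f where "corner R p" "fst p = snd p \<longrightarrow> \<not> f" "snext R p f = (q, g)"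
proof -
  obtain i j where q: "q = (i, j)" by (cases q)
  have R: "SYoung R" "q \<notin> R" "SYoung (insert q R)" and le: "i \<le> j"
    using assms(1) saddable_le[OF assms(1)] q by (auto simp: saddable_def)
  show thesis
  proof (cases g)
    case True
    then have lt: "i < j" using assms(2) le q by auto
    then obtain j0 where j: "j = Suc j0" "i \<le> j0" by (cases j) auto
    have "(i, j0) \<in> R" using SYoungD[OF R(3), of i j i j0] q j by auto
    then obtain p where p: "corner R p" "fst (i, j0) \<le> fst p" "snd (i, j0) \<le> snd p"
      using maximal_corner[OF R(1)] by blast
    have "snd p = j0"
    proof (rule ccontr)
      assume "snd p \<noteq> j0"
      then have "(i, j) \<in> R" using SYoungD[OF R(1), of "fst p" "snd p" i j] p j le unfolding corner_def by auto
      then show False using R(2) q by simp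
    qed
    moreover have "scol R j = q" using saddable_scol[OF assms(1)] q by simp
    \<comment> \<open>A primed entry came either from the diagonal, where it was still unprimed, or
      from elsewhere, where it was primed already.\<close>
    ultimately have "snext R p (fst p \<noteq> snd p) = (q, g)" using True j by (auto simp: snext_def)
    then show thesis by (rule that[OF p(1), rotated]) simp
  next
    case False
    then obtain i0 where i: "i = Suc i0" using assms(3) q by (cases i) auto
    have "(i0, j) \<in> R" using SYoungD[OF R(3), of i j i0 j] q i le by auto
    then obtain p where p: "corner R p" "fst (i0, j) \<le> fst p" "snd (i0, j) \<le> snd p"
      using maximal_corner[OF R(1)] by blast
    have "fst p = i0"
    proof (rule ccontr)
      assume "fst p \<noteq> i0"
      then have "(i, j) \<in> R" using SYoungD[OF R(1), of "fst p" "snd p" i j] p i le unfolding corner_def by auto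
      then show False using R(2) q by simp
    qed
    moreover have "srow R i = q" using saddable_srow[OF assms(1)] q by simp
    ultimately have "snext R p False = (q, g)" "fst p \<noteq> snd p" using False i p(3) le by (auto simp: snext_def)
    then show thesis by (intro that[OF p(1), of False]) simp_all
  qed
qed

text \<open>If \<open>c\<close> is not the cell of the largest entry, that entry was untouched.
  Otherwise it was moved last; \<open>snext_surj\<close> pulls it back to a corner of the smaller
  tableau, and the reversal continues from that corner.\<close>

theorem sins_surj:
  assumes "svalid S'" "corner (sshape S') c"
  shows "\<exists>x S. svalid S \<and> 0 < x \<and> x \<notin> sletters S \<and> sins x S = (c, S')"
  using assms
proof (induction S' arbitrary: c)
  case Nil
  then show ?case by (simp add: corner_def)
next
  case (Cons e R)
  obtain l q g where e: "e = (l, q, g)" by (cases e)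
  have v: "svalid R" "saddable (sshape R) q" "fst q = snd q \<longrightarrow> \<not> g" "0 < l" "\<forall>k \<in> sletters R. k < l"
    using Cons.prems(1) e by auto
  have cor: "corner (insert q (sshape R)) c" using Cons.prems(2) e by simp
  show ?case
  proof (cases "c = q")
    case False
    note r = saddable_corner_remove[OF v(2) cor False]
    obtain x S0 where x: "svalid S0" "0 < x" "x \<notin> sletters S0" "sins x S0 = (c, R)"
      using Cons.IH[OF v(1) r(1)] by blast
    have p: "sletters R = insert x (sletters S0)" "sshape R = insert c (sshape S0)" "saddable (sshape S0) c"
      using sins_props[OF x] by auto
    then have "sshape R - {c} = sshape S0" by (auto simp: saddable_def)
    then have "svalid ((l, q, g) # S0)" using v p x r(2) by auto
    moreover have "sins x ((l, q, g) # S0) = (c, e # R)" using x(4) v(5) p(1) e False by (auto simp: spush_def)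
    ultimately show ?thesis using x v p by (intro exI[of _ x] exI[of _ "(l, q, g) # S0"]) auto
  next
    case True
    show ?thesis
    proof (cases "g \<or> 0 < fst q")
      case False
      \<comment> \<open>An unprimed entry at the end of row 0 is the inserted letter itself; here
        the reversal stops.\<close>
      then have "srow (sshape R) 0 = q" using saddable_srow[OF v(2)] by simp
      then have "sins l R = (c, e # R)" using sins_top[OF v(5)] True False e by simp
      then show ?thesis using v by blast
    next
      case g: True
      obtain p f where p: "corner (sshape R) p" "fst p = snd p \<longrightarrow> \<not> f" "snext (sshape R) p f = (q, g)"
        using snext_surj[OF v(2,3) g] .
      obtain x S0 where x: "svalid S0" "0 < x" "x \<notin> sletters S0" "sins x S0 = (p, R)"
        using Cons.IH[OF v(1) p(1)] by blast
      have s: "sletters R = insert x (sletters S0)" "sshape R = insert p (sshape S0)" "saddable (sshape S0) p"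
        using sins_props[OF x] by auto
      have "svalid ((l, p, f) # S0)" using v p s x by auto
      moreover have "sins x ((l, p, f) # S0) = (c, e # R)" using x(4) v(5) s p(3) e True by (auto simp: spush_def)
      ultimately show ?thesis using x v s by (intro exI[of _ x] exI[of _ "(l, p, f) # S0"]) auto
    qed
  qed
qed

text \<open>Corners are peeled off one by one. In \<open>exchange_corners\<close> this supplies the
  common prefix in front of the last four letters.\<close>

lemma srun_surj:
  assumes "svalid S"
  shows "\<exists>w. distinct w \<and> set w = sletters S \<and> snd (srun w []) = S"
proof -
  have "length S = n \<Longrightarrow> svalid S \<Longrightarrow> ?thesis" for n
  proof (induction n arbitrary: S)
    case 0
    then show ?case by (intro exI[of _ "[]"]) auto
  next
    case (Suc n)
    then obtain l q g R where S: "S = (l, q, g) # R" by (cases S rule: dbls.cases) auto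
    then have "corner (sshape S) q" using Suc.prems corner_insert by auto
    then obtain x S0 where x: "svalid S0" "0 < x" "x \<notin> sletters S0" "sins x S0 = (q, S)"
      using sins_surj Suc.prems by blast
    have "sletters S = insert x (sletters S0)" using sins_props[OF x] by auto
    have len: "length (snd (sins x T)) = Suc (length T)" for T
      by (induction x T rule: sins.induct) (auto simp: Let_def split: prod.splits)
    have "length S0 = n" using len[of S0] x(4) Suc.prems by simp
    then obtain w where w: "distinct w" "set w = sletters S0" "snd (srun w []) = S0" using Suc.IH x(1) by blast
    then have "snd (srun (w @ [x]) []) = S" using x(4) by (simp add: snd_srun_append)
    then show ?case using w x \<open>sletters S = insert x (sletters S0)\<close>
      by (intro exI[of _ "w @ [x]"]) auto
  qed
  then show ?thesis using assms by blast
qed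

section \<open>Connectedness\<close>

lemma mix_relI:
  "a \<le> b \<Longrightarrow> b \<le> c \<Longrightarrow> c < d \<Longrightarrow> mix_rel [a,b,d,c] [a,d,b,c]"
  "a \<le> b \<Longrightarrow> b < c \<Longrightarrow> c \<le> d \<Longrightarrow> mix_rel [a,c,d,b] [a,c,b,d]"
  "a \<le> b \<Longrightarrow> b < c \<Longrightarrow> c < d \<Longrightarrow> mix_rel [d,a,c,b] [a,d,c,b]"
  "a < b \<Longrightarrow> b \<le> c \<Longrightarrow> c < d \<Longrightarrow> mix_rel [b,a,d,c] [b,d,a,c]"
  "a < b \<Longrightarrow> b < c \<Longrightarrow> c \<le> d \<Longrightarrow> mix_rel [c,b,d,a] [c,d,b,a]"
  "a < b \<Longrightarrow> b \<le> c \<Longrightarrow> c < d \<Longrightarrow> mix_rel [d,b,c,a] [b,d,c,a]"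
  "a < b \<Longrightarrow> b \<le> c \<Longrightarrow> c \<le> d \<Longrightarrow> mix_rel [b,c,d,a] [b,c,a,d]"
  "a \<le> b \<Longrightarrow> b < c \<Longrightarrow> c \<le> d \<Longrightarrow> mix_rel [c,a,d,b] [c,d,a,b]"
  unfolding mix_rel_def
  by (rule exI[of _ a], rule exI[of _ b], rule exI[of _ c], rule exI[of _ d], simp)+

text \<open>The relations in terms of comparisons of letters with letters further to the right; such
  comparisons have the same outcome for letters and for labels.\<close>

lemma mix_rel_first: "mix_rel [w, x, y, z] [x, w, y, z] \<longleftrightarrow>
    \<not> w \<le> y \<and> (x \<le> z \<and> \<not> y \<le> z \<or> \<not> x \<le> z \<and> x \<le> y)" (is "?l \<longleftrightarrow> ?r")
proof
  show "?l \<Longrightarrow> ?r" unfolding mix_rel_def by (elim exE disjE conjE) auto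
  show "?r \<Longrightarrow> ?l" using mix_relI(3)[of x z y w] mix_relI(6)[of z x y w] by linarith
qed

lemma mix_rel_middle: "mix_rel [w, x, y, z] [w, y, x, z] \<longleftrightarrow>
    w \<le> x \<and> x \<le> z \<and> \<not> y \<le> z \<or> \<not> w \<le> x \<and> w \<le> z \<and> \<not> y \<le> z \<or>
    \<not> w \<le> x \<and> \<not> x \<le> z \<and> w \<le> y \<or> x \<le> z \<and> \<not> w \<le> z \<and> w \<le> y" (is "?l \<longleftrightarrow> ?r")
proof
  show "?l \<Longrightarrow> ?r" unfolding mix_rel_def by (elim exE disjE conjE) auto
  show "?r \<Longrightarrow> ?l" using mix_relI(1)[of w x z y] mix_relI(4)[of x w z y] mix_relI(5)[of z x w y] mix_relI(8)[of x z w y]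
    by linarith
qed

lemma mix_rel_last: "mix_rel [w, x, y, z] [w, x, z, y] \<longleftrightarrow>
    x \<le> y \<and> (w \<le> z \<and> \<not> x \<le> z \<or> \<not> w \<le> z \<and> w \<le> x)" (is "?l \<longleftrightarrow> ?r")
proof
  show "?l \<Longrightarrow> ?r" unfolding mix_rel_def by (elim exE disjE conjE) auto
  show "?r \<Longrightarrow> ?l" using mix_relI(2)[of w z x y] mix_relI(7)[of z w x y] by linarith
qed

text \<open>For distinct letters, eight of the 24 orderings have the largest of the last three
  letters in third place, and these are the eight left-hand sides. The weak inequalities of the
  relations cover the ties that a strict peak leaves open.\<close>

lemma mix_rel_peak:
  assumes "b < c" "d < c"
  shows "\<exists>q. mix_rel [a, b, c, d] q"
proof -
  have "mix_rel [a, b, c, d] [b, a, c, d] \<or> mix_rel [a, b, c, d] [a, c, b, d] \<or> mix_rel [a, b, c, d] [a, b, d, c]"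
    unfolding mix_rel_first mix_rel_middle mix_rel_last using assms by linarith
  then show ?thesis by blast
qed

text \<open>The Knuth transformation at the second position of \<open>s, -s, t, -t, u, -u\<close> produces a descent
  at the fourth position exactly if \<open>t\<close> is a peak.\<close>

lemma srun_peak:
  assumes "svalid S" "distinct [s, t, u]" "0 \<notin> {s, t, u}" "{s, t, u} \<inter> sletters S = {}"
    "srun [s, t, u] S = ([z, c, d], S')" "content z < content c" "content d < content c" "0 \<le> content z"
  shows "s < t \<and> u < t"
proof -
  let ?w = "dword [s, t, u]" and ?cs = "dcells [z, c, d]"
  have z: "0 \<notin> set [s, t, u]" "set [s, t, u] \<inter> sletters S = {}" using assms(3,4) by auto
  have w: "uvalid (dbls S)" "distinct ?w" "0 \<notin> set ?w" "set ?w \<inter> uletters (dbls S) = {}"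
    by (fact uvalid_dbls[OF assms(1)], fact distinct_dword[OF assms(2) z(1)], fact zero_dword[OF z(1)],
        fact fresh_dword[OF z assms(1)])
  have r: "urun ?w (dbls S) = (?cs, dbls S')" using urun_dword[OF assms(1,2) z assms(5)] .
  have r': "urun (kn (\<lambda>a. a) 1 ?w) (dbls S) = (kn content 1 ?cs, dbls S')" using urun_kn[OF w r] .
  \<comment> \<open>The triple \<open>mir z, c, mir c\<close> has its middle content first, so the
    last two cells are exchanged and \<open>c\<close> comes to stand directly before
    \<open>d\<close>.\<close>
  have "kn content 1 ?cs = [z, mir z, mir c, c, d, mir d]"
    using assms(6-8) by (simp add: kn3_def content_mir)
  moreover have "kn (\<lambda>a. a) 1 ?w ! 3 < kn (\<lambda>a. a) 1 ?w ! Suc 3 \<longleftrightarrow>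
      content (kn content 1 ?cs ! 3) < content (kn content 1 ?cs ! Suc 3)"
  proof (rule urun_adjacent[OF w(1) _ _ _ r'])
    show "distinct (kn (\<lambda>a. a) 1 ?w)" "0 \<notin> set (kn (\<lambda>a. a) 1 ?w)"
      "set (kn (\<lambda>a. a) 1 ?w) \<inter> uletters (dbls S) = {}"
      using w(2-4) unfolding set_kn distinct_kn by blast+
    show "Suc 3 < length (kn (\<lambda>a. a) 1 ?w)" by (simp add: kn3_def)
  qed
  ultimately have k: "\<not> kn (\<lambda>a. a) 1 ?w ! 3 < kn (\<lambda>a. a) 1 ?w ! Suc 3"
    using assms(7) by simp
  have ne: "s \<noteq> t" "0 < s" "0 < t" "0 < u" "t \<noteq> u" using assms(2,3) by auto
  show ?thesis
  proof (cases "s < t")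
    case True
    then show ?thesis using k ne by (simp add: kn3_def)
  next
    case False
    then show ?thesis using k ne by (simp add: kn3_def)
  qed
qed

lemma two_corners:
  assumes "corner S c" "corner S d" "c \<noteq> d"
  shows "fst c < fst d \<and> snd d < snd c \<or> fst d < fst c \<and> snd c < snd d"
proof -
  obtain i j i' j' where c: "c = (i, j)" "d = (i', j')" by (cases c; cases d)
  have le: "i \<le> j" "i' \<le> j'" using assms SYoung_le c unfolding corner_def by blast+
  have "\<not> (i' \<le> i \<and> j' \<le> j)"
    using SYoungD[of "S - {d}" i j i' j'] assms c le unfolding corner_def by auto
  moreover have "\<not> (i \<le> i' \<and> j \<le> j')"
    using SYoungD[of "S - {c}" i' j' i j] assms c le unfolding corner_def by auto
  ultimately show ?thesis using c by auto
qed

lemma corner_not_below: "corner S c \<Longrightarrow> z \<in> S \<Longrightarrow> fst c \<le> fst z \<Longrightarrow> snd c \<le> snd z \<Longrightarrow> z = c"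
  using SYoungD[of "S - {c}" "fst z" "snd z" "fst c" "snd c"] SYoung_le[of S "fst c" "snd c"]
  unfolding corner_def by auto

lemma corner_other:
  assumes "corner S c" "corner S d" "c \<noteq> d" shows "corner (S - {c}) d"
proof -
  have "(S - {c}) \<inter> (S - {d}) = S - {c} - {d}" by blast
  then have "SYoung (S - {c} - {d})" using SYoung_Int[of "S - {c}" "S - {d}"] assms by (simp add: corner_def)
  then show ?thesis using assms by (auto simp: corner_def)
qed

lemma mix_moveI: "mix_rel p q \<Longrightarrow> mix_move (x @ p @ y) (x @ q @ y)"
  unfolding mix_move_def by blast

text \<open>A corner \<open>z\<close> between the two given corners and a corner \<open>y\<close> to the left of \<open>z\<close> are removed as well.
  The four last letters of a word that adds \<open>y, z, c, d\<close> in this order have a peak at the third position;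
  the relation for this factor exchanges the last two cells.\<close>

lemma exchange_corners:
  assumes "svalid S" "corner (sshape S) c" "corner (sshape S) d" "fst c < fst d" "snd d < snd c"
  obtains u v x y S1 S2 where "mix_move (u @ [x]) (v @ [y])" "distinct (u @ [x])" "distinct (v @ [y])"
    "set (u @ [x]) = sletters S" "set (v @ [y]) = sletters S"
    "snd (srun u []) = S1" "sins x S1 = (d, S)" "snd (srun v []) = S2" "sins y S2 = (c, S)"
proof -
  let ?M = "sshape S - {d} - {c}"
  have cd: "c \<noteq> d" using assms(4) by auto
  obtain s4 S4 where s4: "svalid S4" "0 < s4" "s4 \<notin> sletters S4" "sins s4 S4 = (d, S)"
    using sins_surj[OF assms(1,3)] by blast
  have p4: "sletters S = insert s4 (sletters S4)" "sshape S4 = sshape S - {d}"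
    using sins_props[OF s4] by (auto simp: saddable_def)
  have c4: "corner (sshape S4) c" using corner_other[OF assms(3,2)] cd p4 by simp
  obtain s3 S3 where s3: "svalid S3" "0 < s3" "s3 \<notin> sletters S3" "sins s3 S3 = (c, S4)"
    using sins_surj[OF s4(1) c4] by blast
  have p3: "sletters S4 = insert s3 (sletters S3)" "sshape S3 = ?M"
    using sins_props[OF s3] p4 by (auto simp: saddable_def)
  have M: "SYoung ?M" using svalid_SYoung[OF s3(1)] p3 by simp
  have Y: "SYoung (sshape S)" using svalid_SYoung[OF assms(1)] .
  have le: "fst c \<le> snd c" "fst d \<le> snd d" using SYoung_le[OF Y] assms(2,3) unfolding corner_def by auto
  \<comment> \<open>The cell in the row of \<open>c\<close> and the column of \<open>d\<close>
    survives the removal of both corners. A corner of the rest weakly southeast of it lies strictly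
    above \<open>d\<close> and strictly left of \<open>c\<close>.\<close>
  have "(fst c, snd d) \<in> sshape S"
    using SYoungD[OF Y, of "fst d" "snd d" "fst c" "snd d"] assms(3-5) le unfolding corner_def by auto
  then have "(fst c, snd d) \<in> ?M" using assms(4,5) by (cases c; cases d) auto
  then obtain z where z: "corner ?M z" "fst c \<le> fst z" "snd d \<le> snd z"
    using maximal_corner[OF M] by (metis fst_conv snd_conv)
  have zS: "z \<in> sshape S" "z \<noteq> c" "z \<noteq> d" using z(1) by (auto simp: corner_def)
  have zc: "snd z < snd c" using corner_not_below[OF assms(2) zS(1) z(2)] zS(2) by linarith
  have zd: "fst z < fst d" using corner_not_below[OF assms(3) zS(1) _ z(3)] zS(3) by linarith
  obtain s2 S2 where s2: "svalid S2" "0 < s2" "s2 \<notin> sletters S2" "sins s2 S2 = (z, S3)"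
    using sins_surj[OF s3(1)] z(1) p3 by metis
  have p2: "sletters S3 = insert s2 (sletters S2)" "sshape S2 = ?M - {z}"
    using sins_props[OF s2] p3 by (auto simp: saddable_def)
  \<comment> \<open>So \<open>z\<close> is off the diagonal and has a left neighbour. A corner
    weakly southeast of that neighbour is in its column, since it must stay left of
    \<open>z\<close>; therefore its content is smaller than that of \<open>z\<close>.\<close>
  have zlt: "fst z < snd z" using zd z(3) le by linarith
  then have "(fst z, snd z - 1) \<in> ?M" using SYoungD[OF M, of "fst z" "snd z" "fst z" "snd z - 1"] z(1)
    by (auto simp: corner_def)
  then have "(fst z, snd z - 1) \<in> ?M - {z}" using zlt by (cases z) auto
  moreover have M2: "SYoung (?M - {z})" using z(1) by (simp add: corner_def)
  ultimately obtain y where y: "corner (?M - {z}) y" "fst z \<le> fst y" "snd z - 1 \<le> snd y"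
    using maximal_corner[OF M2] by (metis fst_conv snd_conv)
  have yM: "y \<in> ?M" "y \<noteq> z" using y(1) by (auto simp: corner_def)
  have yz: "snd y < snd z" using corner_not_below[OF z(1) yM(1) y(2)] yM(2) by linarith
  obtain s1 S1 where s1: "svalid S1" "0 < s1" "s1 \<notin> sletters S1" "sins s1 S1 = (y, S2)"
    using sins_surj[OF s2(1)] y(1) p2 by metis
  have p1: "sletters S2 = insert s1 (sletters S1)" using sins_props[OF s1] by simp
  have le': "fst y \<le> snd y" "fst z \<le> snd z" using SYoung_le[OF M] yM(1) z(1) unfolding corner_def by auto
  have con: "0 \<le> content y" "content y < content z" "content z < content c" "content d < content z" "0 \<le> content d"
    "0 \<le> content z"
    using le le' y(2) yz z(2,3) zc zd by (auto simp: content_def)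
  let ?p = "[s1, s2, s3, s4]"
  have pp: "distinct ?p" "0 \<notin> set ?p" "set ?p \<inter> sletters S1 = {}"
    using s1 s2 s3 s4 p1 p2 p3 p4 by auto
  have run: "srun ?p S1 = ([y, z, c, d], S)" using s1 s2 s3 s4 by simp
  have run3: "srun [s2, s3, s4] S2 = ([z, c, d], S)" using s2 s3 s4 by simp
  have "s2 < s3 \<and> s4 < s3"
    by (rule srun_peak[OF s2(1) _ _ _ run3]) (use con pp s2 s3 s4 p2 p3 in auto)
  then obtain q where q: "mix_rel ?p q" using mix_rel_peak[of s2 s3 s4 s1] by auto
  have sq: "set q = set ?p" "distinct q" using mix_rel_perm[OF q] pp(1) by auto
  obtain ds T where qr: "srun q S1 = (ds, T)" by (cases "srun q S1")
  have T: "S = T" "dcells ds = fold (kn content) mix_knuth (dcells [y, z, c, d])"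
    using srun_mix_rel[OF s1(1) pp q run qr] by auto
  then have "dcells ds = dcells [y, z, d, c]" using mix_knuth_cells con by simp
  then have ds: "ds = [y, z, d, c]"
    by (cases ds rule: dcells.cases; cases "tl ds" rule: dcells.cases; cases "tl (tl ds)" rule: dcells.cases;
        cases "tl (tl (tl ds))" rule: dcells.cases; cases "tl (tl (tl (tl ds)))" rule: dcells.cases) auto
  obtain t1 t2 t3 t4 where qt: "q = [t1, t2, t3, t4]" using q unfolding mix_rel_def by (elim exE disjE conjE) auto
  obtain w where w: "distinct w" "set w = sletters S1" "snd (srun w []) = S1" using srun_surj[OF s1(1)] by blast
  obtain T3 where T3: "snd (srun [t1, t2, t3] S1) = T3" "sins t4 T3 = (c, S)"
    using qr T(1) unfolding ds qt by (auto split: prod.splits)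
  have mv: "mix_move ((w @ [s1, s2, s3]) @ [s4]) ((w @ [t1, t2, t3]) @ [t4])"
    using mix_moveI[OF q, of w "[]"] qt by simp
  show thesis
  proof (rule that[OF mv])
    show "distinct ((w @ [s1, s2, s3]) @ [s4])" "set ((w @ [s1, s2, s3]) @ [s4]) = sletters S"
      using w pp p1 p2 p3 p4 by auto
    show "distinct ((w @ [t1, t2, t3]) @ [t4])" "set ((w @ [t1, t2, t3]) @ [t4]) = sletters S"
      using w pp p1 p2 p3 p4 sq qt by auto
    show "snd (srun (w @ [s1, s2, s3]) []) = S4" using w(3) s1 s2 s3 by (simp add: snd_srun_append)
    show "sins s4 S4 = (d, S)" by fact
    show "snd (srun (w @ [t1, t2, t3]) []) = T3" using w(3) T3(1) by (simp add: snd_srun_append)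
    show "sins t4 T3 = (c, S)" by fact
  qed
qed

lemma mix_move_sym: "mix_move u v \<Longrightarrow> mix_move v u"
  unfolding mix_move_def by blast

lemma mix_moves_sym: "mix_move\<^sup>*\<^sup>* u v \<Longrightarrow> mix_move\<^sup>*\<^sup>* v u"
  by (induction rule: rtranclp_induct) (auto intro: converse_rtranclp_into_rtranclp mix_move_sym)

lemma mix_move_context: "mix_move u v \<Longrightarrow> mix_move (x @ u @ y) (x @ v @ y)"
  unfolding mix_move_def by (metis append.assoc)

lemma mix_moves_context: "mix_move\<^sup>*\<^sup>* u v \<Longrightarrow> mix_move\<^sup>*\<^sup>* (x @ u @ y) (x @ v @ y)"
  by (induction rule: rtranclp_induct) (auto intro: rtranclp.rtrancl_into_rtrancl mix_move_context)

text \<open>If the last new cells agree, reverse insertion makes the last letters and the tableaux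
  before them equal, and the induction hypothesis applies to the prefixes. If they differ,
  \<open>exchange_corners\<close> inserts two words joined by one move, each sharing its last new
  cell with one of the given words.\<close>

theorem mix_moves_of_srun:
  assumes "distinct u" "0 \<notin> set u" "distinct v" "0 \<notin> set v" "snd (srun u []) = S" "snd (srun v []) = S"
  shows "mix_move\<^sup>*\<^sup>* u v"
proof -
  have "length u = n \<Longrightarrow> ?thesis" for n using assms
  proof (induction n arbitrary: u v S)
    case 0
    then have "S = []" by simp
    then obtain cs where "srun v [] = (cs, [])" using 0 by (cases "srun v []") auto
    then have "set v = {}" using srun_props[of "[]" v cs "[]"] 0 by auto
    then show ?case using 0 by simp
  next
    case (Suc n)
    have props: "svalid (snd (srun w [])) \<and> sletters (snd (srun w [])) = set w" if "distinct w" "0 \<notin> set w" for w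
      using srun_props[of "[]" w "fst (srun w [])" "snd (srun w [])"] that by auto
    have last: "\<exists>c. sins x (snd (srun w [])) = (c, S) \<and> svalid (snd (srun w [])) \<and> 0 < x \<and> x \<notin> sletters (snd (srun w []))
        \<and> corner (sshape S) c"
      if "distinct (w @ [x])" "0 \<notin> set (w @ [x])" "snd (srun (w @ [x]) []) = S" for w x
    proof -
      let ?R = "snd (srun w [])"
      obtain c R' where c: "sins x ?R = (c, R')" by (cases "sins x ?R")
      then have "R' = S" using that(3) by (simp add: snd_srun_append)
      moreover have p: "svalid ?R" "0 < x" "x \<notin> sletters ?R" using props[of w] that(1,2) by auto
      ultimately show ?thesis using c sins_props[OF p] corner_insert by metis
    qed
    have sS: "svalid S" "sletters S = set u" "set u = set v" using props[of u] props[of v] Suc.prems by auto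
    then have len: "length v = Suc n" using Suc.prems by (metis distinct_card)
    obtain u0 x where u: "u = u0 @ [x]" using Suc.prems(1) by (metis length_Suc_conv_rev)
    obtain v0 y where v: "v = v0 @ [y]" using len by (metis length_Suc_conv_rev)
    obtain c where c: "sins x (snd (srun u0 [])) = (c, S)" "svalid (snd (srun u0 []))" "0 < x"
      "x \<notin> sletters (snd (srun u0 []))" "corner (sshape S) c" using last[of u0 x] Suc.prems u by auto
    obtain d where d: "sins y (snd (srun v0 [])) = (d, S)" "svalid (snd (srun v0 []))" "0 < y"
      "y \<notin> sletters (snd (srun v0 []))" "corner (sshape S) d" using last[of v0 y] Suc.prems v by auto
    have same: "mix_move\<^sup>*\<^sup>* (a @ [s]) (b @ [t])"
      if ab: "distinct (a @ [s])" "0 \<notin> set (a @ [s])" "distinct (b @ [t])" "0 \<notin> set (b @ [t])" "length (a @ [s]) = Suc n"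
        "sins s (snd (srun a [])) = (e, S)" "sins t (snd (srun b [])) = (e, S)" for a s b t e
    proof -
      have "s = t \<and> snd (srun a []) = snd (srun b [])"
        by (rule sins_inj[OF _ _ _ _ _ _ ab(6,7)]) (use props[of a] props[of b] ab in auto)
      moreover have "mix_move\<^sup>*\<^sup>* a b" by (rule Suc.IH) (use calculation ab in auto)
      ultimately show ?thesis using mix_moves_context[of a b "[]" "[t]"] by simp
    qed
    have ex: "mix_move\<^sup>*\<^sup>* (a @ [s]) (b @ [t])"
      if ab: "distinct (a @ [s])" "0 \<notin> set (a @ [s])" "distinct (b @ [t])" "0 \<notin> set (b @ [t])"
        "length (a @ [s]) = Suc n" "length (b @ [t]) = Suc n"
        "sins s (snd (srun a [])) = (f, S)" "sins t (snd (srun b [])) = (e, S)"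
        and cor: "corner (sshape S) e" "corner (sshape S) f" "fst e < fst f" "snd f < snd e" for a s b t e f
    proof -
      obtain a' s' b' t' T1 T2 where m: "mix_move (a' @ [s']) (b' @ [t'])" "distinct (a' @ [s'])" "distinct (b' @ [t'])"
        "set (a' @ [s']) = sletters S" "set (b' @ [t']) = sletters S"
        "snd (srun a' []) = T1" "sins s' T1 = (f, S)" "snd (srun b' []) = T2" "sins t' T2 = (e, S)"
        by (rule exchange_corners[OF sS(1) cor])
      have z: "0 \<notin> set (a' @ [s'])" "0 \<notin> set (b' @ [t'])" using m(4,5) sS Suc.prems(3) by auto
      have l: "length (b' @ [t']) = Suc n"
        using m(3,5) sS Suc.prems(1,2) by (metis distinct_card)
      have "mix_move\<^sup>*\<^sup>* (a @ [s]) (a' @ [s'])"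
        by (rule same[OF ab(1,2) m(2) z(1) ab(5,7)]) (use m in simp)
      moreover have "mix_move\<^sup>*\<^sup>* (b' @ [t']) (b @ [t])"
        by (rule same[OF m(3) z(2) ab(3,4) l _ ab(8)]) (use m in simp)
      ultimately show ?thesis using m(1) by (meson rtranclp.rtrancl_into_rtrancl rtranclp_trans)
    qed
    note pu = Suc.prems(2,3)[unfolded u] and pv = Suc.prems(4,5)[unfolded v]
    have lu: "length (u0 @ [x]) = Suc n" "length (v0 @ [y]) = Suc n" using Suc.prems(1) len u v by simp_all
    show ?case
    proof (cases "c = d")
      case True
      then show ?thesis using same[OF pu pv lu(1) c(1)] d(1) u v by simp
    next
      case False
      from two_corners[OF c(5) d(5) False] show ?thesis
      proof
        assume "fst c < fst d \<and> snd d < snd c"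
        then have "mix_move\<^sup>*\<^sup>* v u" using ex[OF pv pu lu(2,1) d(1) c(1) c(5) d(5)] u v by simp
        then show ?thesis by (rule mix_moves_sym)
      next
        assume "fst d < fst c \<and> snd c < snd d"
        then show ?thesis using ex[OF pu pv lu c(1) d(1) d(5) c(5)] u v by simp
      qed
    qed
  qed
  then show ?thesis by blast
qed

section \<open>Order of equal letters\<close>

text \<open>The reading order of equal letters in a tableau: first the primed ones, a vertical
  strip, downwards, then the unprimed ones, a horizontal strip, from left to right. Labels of equal
  letters will turn out to increase in this order.\<close>

definition prec :: "cell \<times> bool \<Rightarrow> cell \<times> bool \<Rightarrow> bool" where
  "prec a b \<longleftrightarrow> snd a \<and> \<not> snd b \<or> snd a \<and> snd b \<and> fst (fst a) < fst (fst b) \<or>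
     \<not> snd a \<and> \<not> snd b \<and> snd (fst a) < snd (fst b)"

lemma prec_trans: "prec a b \<Longrightarrow> prec b c \<Longrightarrow> prec a c"
  unfolding prec_def by auto

lemma prec_irrefl: "\<not> prec a a"
  unfolding prec_def by auto

lemma saddable_notin: "saddable S p \<Longrightarrow> (i, j) \<in> S \<Longrightarrow> fst p \<le> i \<Longrightarrow> snd p \<le> j \<Longrightarrow> False"
  using SYoungD[of S i j "fst p" "snd p"] saddable_le[of S p] unfolding saddable_def by auto

lemma saddable_in: "saddable S p \<Longrightarrow> i \<le> fst p \<Longrightarrow> j \<le> snd p \<Longrightarrow> i \<le> j \<Longrightarrow> (i, j) \<noteq> p \<Longrightarrow> (i, j) \<in> S"
  using SYoungD[of "insert p S" "fst p" "snd p" i j] unfolding saddable_def by auto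

lemma saddable_eq_col: "saddable S c \<Longrightarrow> saddable S d \<Longrightarrow> snd c = snd d \<Longrightarrow> c = d"
  using saddable_scol by metis

lemma snext_cases:
  assumes "saddable S p" "fst p = snd p \<longrightarrow> \<not> f" "snext (insert p S) p f = (q, g)"
  obtains (row) "\<not> f" "fst p < snd p" "\<not> g" "fst q = Suc (fst p)" "snd q \<le> snd p" "saddable (insert p S) q"
  | (col) "f \<or> fst p = snd p" "g" "snd q = Suc (snd p)" "fst q \<le> fst p" "saddable (insert p S) q"
proof (cases "f \<or> fst p = snd p")
  case True
  then have q: "q = scol (insert p S) (Suc (snd p))" "g" using assms(3) by (auto simp: snext_def)
  then have "snd q = Suc (snd p)" by simp
  then show thesis using col True q saddable_next_col[OF assms(1)] by simp
next
  case False
  then have q: "q = srow (insert p S) (Suc (fst p))" "\<not> g" using assms(3) by (auto simp: snext_def)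
  then have f: "fst q = Suc (fst p)" by simp
  have lt: "fst p < snd p" using saddable_le[OF assms(1)] False by simp
  have sq: "saddable (insert p S) q" using saddable_next_row[OF assms(1) lt] q by simp
  have "snd q \<le> snd p"
  proof (rule ccontr)
    assume "\<not> snd q \<le> snd p"
    then have "(Suc (fst p), snd p) \<in> insert p S"
      using saddable_in[OF sq, of "Suc (fst p)" "snd p"] f lt by (cases q) auto
    then have "(Suc (fst p), snd p) \<in> S" by (cases p) auto
    then show False using saddable_notin[OF assms(1)] by force
  qed
  then show thesis using row False q(2) f lt sq by simp
qed

text \<open>The local step for two entries added one directly after the other. A delicate case is
  that the first stays while the second is bumped: it must not be thrown back behind the
  first.\<close>

lemma prec_spush:
  assumes "saddable S p" "saddable (insert p S) p'" "saddable S c" "fst p = snd p \<longrightarrow> \<not> f" "fst p' = snd p' \<longrightarrow> \<not> f'"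
    "spush S p f c = ((q, g), d)" "spush (insert p S) p' f' d = ((q', g'), d')" "prec (p, f) (p', f')"
  shows "prec (q, g) (q', g')"
proof -
  obtain i j where p: "p = (i, j)" by (cases p)
  obtain i' j' where p': "p' = (i', j')" by (cases p')
  have le: "i \<le> j" "i' \<le> j'" using saddable_le[OF assms(1)] saddable_le[OF assms(2)] p p' by auto
  show ?thesis
  proof (cases "c = p")
    case True
    then have n: "snext (insert p S) p f = (q, g)" "d = q"
      using assms(6) unfolding spush_def Let_def by (auto split: prod.splits)
    show ?thesis
    proof (cases "q = p'")
      case hit: True
      have n': "snext (insert p' (insert p S)) p' f' = (q', g')"
        using assms(7) n hit unfolding spush_def Let_def by (auto split: prod.splits)
      from assms(1,4) n(1) show ?thesis
      proof (cases rule: snext_cases)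
        case row
        note r = row
        from assms(2,5) n' show ?thesis
          by (cases rule: snext_cases) (use r hit assms(8) in \<open>auto simp: prec_def\<close>)
      next
        case col
        note r = col
        from assms(2,5) n' show ?thesis
          by (cases rule: snext_cases) (use r hit le p p' assms(8) in \<open>auto simp: prec_def\<close>)
      qed
    next
      case False
      then have e: "q' = p'" "g' = f'" using assms(7) n by (auto simp: spush_def)
      from assms(1,4) n(1) show ?thesis
        by (cases rule: snext_cases) (use assms(8) e in \<open>auto simp: prec_def\<close>)
    qed
  next
    case False
    then have e: "q = p" "g = f" "d = c" using assms(6) by (auto simp: spush_def)
    show ?thesis
    proof (cases "c = p'")
      case c: False
      then show ?thesis using e assms(7,8) by (auto simp: spush_def)
    next
      case True
      have n': "snext (insert p' (insert p S)) p' f' = (q', g')"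
        using assms(7) e True unfolding spush_def Let_def by (auto split: prod.splits)
      have a': "saddable S p'" using assms(3) True by simp
      have "fst p \<noteq> fst p'" using saddable_eq_row[OF assms(1) a'] False True by blast
      moreover have "snd p \<noteq> snd p'" using saddable_eq_col[OF assms(1) a'] False True by blast
      ultimately have ne: "i \<noteq> i'" "j \<noteq> j'" by (simp_all add: p p')
      have nn: "(i, j) \<notin> S" "(i', j') \<notin> S" "(i', j') \<noteq> (i, j)"
        using assms(1) a' p p' ne by (auto simp: saddable_def)
      have "\<not> (i' \<le> i \<and> j' \<le> j)" using saddable_in[OF assms(1), of i' j'] nn p le by force
      moreover have "\<not> (i \<le> i' \<and> j \<le> j')" using saddable_in[OF a', of i j] nn p' le by force
      \<comment> \<open>Both \<open>p\<close> and \<open>p'\<close> can be added to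
        \<open>S\<close>, so one of them lies strictly above and strictly to the right of the
        other.\<close>
      ultimately have inc: "i < i' \<longleftrightarrow> j' < j" using ne by linarith
      from assms(2,5) n' show ?thesis
      proof (cases rule: snext_cases)
        case row
        have "j < snd q'" if "j < j'"
        proof (rule ccontr)
          assume h: "\<not> j < snd q'"
          have "Suc i' \<le> i" using inc ne that by auto
          then show False using saddable_notin[OF row(6), of i j] row(4) h p p' by auto
        qed
        then show ?thesis using e row p p' assms(8) by (auto simp: prec_def)
      next
        case col
        have nj: "\<not> j < j'" if "\<not> f'"
          using saddable_in[OF a', of i j] nn col(1) p p' le that by auto
        have lt: "i < fst q'" if "i < i' \<or> \<not> f'"
        proof (rule ccontr)
          assume h: "\<not> i < fst q'"
          have "Suc j' \<le> j" using inc nj ne that by auto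
          then show False using saddable_notin[OF col(5), of i j] col(3) h p p' by auto
        qed
        then show ?thesis using e col nj p p' assms(8) by (auto simp: prec_def)
      qed
    qed
  qed
qed

lemma svalid_letters_le: "svalid ((l, q, g) # R) \<Longrightarrow> (k, p, f) \<in> set ((l, q, g) # R) \<Longrightarrow> k \<le> l"
  by fastforce

lemma svalid_unique: "svalid S \<Longrightarrow> (k, p, f) \<in> set S \<Longrightarrow> (k, p', f') \<in> set S \<Longrightarrow> p = p' \<and> f = f'"
  by (induction S rule: svalid.induct) fastforce+

lemma svalid_max_hd:
  assumes "svalid R" "(k, p, f) \<in> set R" "\<forall>l \<in> sletters R. l \<le> k"
  obtains R' where "R = (k, p, f) # R'"
proof (cases R rule: dbls.cases)
  case 1
  then show thesis using assms by simp
next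
  case (2 l q g R')
  then have kl: "k = l" using assms svalid_letters_le[of l q g R' k p f] by (intro antisym) auto
  then have "p = q \<and> f = g" using svalid_unique[OF assms(1,2), of q g] 2 by simp
  then have "R = (k, p, f) # R'" using 2 kl by simp
  then show thesis by (rule that)
qed

lemma sins_cases_push:
  assumes "svalid S" "0 < x" "x \<notin> sletters S" "sins x S = (c, (l, q, g) # R)" "x \<noteq> l"
  obtains p f S0 d where "S = (l, p, f) # S0" "sins x S0 = (d, R)" "x < l" "spush (sshape S0) p f d = ((q, g), c)"
  using assms(1-4)
proof (cases rule: sins_cases)
  case new
  then show ?thesis using assms(5) by simp
next
  case (hit p f S0)
  have "sshape R = insert p (sshape S0)" using sins_props[OF _ assms(2) _ hit(3)] hit(2) assms(1,3) by auto
  then have "snext (insert p (sshape S0)) p f = (q, g)" using hit(5) by simp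
  then have "spush (sshape S0) p f p = ((q, g), c)" using hit(4) by (simp add: spush_def)
  then show ?thesis using hit(1-3) by (intro that)
next
  case (miss S0)
  then show ?thesis using that[of q g S0 c] by (auto simp: spush_def)
qed

text \<open>Consecutive labels are neighbours in the list, so \<open>prec_spush\<close> applies to
  their two pushes. A new \<open>Suc k\<close> enters unprimed at the end of row 0, in a column
  beyond all others. Only a \<open>k\<close> inserted while \<open>Suc k\<close> is already present
  could break the order.\<close>

lemma sins_prec:
  assumes "svalid S" "0 < x" "x \<notin> sletters S" "sins x S = (c, S')" "(k, p, f) \<in> set S'" "(Suc k, p', f') \<in> set S'" "x \<noteq> k"
    "\<And>r h r' h'. (k, r, h) \<in> set S \<Longrightarrow> (Suc k, r', h') \<in> set S \<Longrightarrow> prec (r, h) (r', h')"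
  shows "prec (p, f) (p', f')"
  using assms
proof (induction S' arbitrary: S c)
  case Nil
  then show ?case by simp
next
  case (Cons e R)
  obtain l q g where e: "e = (l, q, g)" by (cases e)
  note s = Cons.prems(4)[unfolded e]
  have vS': "svalid ((l, q, g) # R)" using sins_props[OF Cons.prems(1-4)] e by simp
  have kl: "Suc k \<le> l" using svalid_letters_le[OF vS'] Cons.prems(6) e by blast
  then have kR: "(k, p, f) \<in> set R" using Cons.prems(5) e by auto
  show ?case
  proof (cases "Suc k = l")
    case False
    then have kR': "(Suc k, p', f') \<in> set R" using Cons.prems(6) e by auto
    have IH: ?thesis if "S = (l, r, h) # S0" "sins x S0 = (c0, R)" for r h S0 c0
      by (rule Cons.IH[OF _ Cons.prems(2) _ that(2) kR kR' Cons.prems(7)]) (use Cons.prems(1,3,8) that(1) in auto)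
    from Cons.prems(1-3) s show ?thesis
    proof (cases rule: sins_cases)
      case new
      then show ?thesis using Cons.prems(8) kR kR' by blast
    qed (use IH in blast)+
  next
    case True
    have "(l, p', f') \<in> set ((l, q, g) # R)" using Cons.prems(6) unfolding e True .
    note eq = svalid_unique[OF vS' this, of q g]
    have pq: "p' = q" "f' = g" using eq by simp_all
    have vR: "svalid R" "\<forall>m \<in> sletters R. m < l" "saddable (sshape R) q" using vS' by auto
    obtain R1 where R1: "R = (k, p, f) # R1" using svalid_max_hd[OF vR(1) kR] vR(2) True by fastforce
    show ?thesis
    proof (cases "x = l")
      case xl: True
      from Cons.prems(1-3) s have n: "S = R" "q = srow (sshape R) 0" "\<not> g"
        by (cases rule: sins_cases; use xl in simp)+
      have "snd p < snd q" if "\<not> f"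
      proof (rule ccontr)
        assume h: "\<not> snd p < snd q"
        have "(fst p, snd p) \<in> sshape R" using R1 by simp
        then show False using saddable_notin[OF vR(3)] n(2) h by fastforce
      qed
      then show ?thesis using pq n(3) by (auto simp: prec_def)
    next
      case xl: False
      obtain p0 f0 S0 c0 where S: "S = (l, p0, f0) # S0" "sins x S0 = (c0, R)" "x < l"
        "spush (sshape S0) p0 f0 c0 = ((q, g), c)"
        by (rule sins_cases_push[OF Cons.prems(1-3) s xl])
      have v0: "svalid S0" "x \<notin> sletters S0" "saddable (sshape S0) p0" "fst p0 = snd p0 \<longrightarrow> \<not> f0"
        using Cons.prems(1,3) S(1) by auto
      obtain p1 f1 S1 c1 where T: "S0 = (k, p1, f1) # S1" "sins x S1 = (c1, R1)"
        "spush (sshape S1) p1 f1 c1 = ((p, f), c0)"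
        by (rule sins_cases_push[OF v0(1) Cons.prems(2) v0(2) S(2)[unfolded R1] Cons.prems(7)])
      have v1: "svalid S1" "x \<notin> sletters S1" "saddable (sshape S1) p1" "fst p1 = snd p1 \<longrightarrow> \<not> f1"
        using v0 T(1) by auto
      have c1: "saddable (sshape S1) c1" using sins_props[OF v1(1) Cons.prems(2) v1(2) T(2)] by auto
      have "saddable (insert p1 (sshape S1)) p0" "spush (insert p1 (sshape S1)) p0 f0 c0 = ((q, g), c)"
        using v0(3) S(4) T(1) by auto
      moreover have "prec (p1, f1) (p0, f0)" by (rule Cons.prems(8)) (use S(1) T(1) True in simp_all)
      ultimately show ?thesis using prec_spush[OF v1(3) _ c1 v1(4) v0(4) T(3)] pq by blast
    qed
  qed
qed

section \<open>The insertion process on tableaux\<close>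

fun tableau :: "(nat \<Rightarrow> nat) \<Rightarrow> entry list \<Rightarrow> tab" where
  "tableau val [] = (\<lambda>_. None)"
| "tableau val ((k, p, f) # S) = (tableau val S)(p := Some (val k, f))"

lemma dom_tableau: "dom (tableau val S) = sshape S"
proof (induction val S rule: tableau.induct)
  case (2 val k p f S)
  have "dom (tableau val ((k, p, f) # S)) = insert p (dom (tableau val S))"
    unfolding tableau.simps by (simp only: dom_fun_upd option.distinct if_False)
  also have "\<dots> = sshape ((k, p, f) # S)" unfolding 2 by simp
  finally show ?case .
qed simp

lemma tableau_SomeD: "tableau val S p = Some (v, f) \<Longrightarrow> \<exists>k. (k, p, f) \<in> set S \<and> v = val k"
  by (induction val S rule: tableau.induct) (auto split: if_splits)

lemma tableau_Some: "svalid S \<Longrightarrow> (k, p, f) \<in> set S \<Longrightarrow> tableau val S p = Some (val k, f)"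
proof (induction val S rule: tableau.induct)
  case (2 val l q g S)
  show ?case
  proof (cases "(k, p, f) = (l, q, g)")
    case False
    then have "(k, p, f) \<in> set S" using 2 by auto
    moreover from this have "p \<in> sshape S" by force
    then have "p \<noteq> q" using 2 by (auto simp: saddable_def)
    ultimately show ?thesis using 2 by simp
  qed simp
qed simp

text \<open>An empty row \<open>i\<close> begins on the diagonal, which accounts for the default
  column \<open>i\<close> in \<open>end_pos\<close>.\<close>

lemma end_pos_Row: assumes "SYoung (dom T)" shows "end_pos (Row i) T = srow (dom T) i"
proof -
  let ?m = "snd (srow (dom T) i)"
  have f: "finite (dom T)" using SYoung_finite[OF assms] .
  have m: "srow (dom T) i = (i, ?m)" by (simp add: srow_def)
  have n: "(i, ?m) \<notin> dom T" "i \<le> ?m" using srow_notin[OF f, of i] m by simp_all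
  have "j < ?m" if "(i, j) \<in> dom T" for j
    using SYoungD[OF assms that order_refl _ n(2)] n(1) by (meson not_le)
  then have J: "{j. T (i, j) \<noteq> None} = {i..<?m}"
    using srow_below[of i _ "dom T"] SYoung_le[OF assms] by (auto simp: dom_def)
  have ex: "(\<exists>j. T (i, j) \<noteq> None) \<longleftrightarrow> i < ?m"
    using J n(2) by (metis (mono_tags) atLeastLessThan_iff le_less_trans mem_Collect_eq order_refl)
  have k: "Suc (Max {i..<k}) = k" if "i < k" for k
    using that by (cases k) (auto simp: atLeastLessThanSuc_atLeastAtMost intro!: Max_eqI)
  have "end_pos (Row i) T = (i, ?m)"
    unfolding end_pos.simps ex J using k[of ?m] n(2) by (cases "i < ?m") simp_all
  then show ?thesis using m by simp
qed

lemma end_pos_Col: assumes "SYoung (dom T)" shows "end_pos (Col c) T = scol (dom T) c"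
proof -
  let ?m = "fst (scol (dom T) c)"
  have m: "scol (dom T) c = (?m, c)" by (simp add: colend_def)
  have n: "(?m, c) \<notin> dom T" using colend_notin[OF SYoung_finite[OF assms], of c] m by simp
  have "i < ?m" if "(i, c) \<in> dom T" for i
    using SYoungD[OF assms that _ order_refl, of ?m] SYoung_le[OF assms that] n by (meson not_le order_trans)
  then have J: "{i. T (i, c) \<noteq> None} = {0..<?m}"
    using colend_below[of _ "dom T" c] by (auto simp: dom_def)
  have ex: "(\<exists>i. T (i, c) \<noteq> None) \<longleftrightarrow> 0 < ?m"
    using J by (metis (mono_tags) atLeastLessThan_iff gr0I le0 mem_Collect_eq not_less0)
  have k: "Suc (Max {0..<k}) = k" if "0 < k" for k :: nat
    using that by (cases k) (auto simp: atLeastLessThanSuc_atLeastAtMost intro!: Max_eqI)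
  have "end_pos (Col c) T = (?m, c)"
    unfolding end_pos.simps ex J using k[of ?m] by (cases "0 < ?m") simp_all
  then show ?thesis using m by simp
qed

fun on_line :: "target \<Rightarrow> cell \<Rightarrow> bool" where
  "on_line (Row i) p \<longleftrightarrow> fst p = i"
| "on_line (Col c) p \<longleftrightarrow> snd p = c"

lemma end_pos_saddable: "saddable (dom T) p \<Longrightarrow> on_line t p \<Longrightarrow> end_pos t T = p"
  using saddable_srow[of "dom T" p] saddable_scol[of "dom T" p] end_pos_Row[of T] end_pos_Col[of T]
  by (cases t) (simp_all add: saddable_def del: end_pos.simps)

lemma on_line_end_pos: "on_line t (end_pos t T)"
  by (cases t) auto

lemma cands_iff: "p \<in> cands t x T \<longleftrightarrow> on_line t p \<and> (\<exists>y. T p = Some y \<and> lt_x x y)"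
  by (cases t) auto

lemma end_pos_upd: "\<not> on_line t p \<Longrightarrow> end_pos t (T(p := Some b)) = end_pos t T"
proof (cases t)
  case (Row i)
  moreover assume "\<not> on_line t p"
  ultimately have "(T(p := Some b)) (i, j) = T (i, j)" for j by auto
  then show ?thesis using Row by simp
next
  case (Col c)
  moreover assume "\<not> on_line t p"
  ultimately have "(T(p := Some b)) (i, c) = T (i, c)" for i by auto
  then show ?thesis using Col by simp
qed

lemma cands_upd:
  assumes "p \<notin> dom T"
  shows "cands t x (T(p := Some b)) = cands t x T \<union> (if on_line t p \<and> lt_x x b then {p} else {})"
proof (rule set_eqI)
  show "r \<in> cands t x (T(p := Some b)) \<longleftrightarrow> r \<in> cands t x T \<union> (if on_line t p \<and> lt_x x b then {p} else {})" for r
    using assms by (cases "r = p") (simp_all add: cands_iff domIff)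
qed

text \<open>An addable cell closes its line, so it lies beyond every candidate already there and
  cannot supply the minimum.\<close>

lemma bump_pos_upd:
  assumes "saddable (dom T) p" "cands t x T \<noteq> {}"
  shows "bump_pos t x (T(p := Some b)) = bump_pos t x T"
proof (cases "on_line t p \<and> lt_x x b")
  case True
  have pn: "p \<notin> dom T" and fin: "finite (dom T)" using assms(1) SYoung_finite by (auto simp: saddable_def)
  have sub: "cands t x T \<subseteq> dom T" by (auto simp: cands_iff)
  then have fc: "finite (cands t x T)" using fin finite_subset by blast
  have c: "cands t x (T(p := Some b)) = insert p (cands t x T)" using cands_upd[OF pn] True by simp
  obtain r where r: "r \<in> cands t x T" using assms(2) by blast
  have rd: "r \<in> dom T" "on_line t r" using r sub by (auto simp: cands_iff)
  show ?thesis
  proof (cases t)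
    case (Row i)
    have "snd r < snd p"
      using saddable_notin[OF assms(1), of "fst r" "snd r"] rd Row True by force
    moreover have "Min (snd ` cands t x T) \<le> snd r" using fc r by simp
    ultimately have "min (snd p) (Min (snd ` cands t x T)) = Min (snd ` cands t x T)" by simp
    moreover have "Min (snd ` insert p (cands t x T)) = min (snd p) (Min (snd ` cands t x T))"
      using fc assms(2) by simp
    ultimately show ?thesis using Row c by simp
  next
    case (Col j)
    have "fst r < fst p"
      using saddable_notin[OF assms(1), of "fst r" "snd r"] rd Col True by force
    moreover have "Min (fst ` cands t x T) \<le> fst r" using fc r by simp
    ultimately have "min (fst p) (Min (fst ` cands t x T)) = Min (fst ` cands t x T)" by simp
    moreover have "Min (fst ` insert p (cands t x T)) = min (fst p) (Min (fst ` cands t x T))"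
      using fc assms(2) by simp
    ultimately show ?thesis using Col c by simp
  qed
next
  case False
  have pn: "p \<notin> dom T" using assms(1) by (auto simp: saddable_def)
  have "cands t x (T(p := Some b)) = cands t x T" using cands_upd[OF pn] False by auto
  then show ?thesis by (cases t) auto
qed

text \<open>An additional entry on an addable cell goes unnoticed until the process without it comes
  to its end. If the end is that very cell, a sufficiently large \<open>b\<close> is bumped instead.
  Its further path lies outside the given derivation and is therefore supplied as a continuation to
  \<open>T''\<close>. This links the recursion of \<open>sins\<close> with the bumping path.\<close>

lemma ins_rel_extend:
  assumes "ins_rel t x T T'" "saddable (dom T) p" "c \<notin> dom T" "dom T' = insert c (dom T)"
  shows "(p \<noteq> c \<longrightarrow> ins_rel t x (T(p := Some b)) (T'(p := Some b))) \<and>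
    (p = c \<longrightarrow> (\<forall>a t' a' T''. T' c = Some a \<longrightarrow> lt_x a b \<longrightarrow> next_step p b = (t', a') \<longrightarrow> ins_rel t' a' T' T'' \<longrightarrow>
       ins_rel t x (T(p := Some b)) T''))"
  using assms
proof (induction t x T T' rule: ins_rel.induct)
  case (place t x T)
  have pn: "p \<notin> dom T" using place(2) by (auto simp: saddable_def)
  have "insert (end_pos t T) (dom T) = insert c (dom T)"
    using place(4) by (simp only: dom_fun_upd option.distinct if_False)
  then have c: "c = end_pos t T" using place(3) by blast
  show ?case
  proof (intro conjI impI allI)
    assume ne: "p \<noteq> c"
    then have l: "\<not> on_line t p" using end_pos_saddable[OF place(2)] c by metis
    then have "cands t x (T(p := Some b)) = {}" using place(1) cands_upd[OF pn] by simp
    then have "ins_rel t x (T(p := Some b)) ((T(p := Some b))(end_pos t (T(p := Some b)) := Some x))"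
      by (rule ins_rel.place)
    then show "ins_rel t x (T(p := Some b)) ((T(end_pos t T := Some x))(p := Some b))"
      using end_pos_upd[OF l] ne c by (simp add: fun_upd_twist)
  next
    fix a t' a' T''
    assume h: "p = c" "(T(end_pos t T := Some x)) c = Some a" "lt_x a b" "next_step p b = (t', a')"
      "ins_rel t' a' (T(end_pos t T := Some x)) T''"
    have l: "on_line t p" using on_line_end_pos h(1) c by simp
    have "a = x" using h(2) c by simp
    then have "lt_x x b" using h(3) by simp
    then have cs: "cands t x (T(p := Some b)) = {p}" unfolding cands_upd[OF pn] place(1) using l by simp
    have "bump_pos t x U = p" if "cands t x U = {p}" for U using l that by (cases t) auto
    note this[OF cs]
    moreover have "ins_rel t' a' ((T(p := Some b))(p := Some x)) T''" using h(1,5) c by simp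
    ultimately show "ins_rel t x (T(p := Some b)) T''"
      using ins_rel.bump[of t x "T(p := Some b)" p b t' a' T''] cs h(4) by simp
  qed
next
  case (bump t x T p1 a t1 a1 T')
  have sp: "saddable (dom T) p" by fact
  have pn: "p \<notin> dom T" using sp by (auto simp: saddable_def)
  then have ne: "p1 \<noteq> p" using bump(3) by auto
  have d: "dom (T(p1 := Some x)) = dom T" using bump(3) by auto
  have b1: "bump_pos t x (T(p := Some b)) = p1" using bump_pos_upd[OF sp bump(1)] bump(2) by simp
  have cn: "cands t x (T(p := Some b)) \<noteq> {}" using bump(1) cands_upd[OF pn] by auto
  have IH: "(p \<noteq> c \<longrightarrow> ins_rel t1 a1 (T(p1 := Some x, p := Some b)) (T'(p := Some b))) \<and>
    (p = c \<longrightarrow> (\<forall>a t' a' T''. T' c = Some a \<longrightarrow> lt_x a b \<longrightarrow> next_step p b = (t', a') \<longrightarrow> ins_rel t' a' T' T'' \<longrightarrow>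
       ins_rel t1 a1 (T(p1 := Some x, p := Some b)) T''))"
    by (rule bump.IH) (unfold d, fact+)
  have tw: "(T(p := Some b))(p1 := Some x) = T(p1 := Some x, p := Some b)" using ne by (simp add: fun_upd_twist)
  have step: "ins_rel t x (T(p := Some b)) T''" if "ins_rel t1 a1 (T(p1 := Some x, p := Some b)) T''" for T''
    using ins_rel.bump[OF cn b1[symmetric] _ bump(4), of T''] bump(3) ne that tw by simp
  then show ?case using IH by blast
qed

lemma ins_rel_unique: "ins_rel t x T T1 \<Longrightarrow> ins_rel t x T T2 \<Longrightarrow> T1 = T2"
proof (induction t x T T1 arbitrary: T2 rule: ins_rel.induct)
  case (place t x T)
  from place(2) show ?case by cases (use place in auto)
next
  case (bump t x T p a t' a' T')
  note IH = bump.IH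
  from bump.prems show ?case
  proof cases
    case place
    then show ?thesis using bump by simp
  next
    case (bump p2 a2 t2 a2')
    have "p2 = p" "a2 = a" using bump(2,3) \<open>T p = Some a\<close> \<open>p = bump_pos t x T\<close> by auto
    moreover from this have "t2 = t'" "a2' = a'" using bump(4) \<open>next_step p a = (t', a')\<close> by auto
    ultimately show ?thesis using bump(5) IH by metis
  qed
qed

definition prec_sorted :: "(nat \<Rightarrow> nat) \<Rightarrow> entry list \<Rightarrow> bool" where
  "prec_sorted val S \<longleftrightarrow> (\<forall>k p f l q g. (k, p, f) \<in> set S \<longrightarrow> (l, q, g) \<in> set S \<longrightarrow> k < l \<longrightarrow> val k = val l \<longrightarrow>
     prec (p, f) (q, g))"

text \<open>Labels compare like their letters except for ties. With ties arranged by
  \<open>prec\<close>, the strict comparison of primed letters still bumps the entry that labels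
  would bump, and a bumped largest entry still finds nothing greater in its next line.\<close>

lemma ins_rel_tableau:
  assumes "svalid S" "0 < x" "x \<notin> sletters S" "sins x S = (c, S')" "mono val" "prec_sorted val S'"
  shows "ins_rel (Row 0) (val x, False) (tableau val S) (tableau val S')"
  using assms
proof (induction S' arbitrary: S c)
  case Nil
  then show ?case using sins_props[OF Nil(1-4)] by auto
next
  case (Cons e R)
  obtain l q g where e: "e = (l, q, g)" by (cases e)
  note s = Cons.prems(4)[unfolded e]
  have vS': "svalid ((l, q, g) # R)" using sins_props[OF Cons.prems(1-4)] e by simp
  have sR: "prec_sorted val R" using Cons.prems(6) unfolding prec_sorted_def by auto
  from Cons.prems(1-3) s show ?case
  proof (cases rule: sins_cases)
    case new
    have le: "val k \<le> val x" if "(k, p, f) \<in> set R" for k p f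
    proof -
      have "k \<le> l" using svalid_letters_le[OF vS', of k p f] that by auto
      then show ?thesis using new(1) \<open>mono val\<close> by (auto dest: monoD)
    qed
    have "cands (Row 0) (val x, False) (tableau val R) = {}"
    proof (rule ccontr)
      assume "cands (Row 0) (val x, False) (tableau val R) \<noteq> {}"
      then obtain p v f where "tableau val R p = Some (v, f)" "lt_x (val x, False) (v, f)"
        by (auto simp: cands_iff)
      moreover from this(1) obtain k where "(k, p, f) \<in> set R" "v = val k" using tableau_SomeD by blast
      ultimately show False using le[of k p f] by (auto simp: lt_x_def)
    qed
    then have "ins_rel (Row 0) (val x, False) (tableau val R)
        ((tableau val R)(end_pos (Row 0) (tableau val R) := Some (val x, False)))" by (rule ins_rel.place)
    moreover have "end_pos (Row 0) (tableau val R) = q"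
      using end_pos_Row[of "tableau val R" 0] svalid_SYoung[of R] vS' new(4) by (simp add: dom_tableau)
    ultimately have "ins_rel (Row 0) (val x, False) (tableau val R) ((tableau val R)(q := Some (val l, g)))"
      using new(1,5) by (simp only: refl)
    then show ?thesis unfolding e tableau.simps new(2) .
  next
    case (miss S0)
    have v: "svalid S0" "x \<notin> sletters S0" "saddable (sshape S0) q" using Cons.prems(1,3) miss(2) by auto
    have p: "sshape R = insert c (sshape S0)" "c \<notin> sshape S0" using sins_props[OF v(1) Cons.prems(2) v(2) miss(3)]
      by (auto simp: saddable_def)
    have ih: "ins_rel (Row 0) (val x, False) (tableau val S0) (tableau val R)"
      by (rule Cons.IH[OF v(1) Cons.prems(2) v(2) miss(3) \<open>mono val\<close> sR])
    have "ins_rel (Row 0) (val x, False) ((tableau val S0)(q := Some (val l, g))) ((tableau val R)(q := Some (val l, g)))"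
      using ins_rel_extend[OF ih, of q c "(val l, g)", unfolded dom_tableau] v(3) p miss(4) by blast
    then show ?thesis unfolding e miss(2) tableau.simps .
  next
    case (hit p f S0)
    have v: "svalid S0" "x \<notin> sletters S0" "saddable (sshape S0) p" using Cons.prems(1,3) hit(2) by auto
    have pr: "sshape R = insert p (sshape S0)" "p \<notin> sshape S0" using sins_props[OF v(1) Cons.prems(2) v(2) hit(3)]
      by (auto simp: saddable_def)
    have ih: "ins_rel (Row 0) (val x, False) (tableau val S0) (tableau val R)"
      by (rule Cons.IH[OF v(1) Cons.prems(2) v(2) hit(3) \<open>mono val\<close> sR])
    have sn: "snext (insert p (sshape S0)) p f = (q, g)" using hit(5) pr(1) by simp
    have le: "val m \<le> val l" if "(m, r, h) \<in> set R" for m r h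
      using that vS' \<open>mono val\<close> svalid_letters_le[OF vS', of m r h] by (auto dest: monoD)
    have pc: "prec (r, h) (q, g)" if "(m, r, h) \<in> set R" "val m = val l" for m r h
    proof -
      have "m < l" using that vS' by fastforce
      then show ?thesis using Cons.prems(6)[unfolded prec_sorted_def e, rule_format, of m r h l q g] that by simp
    qed
    have "p \<in> sshape R" using pr(1) by simp
    then obtain m h where m: "(m, p, h) \<in> set R" by force
    have vR: "svalid R" using vS' by simp
    have Tp: "tableau val R p = Some (val m, h)" using tableau_Some[OF vR m] .
    \<comment> \<open>For equal letters \<open>prec\<close> compares \<open>p\<close> with the
      target \<open>q\<close>. A column move would lead weakly upwards, against \<open>prec\<close>;
      a row move leads weakly to the left, so the entry now on \<open>p\<close> is primed and the
      bumped one is not.\<close>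
    have lt: "lt_x (val m, h) (val l, f)"
    proof (cases "val m = val l")
      case True
      have P: "prec (p, h) (q, g)" using pc[OF m True] .
      from v(3) hit(7) sn have "h \<and> \<not> f"
        by (cases rule: snext_cases) (use P in \<open>auto simp: prec_def\<close>)
      then show ?thesis using True by (simp add: lt_x_def)
    next
      case False
      then show ?thesis using le[OF m] by (simp add: lt_x_def)
    qed
    define t where "t = (if f \<or> fst p = snd p then Col (Suc (snd p)) else Row (Suc (fst p)))"
    have ns: "next_step p (val l, f) = (t, (val l, g))"
      using hit(5,7) by (auto simp: next_step_def snext_def t_def)
    \<comment> \<open>Since \<open>l\<close> is the largest label, a strictly greater entry would be
      an unprimed copy of the same letter against a primed \<open>l\<close>, contrary to
      \<open>prec\<close>.\<close>
    have "cands t (val l, g) (tableau val R) = {}"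
    proof (rule ccontr)
      assume "cands t (val l, g) (tableau val R) \<noteq> {}"
      then obtain r v h' where r: "tableau val R r = Some (v, h')" "lt_x (val l, g) (v, h')"
        by (auto simp: cands_iff)
      then obtain m' where m': "(m', r, h') \<in> set R" "v = val m'" using tableau_SomeD by blast
      then have "val m' = val l \<and> g \<and> \<not> h'" using r(2) le[OF m'(1)] by (auto simp: lt_x_def)
      then show False using pc[OF m'(1)] by (auto simp: prec_def)
    qed
    then have pl: "ins_rel t (val l, g) (tableau val R) ((tableau val R)(end_pos t (tableau val R) := Some (val l, g)))"
      by (rule ins_rel.place)
    have Y: "SYoung (dom (tableau val R))" using svalid_SYoung[OF vR] by (simp add: dom_tableau)
    have "end_pos t (tableau val R) = q"
    proof (cases "f \<or> fst p = snd p")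
      case True
      then have "t = Col (Suc (snd p))" "q = scol (sshape R) (Suc (snd p))"
        using hit(5) unfolding t_def snext_def by simp_all
      then show ?thesis using end_pos_Col[OF Y, of "Suc (snd p)"] unfolding dom_tableau by metis
    next
      case False
      then have "t = Row (Suc (fst p))" "q = srow (sshape R) (Suc (fst p))"
        using hit(5) unfolding t_def snext_def by simp_all
      then show ?thesis using end_pos_Row[OF Y, of "Suc (fst p)"] unfolding dom_tableau by metis
    qed
    then have "ins_rel t (val l, g) (tableau val R) (tableau val ((l, q, g) # R))"
      using pl unfolding tableau.simps by (simp only:)
    moreover have "saddable (dom (tableau val S0)) p" "p \<notin> dom (tableau val S0)"
        "dom (tableau val R) = insert p (dom (tableau val S0))"
      using v(3) pr by (simp_all add: dom_tableau)
    ultimately have "ins_rel (Row 0) (val x, False) ((tableau val S0)(p := Some (val l, f))) (tableau val ((l, q, g) # R))"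
      using ins_rel_extend[OF ih, of p p "(val l, f)"] Tp lt ns by blast
    then show ?thesis unfolding e hit(2) tableau.simps .
  qed
qed

section \<open>Standardization\<close>

text \<open>The label \<open>k\<close> stands for the letter \<open>k div N\<close>; the occurrences of a letter are labelled
  in increasing order, without gaps, from left to right.\<close>

definition labelling :: "nat \<Rightarrow> nat list \<Rightarrow> bool" where
  "labelling N L \<longleftrightarrow> (\<forall>i < length L. L ! i \<noteq> 0 \<and>
     (\<forall>k. k div N = L ! i div N \<longrightarrow> (k < L ! i \<longleftrightarrow> k \<in> set (take i L))))"

lemma labelling_Nil [simp]: "labelling N []"
  by (simp add: labelling_def)

lemma labelling_snoc:
  "labelling N (L @ [x]) \<longleftrightarrow> labelling N L \<and> x \<noteq> 0 \<and> (\<forall>k. k div N = x div N \<longrightarrow> (k < x \<longleftrightarrow> k \<in> set L))"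
  unfolding labelling_def by (simp add: All_less_Suc nth_append) blast

text \<open>Comparisons of a label with a label further to the right become weak comparisons of
  letters, the form in which \<open>mix_rel_first\<close> and its companions express the
  relations.\<close>

lemma labelling_sorted:
  "labelling N L \<Longrightarrow> distinct L \<and> 0 \<notin> set L \<and> sorted_wrt (\<lambda>k l. k < l \<longleftrightarrow> k div N \<le> l div N) L"
proof (induction L rule: rev_induct)
  case (snoc x L)
  then have x: "labelling N L" "x \<noteq> 0" "\<And>k. k div N = x div N \<Longrightarrow> k < x \<longleftrightarrow> k \<in> set L"
    by (auto simp: labelling_snoc)
  have "k < x \<longleftrightarrow> k div N \<le> x div N" if "k \<in> set L" for k
  proof (cases "k div N = x div N")
    case True
    then show ?thesis using x(3) that by simp
  next
    case False
    then show ?thesis using div_le_mono[of k x N] div_le_mono[of x k N] by linarith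
  qed
  moreover have "x \<notin> set L" using x(3)[of x] by simp
  ultimately show ?case using snoc.IH[OF x(1)] x(2) by (simp add: sorted_wrt_append)
qed simp

lemma labelling_block: "labelling N L \<Longrightarrow> l \<in> set L \<Longrightarrow> k < l \<Longrightarrow> k div N = l div N \<Longrightarrow> k \<in> set L"
  by (induction L rule: rev_induct) (auto simp: labelling_snoc)

lemma labelling_swap:
  "labelling N (X @ [k, l] @ Y) \<Longrightarrow> k div N \<noteq> l div N \<Longrightarrow> labelling N (X @ [l, k] @ Y)"
proof (induction Y rule: rev_induct)
  case Nil
  have 1: "labelling N ((X @ [k]) @ [l])" using Nil(1) by simp
  have 2: "labelling N X" "k \<noteq> 0" "l \<noteq> 0" "\<And>j. j div N = k div N \<Longrightarrow> j < k \<longleftrightarrow> j \<in> set X"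
    "\<And>j. j div N = l div N \<Longrightarrow> j < l \<longleftrightarrow> j \<in> set X"
    using 1 Nil(2) unfolding labelling_snoc by auto
  have "labelling N ((X @ [l]) @ [k])" unfolding labelling_snoc using 2 Nil(2) by auto
  then show ?case by simp
next
  case (snoc y Y)
  have "labelling N ((X @ [k, l] @ Y) @ [y])" using snoc.prems(1) by simp
  then have "labelling N ((X @ [l, k] @ Y) @ [y])" using snoc.IH[OF _ snoc.prems(2)] unfolding labelling_snoc by auto
  then show ?case by simp
qed

text \<open>An occurrence of \<open>x\<close> preceded by \<open>c\<close> others receives the label
  \<open>x * N + c\<close>; as \<open>N\<close> exceeds the length, the blocks of different letters
  do not overlap. The set of labels then depends only on the multiplicities.\<close>

lemma labelling_exists:
  assumes "\<forall>x \<in> set w. 1 \<le> x" "length w < N"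
  shows "\<exists>L. labelling N L \<and> map (\<lambda>k. k div N) L = w \<and> set L = {k. k mod N < count_list w (k div N)}"
  using assms
proof (induction w rule: rev_induct)
  case Nil
  then show ?case by simp
next
  case (snoc x w)
  then obtain L where L: "labelling N L" "map (\<lambda>k. k div N) L = w" "set L = {k. k mod N < count_list w (k div N)}"
    by auto
  let ?c = "count_list w x"
  let ?l = "x * N + ?c"
  have c: "?c < N" using count_le_length[of w x] snoc.prems(2) by simp
  then have l: "?l div N = x" "?l mod N = ?c" "?l \<noteq> 0" using snoc.prems(1) by auto
  have k: "k < ?l \<longleftrightarrow> k mod N < ?c" if "k div N = x" for k
    using div_mult_mod_eq[of k N] that nat_add_left_cancel_less[of "x * N" "k mod N" ?c] by simp
  have "labelling N (L @ [?l])"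
    unfolding labelling_snoc using L(1,3) l(1,3) k by auto
  moreover have "set (L @ [?l]) = {k. k mod N < count_list (w @ [x]) (k div N)}"
  proof (rule set_eqI)
    fix k
    have "k = ?l \<longleftrightarrow> k div N = x \<and> k mod N = ?c" using l(1,2) div_mult_mod_eq[of k N] by metis
    then show "k \<in> set (L @ [?l]) \<longleftrightarrow> k \<in> {k. k mod N < count_list (w @ [x]) (k div N)}"
      using L(3) by (auto simp: less_Suc_eq)
  qed
  ultimately show ?case using L(2) l(1) by (intro exI[of _ "L @ [?l]"]) simp
qed

lemma srun_Nil_props:
  assumes "distinct L" "0 \<notin> set L"
  shows "svalid (snd (srun L []))" "sletters (snd (srun L [])) = set L"
  using srun_props[of "[]" L "fst (srun L [])" "snd (srun L [])"] assms by auto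

text \<open>Consecutive labels suffice: the labels of one letter have no gaps, and
  \<open>prec\<close> is transitive.\<close>

lemma labelling_prec_sorted:
  assumes "labelling N L"
  shows "prec_sorted (\<lambda>k. k div N) (snd (srun L []))"
proof -
  let ?S = "snd (srun L [])"
  have suc: "prec (p, f) (p', f')"
    if "(k, p, f) \<in> set (snd (srun L []))" "(Suc k, p', f') \<in> set (snd (srun L []))" "k div N = Suc k div N"
      "labelling N L" for k p f p' f' L
    using that
  proof (induction L arbitrary: p f p' f' rule: rev_induct)
    case Nil
    then show ?case by simp
  next
    case (snoc x L)
    have x: "labelling N L" "x \<noteq> 0" "\<And>k. k div N = x div N \<Longrightarrow> k < x \<longleftrightarrow> k \<in> set L"
      using snoc.prems(4) by (auto simp: labelling_snoc)
    obtain c S' where s: "sins x (snd (srun L [])) = (c, S')" by (cases "sins x (snd (srun L []))")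
    have S': "snd (srun (L @ [x]) []) = S'" using s by (simp add: snd_srun_append)
    have v: "svalid (snd (srun L []))" "sletters (snd (srun L [])) = set L"
      using srun_Nil_props labelling_sorted[OF x(1)] by auto
    have xL: "x \<notin> set L" using x(3)[of x] by simp
    \<comment> \<open>Equal letters are labelled from left to right, so \<open>Suc k\<close> cannot
      be present before \<open>k\<close> arrives.\<close>
    have xk: "x \<noteq> k"
    proof
      assume "x = k"
      have v': "sletters S' = insert x (set L)"
        using sins_props[OF v(1) _ _ s] v(2) xL x(2) by auto
      have "Suc k \<in> sletters S'" using snoc.prems(2) S' by force
      then have "Suc k \<in> set L" using v' \<open>x = k\<close> by simp
      then show False using x(3)[of "Suc k"] snoc.prems(3) \<open>x = k\<close> by simp
    qed
    show ?case
      by (rule sins_prec[OF v(1) _ _ s snoc.prems(1,2)[unfolded S'] xk])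
        (use x(2) v(2) xL snoc.IH[OF _ _ snoc.prems(3) x(1)] in auto)
  qed
  have lets: "svalid ?S" "sletters ?S = set L" using srun_Nil_props labelling_sorted[OF assms] by auto
  have "prec (p, f) (q, g)"
    if "(k, p, f) \<in> set ?S" "(l, q, g) \<in> set ?S" "k < l" "k div N = l div N" for k p f l q g
    using that
  proof (induction l arbitrary: q g)
    case 0
    then show ?case by simp
  next
    case (Suc m)
    have km: "k \<le> m" using Suc.prems by simp
    have dv: "k div N = m div N" "m div N = Suc m div N"
      using div_le_mono[OF km, of N] div_le_mono[of m "Suc m" N] Suc.prems(4) by linarith+
    show ?case
    proof (cases "k = m")
      case True
      then have "(m, p, f) \<in> set ?S" using Suc.prems(1) by simp
      then show ?thesis using suc[OF _ Suc.prems(2) dv(2) assms] by blast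
    next
      case False
      have "Suc m \<in> set L" using lets(2) Suc.prems(2) by force
      then have "m \<in> set L" using labelling_block[OF assms _ _ dv(2)] by simp
      then obtain r h where r: "(m, r, h) \<in> set ?S" using lets(2) by force
      have "prec (p, f) (r, h)" using Suc.IH[OF Suc.prems(1) r] False km dv(1) by simp
      then show ?thesis using suc[OF r Suc.prems(2) dv(2) assms] prec_trans by blast
    qed
  qed
  then show ?thesis unfolding prec_sorted_def by blast
qed

theorem P_mix_labelling:
  assumes "labelling N L"
  shows "P_mix (map (\<lambda>k. k div N) L) = tableau (\<lambda>k. k div N) (snd (srun L []))"
  using assms
proof (induction L rule: rev_induct)
  case Nil
  then show ?case by (simp add: P_mix_def)
next
  case (snoc x L)
  let ?v = "\<lambda>k. k div N"
  let ?S = "snd (srun L [])"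
  have x: "labelling N L" "0 < x" "x \<notin> set L" using snoc.prems by (auto simp: labelling_snoc)
  obtain c S' where s: "sins x ?S = (c, S')" by (cases "sins x ?S")
  have S': "snd (srun (L @ [x]) []) = S'" using s by (simp add: snd_srun_append)
  have v: "svalid ?S" "x \<notin> sletters ?S"
    using srun_Nil_props labelling_sorted[OF x(1)] x(3) by auto
  have "ins_rel (Row 0) (?v x, False) (tableau ?v ?S) (tableau ?v S')"
    by (rule ins_rel_tableau[OF v(1) x(2) v(2) s])
      (simp add: mono_def div_le_mono, rule labelling_prec_sorted[OF snoc.prems, unfolded S'])
  then have "mix_insert (tableau ?v ?S) (?v x) = tableau ?v S'"
    unfolding mix_insert_def using ins_rel_unique by (blast intro: the_equality)
  then show ?case using snoc.IH[OF x(1)] S' by (simp add: P_mix_def)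
qed

section \<open>Relations between letters and relations between labels\<close>

lemma mix_rel_form:
  assumes "mix_rel p q"
  obtains (first) w x y z where "p = [w, x, y, z]" "q = [x, w, y, z]" "w \<noteq> x"
    | (middle) w x y z where "p = [w, x, y, z]" "q = [w, y, x, z]" "x \<noteq> y"
    | (last) w x y z where "p = [w, x, y, z]" "q = [w, x, z, y]" "y \<noteq> z"
  using assms unfolding mix_rel_def
  by (elim exE disjE conjE) ((erule (1) middle, simp) | (erule (1) last, simp) | (erule (1) first, simp))+

lemma mix_rel_swap:
  assumes "mix_rel p q"
  obtains s a b t where "p = s @ [a, b] @ t" "q = s @ [b, a] @ t" "a \<noteq> b"
  using assms
proof (cases rule: mix_rel_form)
  case (first w x y z)
  then show ?thesis using that[of "[]" w x "[y, z]"] by simp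
next
  case (middle w x y z)
  then show ?thesis using that[of "[w]" x y "[z]"] by simp
next
  case (last w x y z)
  then show ?thesis using that[of "[w, x]" y z "[]"] by simp
qed

lemma sorted_wrt_compat:
  assumes "sorted_wrt (\<lambda>x y. x < y \<longleftrightarrow> f x \<le> f y) [w, x, y, z]" "distinct [w, x, y, z]"
  shows "f w \<le> f x \<longleftrightarrow> w \<le> x" "f w \<le> f y \<longleftrightarrow> w \<le> y" "f w \<le> f z \<longleftrightarrow> w \<le> z"
    "f x \<le> f y \<longleftrightarrow> x \<le> y" "f x \<le> f z \<longleftrightarrow> x \<le> z" "f y \<le> f z \<longleftrightarrow> y \<le> (z :: nat)"
  using assms by (auto simp: le_less)

lemma mix_rel_neighbour:
  assumes "mix_rel p q \<or> mix_rel q p"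
  obtains w x y z where "p = [w, x, y, z]" "q \<in> {[x, w, y, z], [w, y, x, z], [w, x, z, y]}"
  using assms
proof
  assume "mix_rel p q"
  then show thesis by (cases rule: mix_rel_form) (rule that, assumption, simp)+
next
  assume "mix_rel q p"
  then show thesis by (cases rule: mix_rel_form) (rule that, assumption, simp)+
qed

text \<open>Once the exchanged neighbours are known, a relation is a condition on comparisons from
  left to right in the first word, and these agree for labels and letters. Only \<open>L\<close> is
  assumed sorted in this sense, so both directions are expressed through it.\<close>

lemma mix_rel_compat:
  assumes "sorted_wrt (\<lambda>x y. x < y \<longleftrightarrow> f x \<le> f y) L" "distinct L" "L = [w, x, y, z]"
    "M \<in> {[x, w, y, z], [w, y, x, z], [w, x, z, y]}"
  shows "mix_rel (map f L) (map f M) \<longleftrightarrow> mix_rel L M" "mix_rel (map f M) (map f L) \<longleftrightarrow> mix_rel M L"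
proof -
  note c = sorted_wrt_compat[OF assms(1,2)[unfolded assms(3)]]
  show "mix_rel (map f L) (map f M) \<longleftrightarrow> mix_rel L M" "mix_rel (map f M) (map f L) \<longleftrightarrow> mix_rel M L"
    using assms(4) unfolding insert_iff empty_iff
    by (elim disjE FalseE; simp only: assms(3) list.map mix_rel_first mix_rel_middle mix_rel_last c)+
qed

lemma mix_rel_map:
  assumes "sorted_wrt (\<lambda>x y. x < y \<longleftrightarrow> f x \<le> f y) L" "distinct L" "mix_rel L M \<or> mix_rel M L"
  shows "mix_rel (map f L) (map f M) \<or> mix_rel (map f M) (map f L)"
proof -
  obtain w x y z where L: "L = [w, x, y, z]" "M \<in> {[x, w, y, z], [w, y, x, z], [w, x, z, y]}"
    by (rule mix_rel_neighbour[OF assms(3)])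
  show ?thesis using assms(3) unfolding mix_rel_compat[OF assms(1,2) L] .
qed

lemma mix_rel_lift:
  assumes "sorted_wrt (\<lambda>x y. x < y \<longleftrightarrow> f x \<le> f y) L" "distinct L" "mix_rel (map f L) q \<or> mix_rel q (map f L)"
  obtains M where "mix_rel L M \<or> mix_rel M L" "map f M = q"
proof -
  obtain w' x' y' z' where f: "map f L = [w', x', y', z']" "q \<in> {[x', w', y', z'], [w', y', x', z'], [w', x', z', y']}"
    by (rule mix_rel_neighbour[OF assms(3)])
  have "length L = 4" using arg_cong[OF f(1), of length] by simp
  then obtain w x y z where L: "L = [w, x, y, z]" by (auto simp: numeral_eq_Suc length_Suc_conv)
  then have "q \<in> map f ` {[x, w, y, z], [w, y, x, z], [w, x, z, y]}" using f by simp
  then obtain M where M: "M \<in> {[x, w, y, z], [w, y, x, z], [w, x, z, y]}" "map f M = q" by (elim imageE) simp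
  show thesis
    by (rule that[OF _ M(2)]) (use assms(3) in \<open>simp only: mix_rel_compat[OF assms(1,2) L M(1)] M(2)[symmetric]\<close>)
qed

lemma labelling_factor:
  assumes "labelling N (X @ p @ Y)" "mix_rel p q \<or> mix_rel q p"
    "mix_rel (map (\<lambda>k. k div N) p) (map (\<lambda>k. k div N) q) \<or> mix_rel (map (\<lambda>k. k div N) q) (map (\<lambda>k. k div N) p)"
  shows "labelling N (X @ q @ Y)"
proof -
  let ?v = "\<lambda>k. k div N"
  have d: "distinct p" using labelling_sorted[OF assms(1)] by simp
  obtain s a b t where p: "p = s @ [a, b] @ t" "q = s @ [b, a] @ t"
  proof -
    from assms(2) show thesis
    proof
      assume "mix_rel p q"
      then show ?thesis by (rule mix_rel_swap) (rule that)
    next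
      assume "mix_rel q p"
      then show ?thesis by (rule mix_rel_swap) (rule that)
    qed
  qed
  \<comment> \<open>With equal letters the move would relate a word to itself, but every relation
    exchanges different letters.\<close>
  have "?v a \<noteq> ?v b"
  proof
    assume "?v a = ?v b"
    then have e: "map ?v p = map ?v q" using p by simp
    have "mix_rel r r \<Longrightarrow> False" for r by (erule mix_rel_swap) simp
    then show False using assms(3) e by auto
  qed
  then show ?thesis using labelling_swap[of N "X @ s" a b "t @ Y"] assms(1) p by simp
qed

lemma P_mix_mix_move:
  assumes "is_word u" "mix_move u v"
  shows "P_mix u = P_mix v"
proof -
  let ?N = "Suc (length u)"
  let ?v = "\<lambda>k. k div ?N"
  obtain L where L: "labelling ?N L" "map ?v L = u"
    using labelling_exists[of u ?N] assms(1) unfolding is_word_def by auto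
  obtain x p q y where uv: "u = x @ p @ y" "v = x @ q @ y" "mix_rel p q \<or> mix_rel q p"
    using assms(2) unfolding mix_move_def by blast
  obtain X P Y where XPY: "L = X @ P @ Y" "map ?v X = x" "map ?v P = p" "map ?v Y = y"
  proof -
    have "map ?v L = x @ p @ y" using L(2) uv(1) by (rule trans)
    then obtain X L' where 1: "L = X @ L'" "x = map ?v X" "p @ y = map ?v L'" unfolding map_eq_append_conv by blast
    from 1(3)[symmetric] obtain P Y where "L' = P @ Y" "p = map ?v P" "y = map ?v Y"
      unfolding map_eq_append_conv by blast
    then show thesis using that 1 by simp
  qed
  have s: "distinct L" "0 \<notin> set L" "distinct P" "sorted_wrt (\<lambda>k l. k < l \<longleftrightarrow> ?v k \<le> ?v l) P"
    using labelling_sorted[OF L(1)] unfolding XPY(1) by (auto simp: sorted_wrt_append)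
  obtain Q where Q: "mix_rel P Q \<or> mix_rel Q P" "map ?v Q = q"
    using mix_rel_lift[OF s(4,3)] uv(3) unfolding XPY(3)[symmetric] by blast
  have l: "labelling ?N (X @ Q @ Y)"
    using labelling_factor[OF L(1)[unfolded XPY(1)] Q(1)] uv(3) XPY(3) Q(2) by simp
  have "mix_move (X @ P @ Y) (X @ Q @ Y)" using Q(1) unfolding mix_move_def by blast
  then have "snd (srun (X @ P @ Y) []) = snd (srun (X @ Q @ Y) [])"
    using srun_mix_move[of "[]"] s(1,2) XPY(1) by simp
  moreover have "u = map ?v (X @ P @ Y)" "v = map ?v (X @ Q @ Y)"
    using uv XPY Q(2) by auto
  ultimately show ?thesis using P_mix_labelling[OF l] P_mix_labelling[OF L(1)[unfolded XPY(1)]] by simp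
qed

lemma mix_moves_map:
  assumes "labelling N L" "mix_move\<^sup>*\<^sup>* L M"
  shows "labelling N M \<and> mix_move\<^sup>*\<^sup>* (map (\<lambda>k. k div N) L) (map (\<lambda>k. k div N) M)"
  using assms(2)
proof (induction rule: rtranclp_induct)
  case base
  then show ?case using assms(1) by simp
next
  case (step M M')
  let ?v = "\<lambda>k. k div N"
  obtain x p q y where m: "M = x @ p @ y" "M' = x @ q @ y" "mix_rel p q \<or> mix_rel q p"
    using step(2) unfolding mix_move_def by blast
  have l: "labelling N (x @ p @ y)" using step.IH m(1) by simp
  have s: "distinct p" "sorted_wrt (\<lambda>k l. k < l \<longleftrightarrow> ?v k \<le> ?v l) p"
    using labelling_sorted[OF l] by (auto simp: sorted_wrt_append)
  have r: "mix_rel (map ?v p) (map ?v q) \<or> mix_rel (map ?v q) (map ?v p)"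
    using mix_rel_map[OF s(2,1) m(3)] .
  then have "mix_move (map ?v M) (map ?v M')"
    unfolding mix_move_def m(1,2) map_append by blast
  then show ?case using step.IH labelling_factor[OF l m(3) r] m(2) by (auto intro: rtranclp.rtrancl_into_rtrancl)
qed

section \<open>Recovering the labels from the tableau\<close>

lemma sorted_wrt_unique:
  assumes "\<And>a b. R a b \<Longrightarrow> \<not> R b a" "sorted_wrt R xs" "sorted_wrt R ys" "set xs = set ys"
  shows "xs = ys"
  using assms(2-4)
proof (induction xs arbitrary: ys)
  case (Cons x xs)
  then obtain y ys' where y: "ys = y # ys'" by (cases ys) auto
  have "x = y"
  proof (rule ccontr)
    assume "x \<noteq> y"
    then have "x \<in> set ys'" "y \<in> set xs" using Cons.prems(3) y by auto
    then show False using Cons.prems(1,2) y assms(1) by auto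
  qed
  moreover have "x \<notin> set xs" "y \<notin> set ys'" using Cons.prems(1,2) y assms(1) by auto
  ultimately show ?case using Cons y by (metis insert_ident list.simps(15) sorted_wrt.simps(2))
qed simp

lemma count_list_map_distinct: "distinct xs \<Longrightarrow> count_list (map f xs) a = card {x \<in> set xs. f x = a}"
proof (induction xs)
  case (Cons x xs)
  have "{y \<in> set (x # xs). f y = a} = (if f x = a then insert x {y \<in> set xs. f y = a} else {y \<in> set xs. f y = a})"
    by auto
  then show ?case using Cons by simp
qed simp

lemma svalid_sorted: "svalid S \<Longrightarrow> sorted_wrt (\<lambda>e e'. fst e' < fst e) S"
  by (induction S rule: svalid.induct) auto

text \<open>The tableau forgets the labels but not their order: sorted by letter and then by
  \<open>prec\<close>, its entries appear in the order of the labels. Their multiplicities give the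
  set of labels, so the labelled tableaux coincide and the distinct case applies.\<close>

lemma mix_moves_of_P_mix:
  assumes "is_word u" "is_word v" "P_mix u = P_mix v"
  shows "mix_move\<^sup>*\<^sup>* u v"
proof -
  let ?N = "Suc (length u + length v)"
  \<comment> \<open>Both words share one modulus, so equal multiplicities lead to equal sets of
    labels.\<close>
  let ?v = "\<lambda>k. k div ?N"
  obtain L where L: "labelling ?N L" "map ?v L = u" "set L = {k. k mod ?N < count_list u (?v k)}"
    using labelling_exists[of u ?N] assms(1) unfolding is_word_def by auto
  obtain M where M: "labelling ?N M" "map ?v M = v" "set M = {k. k mod ?N < count_list v (?v k)}"
    using labelling_exists[of v ?N] assms(2) unfolding is_word_def by auto
  define S where "S = snd (srun L [])"
  define T where "T = snd (srun M [])"
  have LM: "distinct L" "0 \<notin> set L" "distinct M" "0 \<notin> set M"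
    using labelling_sorted[OF L(1)] labelling_sorted[OF M(1)] by auto
  have S: "svalid S" "sletters S = set L" "prec_sorted ?v S" and T: "svalid T" "sletters T = set M" "prec_sorted ?v T"
    using srun_Nil_props LM labelling_prec_sorted[OF L(1)] labelling_prec_sorted[OF M(1)] by (auto simp: S_def T_def)
  have tab: "tableau ?v S = tableau ?v T"
    using P_mix_labelling[OF L(1)] P_mix_labelling[OF M(1)] assms(3) L(2) M(2) by (simp add: S_def T_def)
  define key :: "entry \<Rightarrow> nat \<times> cell \<times> bool" where "key = (\<lambda>(k, p, f). (?v k, p, f))"
  define R :: "nat \<times> cell \<times> bool \<Rightarrow> nat \<times> cell \<times> bool \<Rightarrow> bool" where "R = (\<lambda>(a, e) (b, e'). b < a \<or> a = b \<and> prec e' e)"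
  have set_key: "set (map key U) = {(a, p, f). tableau ?v U p = Some (a, f)}" if "svalid U" for U
    using tableau_Some[OF that] tableau_SomeD[of ?v U] by (fastforce simp: key_def)
  have sorted_key: "sorted_wrt R (map key U)" if "svalid U" "prec_sorted ?v U" for U
    unfolding sorted_wrt_map
  proof (rule sorted_wrt_mono_rel[OF _ svalid_sorted[OF that(1)]])
    fix e e' assume h: "e \<in> set U" "e' \<in> set U" "fst e' < fst e"
    obtain k p f where e: "e = (k, p, f)" by (cases e)
    obtain l q g where e': "e' = (l, q, g)" by (cases e')
    have "l < k" using h(3) e e' by simp
    then have "?v l \<le> ?v k" by (simp add: div_le_mono)
    moreover have "prec (q, g) (p, f)" if "?v l = ?v k"
      using \<open>prec_sorted ?v U\<close> h(1,2) \<open>l < k\<close> that unfolding prec_sorted_def e e' by blast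
    ultimately show "R (key e) (key e')"
      unfolding e e' R_def key_def prod.case by (metis le_neq_implies_less)
  qed
  have keys: "map key S = map key T"
  proof (rule sorted_wrt_unique[of R])
    show "\<not> R b a" if "R a b" for a b
    proof -
      obtain x e y e' where ab: "a = (x, e)" "b = (y, e')" by (cases a; cases b)
      have "y < x \<or> x = y \<and> prec e' e" using that unfolding ab R_def prod.case .
      moreover have "\<not> (prec e' e \<and> prec e e')" using prec_trans prec_irrefl by blast
      ultimately show ?thesis unfolding ab R_def prod.case by auto
    qed
    show "sorted_wrt R (map key S)" "sorted_wrt R (map key T)"
      by (rule sorted_key[OF S(1,3)], rule sorted_key[OF T(1,3)])
    show "set (map key S) = set (map key T)" unfolding set_key[OF S(1)] set_key[OF T(1)] tab ..
  qed
  have cnt: "count_list w a = count_list (map fst (map key U)) a"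
    if "svalid U" "sletters U = set K" "distinct K" "map ?v K = w" for w a U K
  proof -
    have e: "map fst (map key U) = map ?v (map fst U)" by (simp add: key_def case_prod_beta)
    have d: "distinct (map fst U)"
      using svalid_sorted[OF that(1)] by (induction U) auto
    have "count_list (map ?v (map fst U)) a = card {x \<in> set K. ?v x = a}"
      unfolding count_list_map_distinct[OF d] using that(2) by simp
    moreover have "count_list w a = card {x \<in> set K. ?v x = a}"
      using count_list_map_distinct[OF that(3), of ?v a] that(4) by simp
    ultimately show ?thesis unfolding e by simp
  qed
  have "count_list u a = count_list v a" for a
    using cnt[OF S(1,2) LM(1) L(2), of a] cnt[OF T(1,2) LM(3) M(2), of a] keys by simp
  then have LMs: "set L = set M" using L(3) M(3) by simp
  have "map fst S = map fst T"
  proof (rule sorted_wrt_unique[of "\<lambda>k l. l < k"])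
    show "sorted_wrt (\<lambda>k l. l < k) (map fst S)" "sorted_wrt (\<lambda>k l. l < k) (map fst T)"
      unfolding sorted_wrt_map using svalid_sorted S(1) T(1) by blast+
    show "set (map fst S) = set (map fst T)" using S(2) T(2) LMs by simp
  qed simp
  moreover have "map snd S = map snd T"
  proof -
    have "map snd (map key U) = map snd U" for U by (simp add: key_def case_prod_beta)
    then show ?thesis using keys by metis
  qed
  ultimately have "S = T" by (rule pair_list_eqI)
  then have "mix_move\<^sup>*\<^sup>* L M" using mix_moves_of_srun[OF LM] by (simp add: S_def T_def)
  from mix_moves_map[OF L(1) this] show ?thesis unfolding L(2) M(2) by (rule conjunct2)
qed

lemma is_word_mix_move: "is_word u \<Longrightarrow> mix_move u v \<Longrightarrow> is_word v"
proof -
  assume a: "is_word u" "mix_move u v"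
  obtain x p q y where uv: "u = x @ p @ y" "v = x @ q @ y" "mix_rel p q \<or> mix_rel q p"
    using a(2) unfolding mix_move_def by blast
  then have "set p = set q" using mix_rel_perm by blast
  then show ?thesis using a(1) uv(1,2) by (simp add: is_word_def)
qed

lemma P_mix_mix_moves: "mix_move\<^sup>*\<^sup>* u v \<Longrightarrow> is_word u \<Longrightarrow> is_word v \<and> P_mix u = P_mix v"
  by (induction rule: rtranclp_induct) (auto dest: is_word_mix_move P_mix_mix_move)

theorem mainTheorem1:
  shows "(\<forall>u v. is_word u \<longrightarrow> is_word v \<longrightarrow>
            (P_mix u = P_mix v \<longleftrightarrow> mix_move\<^sup>*\<^sup>* u v)) \<and>
         (\<forall>u u' v v'. is_word u \<longrightarrow> is_word u' \<longrightarrow> is_word v \<longrightarrow> is_word v' \<longrightarrow>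
            P_mix u = P_mix u' \<longrightarrow> P_mix v = P_mix v' \<longrightarrow>
            P_mix (u @ v) = P_mix (u' @ v'))"
proof -
  have iff: "P_mix u = P_mix v \<longleftrightarrow> mix_move\<^sup>*\<^sup>* u v" if "is_word u" "is_word v" for u v
    using mix_moves_of_P_mix[OF that] P_mix_mix_moves that by blast
  have "P_mix (u @ v) = P_mix (u' @ v')"
    if w: "is_word u" "is_word u'" "is_word v" "is_word v'" and e: "P_mix u = P_mix u'" "P_mix v = P_mix v'" for u u' v v'
  proof -
    have "mix_move\<^sup>*\<^sup>* (u @ v) (u' @ v)"
      using mix_moves_context[of u u' "[]" v] iff[OF w(1,2)] e(1) by simp
    also have "mix_move\<^sup>*\<^sup>* (u' @ v) (u' @ v')"
      using mix_moves_context[of v v' u' "[]"] iff[OF w(3,4)] e(2) by simp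
    finally have "mix_move\<^sup>*\<^sup>* (u @ v) (u' @ v')" .
    moreover have "is_word (u @ v)" using w by (auto simp: is_word_def)
    ultimately show ?thesis using P_mix_mix_moves by blast
  qed
  then show ?thesis using iff by blast
qed

end
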